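(* Let $k,n,D\in\mathbb{N}$ and $T>0$. Let $V\in C^k([0,T]\times\mathbb{R}^n\times[0,1]^D;\mathbb{R}^n)$ and suppose there is $C>0$ with $|V(t,x,\eta)|\le C(1+|x|)$ for all $(t,x,\eta)\in[0,T]\times\mathbb{R}^n\times[0,1]^D$. Let $r>0$ and let $u_0\in C^1(\mathbb{R}^n)$ be $r$-approximable by NNs. Let $u\in C^1([0,T]\times\mathbb{R}^n\times[0,1]^D)$ denote the unique solution of the Cauchy problem $$\partial_t u(t,x,\eta)+V(t,x,\eta)\cdot\nabla_x u(t,x,\eta)=0,\qquad u(0,x,\eta)=u_0(x).$$ Set $d:=1+n+D$. Then for every compact $K\subset\mathbb{R}^n$ there exists a constant $c=c(n,r,d,k,K,T,\|V\|_{C^k},u_0)>0$ (depending only on the indicated quantities, in particular not on $\varepsilon$) such that for every $\varepsilon\in(0,1)$ there exists a NN $\Phi^{\overline u,\varepsilon}$ with $d$-dimensional input such that, for the restriction $\overline u:=u|_{[0,T]\times K\times[0,1]^D}$, (i) $L(\Phi^{\overline u,\varepsilon})\le c\cdot(\ln(1/\varepsilon)+1)$; (ii) $W(\Phi^{\overline u,\varepsilon})\le c\cdot(\varepsilon^{-1/r}+\varepsilon^{-d/k})\cdot(\ln(1/\varepsilon)+1)$; (iii) $\|\overline u-\mathrm{R}(\Phi^{\overline u,\varepsilon})\|_{L^\infty([0,T]\times K\times[0,1]^D)}<\varepsilon$.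
   Context: $\mathbb{N}=\{1,2,\dots\}$. Neural networks: for $m,L\in\mathbb{N}$, a neural network (NN) $\Phi$ with input dimension $m$ and $L$ layers is a sequence $\Phi=((A_1,b_1),\dots,(A_L,b_L))$ where, with $N_0=m$ and some $N_1,\dots,N_L\in\mathbb{N}$, each $A_\ell$ is a real $N_\ell\times\sum_{j=0}^{\ell-1}N_j$ matrix and $b_\ell\in\mathbb{R}^{N_\ell}$. With $\varrho(x)=\max\{0,x\}$ (ReLU, applied componentwise), its realisation $\mathrm{R}(\Phi):\mathbb{R}^m\to\mathbb{R}^{N_L}$ is $\mathrm{R}(\Phi)(x)=x_L$, where $x_0:=x$, $x_\ell:=\varrho(A_\ell[x_0^T|\dots|x_{\ell-1}^T]^T+b_\ell)$ for $\ell=1,\dots,L-1$, and $x_L:=A_L[x_0^T|\dots|x_{L-1}^T]^T+b_L$. $N_L$ is the output dimension, $L(\Phi):=L$ the number of layers, and $W(\Phi):=\sum_{j=1}^L(\|A_j\|_0+\|b_j\|_0)$ the number of weights, where $\|\cdot\|_0$ counts nonzero entries. NNs approximating scalar functions have output dimension $1$. Approximability: $f\in L^\infty(\mathbb{R}^n)$ is $r$-approximable by NNs ($r>0$) if for every compact $K\subset\mathbb{R}^n$ there is a constant $c=c(K,r,f)>0$ such that for every $\varepsilon\in(0,1)$ there is a NN $\Phi^{f,\varepsilon}$ (input dimension $n$) with $L(\Phi^{f,\varepsilon})\le c\cdot(\ln(1/\varepsilon)+1)$, $W(\Phi^{f,\varepsilon})\le c\,\varepsilon^{-1/r}$, and $\|f-\mathrm{R}(\Phi^{f,\varepsilon})\|_{L^\infty(K)}\le\varepsilon$.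 Norms: $\|g\|_{C^k(\Omega)}=\max_{|\alpha|\le k}\sup_{x\in\Omega}|D^\alpha g(x)|$. Writing $|K|:=\max_{x\in K}|x|$, $\|V\|_{C^k}$ is taken over $[0,T]\times B_{G_0}(0)\times[0,1]^D$, where $B_{G_0}(0)\subset\mathbb{R}^n$ is the closed ball of radius $G_0:=(|K|+CT)\exp(CT)$ about $0$. *)

theory Defs
  imports
    "HOL-Analysis.Analysis"
    "HOL-Probability.Essential_Supremum"
    "Jordan_Normal_Form.Matrix"
begin

unbundle no vec_syntax

section \<open>Coordinates\<close>

text \<open>An arbitrary but fixed ordering of the standard basis. It orders the coordinates in which a
  network reads its input, and the factors of the mixed partial derivatives below. The choice is
  immaterial: another one permutes columns of the weight matrices, or commuting derivatives.\<close>

definition basis_list :: "'a::euclidean_space list" where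
  "basis_list = (SOME bs. distinct bs \<and> set bs = Basis)"

lemma basis_list: "distinct (basis_list :: 'a::euclidean_space list)"
  "set (basis_list :: 'a list) = Basis"
proof -
  have "\<exists>bs :: 'a list. distinct bs \<and> set bs = Basis"
    using finite_distinct_list[OF finite_Basis] by blast
  from someI_ex[OF this] show "distinct (basis_list :: 'a list)" "set (basis_list :: 'a list) = Basis"
    unfolding basis_list_def by auto
qed

definition coords :: "'a::euclidean_space \<Rightarrow> real Matrix.vec" where
  "coords x = vec_of_list (map (\<lambda>b. x \<bullet> b) basis_list)"

section \<open>Neural networks\<close>

type_synonym nn = "(real mat \<times> real Matrix.vec) list"

text \<open>Layers are counted from \<open>0\<close>, so \<open>width \<Phi> l\<close> is \<open>N\<^bsub>l+1\<^esub>\<close>.\<close>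

definition width :: "nn \<Rightarrow> nat \<Rightarrow> nat" where
  "width \<Phi> l = dim_row (fst (\<Phi> ! l))"

definition is_nn :: "nat \<Rightarrow> nn \<Rightarrow> bool" where
  "is_nn m \<Phi> \<longleftrightarrow> 0 < m \<and> \<Phi> \<noteq> [] \<and>
     (\<forall>l<length \<Phi>. 0 < width \<Phi> l \<and>
        fst (\<Phi> ! l) \<in> carrier_mat (width \<Phi> l) (m + (\<Sum>j<l. width \<Phi> j)) \<and>
        snd (\<Phi> ! l) \<in> carrier_vec (width \<Phi> l))"

definition output_dim :: "nn \<Rightarrow> nat" where
  "output_dim \<Phi> = width \<Phi> (length \<Phi> - 1)"

definition relu :: "real \<Rightarrow> real" where
  "relu x = max 0 x"

text \<open>The vector argument is the concatenation of the input and of the outputs of all layers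
  evaluated so far.\<close>

fun realise :: "nn \<Rightarrow> real Matrix.vec \<Rightarrow> real Matrix.vec" where
  "realise [] z = z"
| "realise [(A, b)] z = A *\<^sub>v z + b"
| "realise ((A, b) # l # ls) z = realise (l # ls) (z @\<^sub>v map_vec relu (A *\<^sub>v z + b))"

definition nn_fun :: "nn \<Rightarrow> 'a::euclidean_space \<Rightarrow> real" where
  "nn_fun \<Phi> x = vec_index (realise \<Phi> (coords x)) 0"

definition mat_nonzeros :: "real mat \<Rightarrow> nat" where
  "mat_nonzeros A = card {(i, j). i < dim_row A \<and> j < dim_col A \<and> A $$ (i, j) \<noteq> 0}"

definition vec_nonzeros :: "real Matrix.vec \<Rightarrow> nat" where
  "vec_nonzeros b = card {i. i < dim_vec b \<and> vec_index b i \<noteq> 0}"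

definition num_layers :: "nn \<Rightarrow> nat" where
  "num_layers \<Phi> = length \<Phi>"

definition num_weights :: "nn \<Rightarrow> nat" where
  "num_weights \<Phi> = (\<Sum>(A, b)\<leftarrow>\<Phi>. mat_nonzeros A + vec_nonzeros b)"

section \<open>Approximability\<close>

text \<open>If \<open>S\<close> is a null set, this is \<open>-\<infinity>\<close> instead of \<open>0\<close>, which makes no difference to
  upper bounds by positive numbers.\<close>

definition Linf_norm :: "'a::euclidean_space set \<Rightarrow> ('a \<Rightarrow> real) \<Rightarrow> ereal" where
  "Linf_norm S f = esssup (lebesgue_on S) (\<lambda>x. ereal \<bar>f x\<bar>)"

definition nn_approximable :: "real \<Rightarrow> ('a::euclidean_space \<Rightarrow> real) \<Rightarrow> bool" where
  "nn_approximable r f \<longleftrightarrow>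
     f \<in> borel_measurable lebesgue \<and> Linf_norm UNIV f < \<infinity> \<and>
     (\<forall>K. compact K \<longrightarrow> (\<exists>c>0. \<forall>\<epsilon>\<in>{0<..<1}. \<exists>\<Phi>.
        is_nn DIM('a) \<Phi> \<and> output_dim \<Phi> = 1 \<and>
        real (num_layers \<Phi>) \<le> c * (ln (1 / \<epsilon>) + 1) \<and>
        real (num_weights \<Phi>) \<le> c * \<epsilon> powr (- 1 / r) \<and>
        Linf_norm K (\<lambda>x. f x - nn_fun \<Phi> x) \<le> ereal \<epsilon>))"

section \<open>Functions of class \<open>C\<^sup>k\<close> on a product of intervals\<close>

text \<open>Derivatives are taken within \<open>S\<close>, hence one-sided at the boundary. They are meaningful when
  every section of \<open>S\<close> parallel to a coordinate axis is a nondegenerate interval.\<close>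

definition partial_deriv ::
    "'a::euclidean_space set \<Rightarrow> 'a \<Rightarrow> ('a \<Rightarrow> 'b::real_normed_vector) \<Rightarrow> 'a \<Rightarrow> 'b" where
  "partial_deriv S b f x =
     vector_derivative (\<lambda>s. f (x + s *\<^sub>R b)) (at 0 within {s. x + s *\<^sub>R b \<in> S})"

definition has_partial ::
    "'a::euclidean_space set \<Rightarrow> 'a \<Rightarrow> ('a \<Rightarrow> 'b::real_normed_vector) \<Rightarrow> bool" where
  "has_partial S b f \<longleftrightarrow>
     (\<forall>x\<in>S. (\<lambda>s. f (x + s *\<^sub>R b)) differentiable (at 0 within {s. x + s *\<^sub>R b \<in> S}))"

fun Ck_on ::
    "nat \<Rightarrow> 'a::euclidean_space set \<Rightarrow> ('a \<Rightarrow> 'b::real_normed_vector) \<Rightarrow> bool" where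
  "Ck_on 0 S f \<longleftrightarrow> continuous_on S f"
| "Ck_on (Suc k) S f \<longleftrightarrow> continuous_on S f \<and>
     (\<forall>b\<in>Basis. has_partial S b f \<and> Ck_on k S (partial_deriv S b f))"

text \<open>A multi-index is a function on vectors that vanishes off the standard basis.\<close>

definition multi_indices :: "nat \<Rightarrow> ('a::euclidean_space \<Rightarrow> nat) set" where
  "multi_indices k = {\<alpha>. (\<forall>b. b \<notin> Basis \<longrightarrow> \<alpha> b = 0) \<and> sum \<alpha> Basis \<le> k}"

definition multi_deriv :: "'a::euclidean_space set \<Rightarrow> ('a \<Rightarrow> nat) \<Rightarrow>
    ('a \<Rightarrow> 'b::real_normed_vector) \<Rightarrow> 'a \<Rightarrow> 'b" where
  "multi_deriv S \<alpha> f = foldr (\<lambda>b. partial_deriv S b ^^ \<alpha> b) basis_list f"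

text \<open>The norm over \<open>\<Omega> \<subseteq> S\<close> of a function on \<open>S\<close>. Keeping \<open>S\<close> as the domain of
  differentiation avoids partial derivatives within degenerate sections of \<open>\<Omega>\<close>, such as the single
  point in which a tangent line meets a ball.\<close>

definition Ck_norm :: "nat \<Rightarrow> 'a::euclidean_space set \<Rightarrow> 'a set \<Rightarrow>
    ('a \<Rightarrow> 'b::real_normed_vector) \<Rightarrow> real" where
  "Ck_norm k S \<Omega> f = (MAX \<alpha>\<in>multi_indices k. SUP x\<in>\<Omega>. norm (multi_deriv S \<alpha> f x))"

section \<open>The transport equation\<close>

definition param_cyl :: "real \<Rightarrow> (real^'n) set \<Rightarrow> (real \<times> (real^'n) \<times> (real^'D)) set" where
  "param_cyl T X = {0..T} \<times> X \<times> cbox 0 1"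

definition transport_solution :: "real \<Rightarrow> (real \<times> (real^'n) \<times> (real^'D) \<Rightarrow> real^'n) \<Rightarrow>
    (real^'n \<Rightarrow> real) \<Rightarrow> (real \<times> (real^'n) \<times> (real^'D) \<Rightarrow> real) \<Rightarrow> bool" where
  "transport_solution T V u0 u \<longleftrightarrow>
     (let S = param_cyl T UNIV in
      Ck_on 1 S u \<and>
      (\<forall>p\<in>S. partial_deriv S (1, 0, 0) u p +
         V p \<bullet> vec_lambda (\<lambda>i. partial_deriv S (0, axis i 1, 0) u p) = 0) \<and>
      (\<forall>x. \<forall>\<eta>\<in>cbox 0 1. u (0, x, \<eta>) = u0 x))"

definition set_bound :: "'a::real_normed_vector set \<Rightarrow> real" where
  "set_bound K = (SUP x\<in>K. norm x)"

definition flow_radius :: "(real^'n) set \<Rightarrow> real \<Rightarrow> real \<Rightarrow> real" where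
  "flow_radius K C T = (set_bound K + C * T) * exp (C * T)"

end

theory Submission
  imports Defs
begin

text \<open>The characteristics are replaced by the explicit Euler scheme, so that no theory of ordinary
  differential equations is needed. With \<open>N\<close> steps of size \<open>t / N\<close> backwards in time, the scheme leads
  from \<open>(t, x, \<eta>)\<close> to a point \<open>E\<^sub>N (t, x, \<eta>)\<close> at time \<open>0\<close>, and \<open>u - u\<^sub>0 \<circ> E\<^sub>N\<close> tends to \<open>0\<close> uniformly on
  compact sets because \<open>u\<close> is \<open>C\<^sup>1\<close> and solves the equation. The number \<open>N\<close> may depend on everything,
  since the constants do not see it: uniformly in \<open>N\<close>, the map \<open>E\<^sub>N\<close> has expansions into
  polynomials of degree \<open>< k\<close> with remainder of order \<open>k\<close> at a scale \<open>\<rho>\<close> that depends only on the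
  \<open>C\<^sup>k\<close> norm of \<open>V\<close>. This is a discrete Gronwall argument in a normed algebra of truncated polynomials
  with remainder, in which every step multiplies the norm by at most \<open>1 + O(1 / N)\<close>.

  A function with such expansions is approximated by gluing the polynomials with a partition of
  unity of hat functions on a grid of width proportional to \<open>\<epsilon>\<^bsup>1/k\<^esup>\<close>; each of the \<open>O(\<epsilon>\<^bsup>-d/k\<^esup>)\<close> products
  costs \<open>O(ln (1/\<epsilon>) + 1)\<close> weights. Composing with a network for the Lipschitz function \<open>u\<^sub>0\<close> gives
  the claim.\<close>

section \<open>Truncated polynomial expansions\<close>

text \<open>The solution has only one derivative at its disposal, because \<open>u0\<close> is
  merely of class C^1. Expansions of order k exist for the inner map alone, and this is why the
  network for \<open>u0\<close> is kept as a separate outer factor. The discrete Gronwall argument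
  has to survive composition with the nonlinear field V. Substituting a jet with bound A into a
  polynomial produces powers of A, and a recursion with such powers may blow up. Hence the variable
  is rescaled by \<rho> = exp (- C2): the identity then has the bound \<rho>, growth by the factor 1
  + C2 / N in each of N steps never lifts it above 1, and for A \<le> 1 all positive powers of A are
  at most A. The recursion becomes linear. This works for expansions without constant term only. The
  growth constant C serves to keep the iterates in the ball over which the norm of V is taken. Since
  c must not depend on C, the sizes that enter c are measured by \<kappa> + T * M, the displacement
  at speed at most M, instead of the radius G.\<close>

no_notation Matrix.scalar_prod (infix "\<bullet>" 70)

definition words :: "nat \<Rightarrow> 'a::euclidean_space list set" where
  "words k = {w. set w \<subseteq> Basis \<and> length w < k}"

text \<open>Words over the basis take the place of multi-indices: monomials multiply by concatenation, and
  no multinomial coefficients occur.\<close>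

definition wpow :: "'a::euclidean_space \<Rightarrow> 'a list \<Rightarrow> real" where
  "wpow z w = (\<Prod>b\<leftarrow>w. z \<bullet> b)"

lemma finite_words [simp]: "finite (words k)"
  by (rule finite_subset[OF _ finite_lists_length_le[OF finite_Basis, of k]]) (auto simp: words_def)

lemma wpow_Nil [simp]: "wpow z [] = 1"
  and wpow_Cons [simp]: "wpow z (b # w) = (z \<bullet> b) * wpow z w"
  and wpow_append [simp]: "wpow z (v @ w) = wpow z v * wpow z w"
  by (simp_all add: wpow_def)

lemma wpow_scaleR: "wpow (c *\<^sub>R z) w = c ^ length w * wpow z w"
  by (induction w) simp_all

lemma abs_wpow_le: "set w \<subseteq> Basis \<Longrightarrow> \<bar>wpow z w\<bar> \<le> norm z ^ length w"
  by (induction w) (auto simp: abs_mult intro!: mult_mono Basis_le_norm)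

lemma abs_wpow_le_norm:
  assumes "w \<in> words k - {[]}" "norm z \<le> 1"
  shows "\<bar>wpow z w\<bar> \<le> norm z"
proof -
  have "\<bar>wpow z w\<bar> \<le> norm z ^ length w" using assms by (intro abs_wpow_le) (auto simp: words_def)
  also have "\<dots> \<le> norm z ^ 1" using assms by (intro power_decreasing) (auto simp: Suc_le_eq)
  finally show ?thesis by simp
qed

text \<open>Expansions without constant term. Bounding the coefficients and the remainder by one number \<open>A\<close>
  makes the bound submultiplicative.\<close>

definition jet :: "nat \<Rightarrow> 'a::euclidean_space set \<Rightarrow> real \<Rightarrow> ('a \<Rightarrow> real) \<Rightarrow> bool" where
  "jet k Z A f \<longleftrightarrow> (\<exists>a B. 0 \<le> B \<and> (\<Sum>w\<in>words k - {[]}. \<bar>a w\<bar>) + B \<le> A \<and>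
     (\<forall>z\<in>Z. \<bar>f z - (\<Sum>w\<in>words k - {[]}. a w * wpow z w)\<bar> \<le> B * norm z ^ k))"

lemma jetE:
  assumes "jet k Z A f"
  obtains a B where "0 \<le> B" "(\<Sum>w\<in>words k - {[]}. \<bar>a w\<bar>) + B \<le> A"
    "\<And>z. z \<in> Z \<Longrightarrow> \<bar>f z - (\<Sum>w\<in>words k - {[]}. a w * wpow z w)\<bar> \<le> B * norm z ^ k"
  using assms unfolding jet_def by blast

lemma jetI:
  assumes "0 \<le> B" "(\<Sum>w\<in>words k - {[]}. \<bar>a w\<bar>) + B \<le> A"
    "\<And>z. z \<in> Z \<Longrightarrow> \<bar>f z - (\<Sum>w\<in>words k - {[]}. a w * wpow z w)\<bar> \<le> B * norm z ^ k"
  shows "jet k Z A f"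
  using assms unfolding jet_def by blast

lemma jet_nonneg: "jet k Z A f \<Longrightarrow> 0 \<le> A"
  by (erule jetE) (meson add_nonneg_nonneg sum_nonneg abs_ge_zero order_trans)

lemma jet_mono: "jet k Z A f \<Longrightarrow> A \<le> A' \<Longrightarrow> jet k Z A' f"
  unfolding jet_def by (meson order_trans)

lemma jet_remainder:
  assumes "0 \<le> B" "\<And>z. z \<in> Z \<Longrightarrow> \<bar>f z\<bar> \<le> B * norm z ^ k"
  shows "jet k Z B f"
  by (rule jetI[where a = "\<lambda>_. 0" and B = B]) (use assms in auto)

lemma jet_zero: "jet k Z 0 (\<lambda>_. 0)"
  by (rule jet_remainder) auto

lemma jet_add:
  assumes "jet k Z A f" "jet k Z A' g"
  shows "jet k Z (A + A') (\<lambda>z. f z + g z)"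
proof -
  obtain a B where a: "0 \<le> B" "(\<Sum>w\<in>words k - {[]}. \<bar>a w\<bar>) + B \<le> A"
    "\<And>z. z \<in> Z \<Longrightarrow> \<bar>f z - (\<Sum>w\<in>words k - {[]}. a w * wpow z w)\<bar> \<le> B * norm z ^ k"
    using assms(1) by (elim jetE) blast
  obtain a' B' where b: "0 \<le> B'" "(\<Sum>w\<in>words k - {[]}. \<bar>a' w\<bar>) + B' \<le> A'"
    "\<And>z. z \<in> Z \<Longrightarrow> \<bar>g z - (\<Sum>w\<in>words k - {[]}. a' w * wpow z w)\<bar> \<le> B' * norm z ^ k"
    using assms(2) by (elim jetE) blast
  show ?thesis
  proof (rule jetI[where B = "B + B'" and a = "\<lambda>w. a w + a' w"])
    have "(\<Sum>w\<in>words k - {[]}. \<bar>a w + a' w\<bar>)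
        \<le> (\<Sum>w\<in>words k - {[]}. \<bar>a w\<bar> + \<bar>a' w\<bar>)"
      by (intro sum_mono abs_triangle_ineq)
    then show "(\<Sum>w\<in>words k - {[]}. \<bar>a w + a' w\<bar>) + (B + B') \<le> A + A'"
      using a b by (simp add: sum.distrib)
    show "\<bar>f z + g z - (\<Sum>w\<in>words k - {[]}. (a w + a' w) * wpow z w)\<bar> \<le> (B + B') * norm z ^ k"
      if "z \<in> Z" for z
      using a(3)[OF that] b(3)[OF that] by (simp add: distrib_right sum.distrib)
  qed (use a b in auto)
qed

lemma jet_cmult:
  assumes "jet k Z A f"
  shows "jet k Z (\<bar>c\<bar> * A) (\<lambda>z. c * f z)"
proof -
  obtain a B where a: "0 \<le> B" "(\<Sum>w\<in>words k - {[]}. \<bar>a w\<bar>) + B \<le> A"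
    "\<And>z. z \<in> Z \<Longrightarrow> \<bar>f z - (\<Sum>w\<in>words k - {[]}. a w * wpow z w)\<bar> \<le> B * norm z ^ k"
    using assms by (elim jetE) blast
  show ?thesis
  proof (rule jetI[where B = "\<bar>c\<bar> * B" and a = "\<lambda>w. c * a w"])
    show "(\<Sum>w\<in>words k - {[]}. \<bar>c * a w\<bar>) + \<bar>c\<bar> * B \<le> \<bar>c\<bar> * A"
      using mult_left_mono[OF a(2), of "\<bar>c\<bar>"]
      by (simp add: abs_mult sum_distrib_left distrib_left)
    show "\<bar>c * f z - (\<Sum>w\<in>words k - {[]}. c * a w * wpow z w)\<bar> \<le> \<bar>c\<bar> * B * norm z ^ k"
      if "z \<in> Z" for z
      using mult_left_mono[OF a(3)[OF that], of "\<bar>c\<bar>"]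
      by (simp add: abs_mult[symmetric] sum_distrib_left right_diff_distrib mult.assoc)
  qed (use a in auto)
qed

lemma jet_sum:
  assumes "finite I" "\<And>i. i \<in> I \<Longrightarrow> jet k Z (A i) (f i)"
  shows "jet k Z (\<Sum>i\<in>I. A i) (\<lambda>z. \<Sum>i\<in>I. f i z)"
  using assms by (induction I rule: finite_induct) (auto intro: jet_zero jet_add)

lemma jet_coord:
  assumes "b \<in> Basis" "1 \<le> k"
  shows "jet k Z 1 (\<lambda>z. z \<bullet> b)"
proof (cases "k = 1")
  \<comment> \<open>With \<open>k = 1\<close> no nonempty word is short enough, so the coordinate
    itself has to be booked as remainder.\<close>
  case True
  then show ?thesis using assms by (intro jet_remainder) (auto simp: Basis_le_norm)
next
  case False
  then have in_words: "[b] \<in> words k - {[]}" using assms by (auto simp: words_def)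
  have s: "(\<Sum>w\<in>words k - {[]}. (if w = [b] then 1 else 0) * wpow z w) = z \<bullet> b" for z
    using in_words by (subst sum.remove[OF _ in_words]) (auto intro!: sum.neutral)
  have t: "(\<Sum>w\<in>words k - {[]}. \<bar>if w = [b] then 1 else 0 :: real\<bar>) = 1"
    using in_words by (subst sum.remove[OF _ in_words]) (auto intro!: sum.neutral)
  show ?thesis
    by (rule jetI[where B = 0 and a = "\<lambda>w. if w = [b] then 1 else 0"]) (auto simp: s t)
qed

text \<open>Without a constant term every monomial, and the remainder as well, carries a factor
  \<open>norm z\<close> on the unit ball. This is how the bound of a jet controls the actual size of
  the function.\<close>

lemma jet_bound:
  assumes "jet k Z A f" "z \<in> Z" "norm z \<le> 1" "1 \<le> k"
  shows "\<bar>f z\<bar> \<le> A * norm z"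
proof -
  obtain a B where a: "0 \<le> B" "(\<Sum>w\<in>words k - {[]}. \<bar>a w\<bar>) + B \<le> A"
    "\<And>z. z \<in> Z \<Longrightarrow> \<bar>f z - (\<Sum>w\<in>words k - {[]}. a w * wpow z w)\<bar> \<le> B * norm z ^ k"
    using assms(1) by (elim jetE) blast
  have "\<bar>\<Sum>w\<in>words k - {[]}. a w * wpow z w\<bar> \<le> (\<Sum>w\<in>words k - {[]}. \<bar>a w\<bar> * norm z)"
    using abs_wpow_le_norm[of _ k z] assms
    by (intro order_trans[OF sum_abs] sum_mono) (auto simp: abs_mult intro!: mult_left_mono)
  moreover have "B * norm z ^ k \<le> B * norm z"
    using power_decreasing[of 1 k "norm z"] a assms by (intro mult_left_mono) auto
  ultimately have "\<bar>f z\<bar> \<le> ((\<Sum>w\<in>words k - {[]}. \<bar>a w\<bar>) + B) * norm z"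
    using a(3)[OF assms(2)] by (simp add: sum_distrib_right distrib_right)
  also have "\<dots> \<le> A * norm z" using a by (intro mult_right_mono) auto
  finally show ?thesis .
qed

text \<open>Products of monomials of total degree at least k are moved to the remainder, which is
  allowed because \<open>norm z \<le> 1\<close>. Coefficient sums and remainder constants multiply
  out like (S + B) * (S' + B'), so no combinatorial factor appears and the bound is exactly
  \<open>A * A'\<close>.\<close>

lemma jet_mult:
  assumes Z: "Z \<subseteq> cball 0 1" and k: "1 \<le> k"
    and f: "jet k Z A f" and g: "jet k Z A' g"
  shows "jet k Z (A * A') (\<lambda>z. f z * g z)"
proof -
  let ?W = "words k - {[]} :: 'a list set"
  obtain a B where a: "0 \<le> B" "(\<Sum>w\<in>?W. \<bar>a w\<bar>) + B \<le> A"
    "\<And>z. z \<in> Z \<Longrightarrow> \<bar>f z - (\<Sum>w\<in>?W. a w * wpow z w)\<bar> \<le> B * norm z ^ k"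
    using f by (elim jetE) blast
  obtain a' B' where b: "0 \<le> B'" "(\<Sum>w\<in>?W. \<bar>a' w\<bar>) + B' \<le> A'"
    "\<And>z. z \<in> Z \<Longrightarrow> \<bar>g z - (\<Sum>w\<in>?W. a' w * wpow z w)\<bar> \<le> B' * norm z ^ k"
    using g by (elim jetE) blast
  define lo where "lo = {x \<in> ?W \<times> ?W. length (fst x) + length (snd x) < k}"
  define hi where "hi = {x \<in> ?W \<times> ?W. \<not> length (fst x) + length (snd x) < k}"
  define h where "h x = a (fst x) * a' (snd x)" for x
  \<comment> \<open>A word may arise from several splittings; collecting them can only decrease the
    sum of the absolute values.\<close>
  define c where "c w = (\<Sum>x | x \<in> lo \<and> fst x @ snd x = w. h x)" for w
  define S where "S = (\<Sum>w\<in>?W. \<bar>a w\<bar>)"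
  define S' where "S' = (\<Sum>w\<in>?W. \<bar>a' w\<bar>)"
  have S: "0 \<le> S" "0 \<le> S'" by (auto simp: S_def S'_def sum_nonneg)
  have fin: "finite lo" "finite hi"
    by (rule finite_subset[of _ "?W \<times> ?W"]; auto simp: lo_def hi_def)+
  have split: "sum q (?W \<times> ?W) = sum q lo + sum q hi" for q :: "_ \<Rightarrow> real"
  proof -
    have "?W \<times> ?W = lo \<union> hi" "lo \<inter> hi = {}" by (auto simp: lo_def hi_def)
    then show ?thesis by (simp add: sum.union_disjoint fin)
  qed
  have img: "(\<lambda>x. fst x @ snd x) ` lo \<subseteq> ?W"
    by (auto simp: lo_def words_def)
  have c_le: "(\<Sum>w\<in>?W. \<bar>c w\<bar>) \<le> (\<Sum>x\<in>lo. \<bar>h x\<bar>)"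
  proof -
    have "(\<Sum>w\<in>?W. \<bar>c w\<bar>) \<le> (\<Sum>w\<in>?W. \<Sum>x | x \<in> lo \<and> fst x @ snd x = w. \<bar>h x\<bar>)"
      unfolding c_def by (intro sum_mono sum_abs)
    also have "\<dots> = (\<Sum>x\<in>lo. \<bar>h x\<bar>)"
      by (rule sum.group[OF fin(1) _ img]) simp
    finally show ?thesis .
  qed
  have tot: "(\<Sum>x\<in>lo. \<bar>h x\<bar>) + (\<Sum>x\<in>hi. \<bar>h x\<bar>) = S * S'"
    unfolding split[symmetric] S_def S'_def h_def
    by (simp add: sum_product sum.cartesian_product abs_mult case_prod_unfold)
  \<comment> \<open>The three sources of the remainder: the error of f times g, the polynomial part
    of f times the error of g, and the products of high degree.\<close>
  define R where "R = B * A' + S * B' + (\<Sum>x\<in>hi. \<bar>h x\<bar>)"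
  have A': "0 \<le> A'" using g by (rule jet_nonneg)
  show ?thesis
  proof (rule jetI[where B = R and a = c])
    show "0 \<le> R" unfolding R_def using a(1) b(1) S A'
      by (intro add_nonneg_nonneg mult_nonneg_nonneg sum_nonneg) auto
    have "(\<Sum>w\<in>?W. \<bar>c w\<bar>) + R \<le> S * (S' + B') + B * A'"
      using c_le tot unfolding R_def by (simp add: distrib_left)
    also have "\<dots> \<le> S * A' + B * A'"
      using a(1) b S unfolding S'_def[symmetric] by (intro add_mono mult_left_mono) auto
    also have "\<dots> = (S + B) * A'" by (simp add: distrib_right)
    also have "\<dots> \<le> A * A'"
      using a A' unfolding S_def[symmetric] by (intro mult_right_mono) auto
    finally show "(\<Sum>w\<in>?W. \<bar>c w\<bar>) + R \<le> A * A'" .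
    fix z assume z: "z \<in> Z"
    then have nz: "norm z \<le> 1" using Z by auto
    define P where "P = (\<Sum>w\<in>?W. a w * wpow z w)"
    define Q where "Q = (\<Sum>w\<in>?W. a' w * wpow z w)"
    define m where "m x = h x * wpow z (fst x @ snd x)" for x
    have PQ: "P * Q = sum m lo + sum m hi"
      unfolding split[symmetric] P_def Q_def m_def h_def sum_product sum.cartesian_product
        case_prod_unfold wpow_append by (simp only: mult_ac)
    have "(\<Sum>w\<in>?W. c w * wpow z w) = (\<Sum>w\<in>?W. \<Sum>x | x \<in> lo \<and> fst x @ snd x = w. m x)"
      unfolding c_def m_def by (intro sum.cong refl) (simp add: sum_distrib_right)
    also have "\<dots> = sum m lo"
      by (rule sum.group[OF fin(1) _ img]) simp
    finally have lo: "(\<Sum>w\<in>?W. c w * wpow z w) = sum m lo" .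
    have "\<bar>m x\<bar> \<le> \<bar>h x\<bar> * norm z ^ k" if "x \<in> hi" for x
    proof -
      have "\<bar>wpow z (fst x @ snd x)\<bar> \<le> norm z ^ length (fst x @ snd x)"
        using that by (intro abs_wpow_le) (auto simp: hi_def words_def)
      also have "\<dots> \<le> norm z ^ k"
        using that nz by (intro power_decreasing) (auto simp: hi_def)
      finally show ?thesis unfolding m_def abs_mult by (intro mult_left_mono) auto
    qed
    then have hi: "\<bar>sum m hi\<bar> \<le> (\<Sum>x\<in>hi. \<bar>h x\<bar>) * norm z ^ k"
      unfolding sum_distrib_right by (intro order_trans[OF sum_abs] sum_mono) auto
    have gA: "\<bar>g z\<bar> \<le> A'"
      using jet_bound[OF g z nz k] A' nz mult_left_mono[OF nz A'] by simp
    have PS: "\<bar>P\<bar> \<le> S"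
      unfolding P_def S_def
    proof (intro order_trans[OF sum_abs] sum_mono)
      fix w assume "w \<in> ?W"
      then have "\<bar>wpow z w\<bar> \<le> 1" using abs_wpow_le_norm[of w k z] nz by linarith
      then show "\<bar>a w * wpow z w\<bar> \<le> \<bar>a w\<bar>" by (simp add: abs_mult mult_left_le)
    qed
    have "\<bar>(f z - P) * g z\<bar> \<le> (B * norm z ^ k) * A'"
      unfolding abs_mult using a(3)[OF z] gA a(1) unfolding P_def[symmetric]
      by (intro mult_mono) auto
    moreover have "\<bar>P * (g z - Q)\<bar> \<le> S * (B' * norm z ^ k)"
      unfolding abs_mult using b(3)[OF z] PS S unfolding Q_def[symmetric]
      by (intro mult_mono) auto
    moreover have "f z * g z - sum m lo = (f z - P) * g z + P * (g z - Q) + sum m hi"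
      using PQ by (simp add: algebra_simps)
    ultimately show "\<bar>f z * g z - (\<Sum>w\<in>?W. c w * wpow z w)\<bar> \<le> R * norm z ^ k"
      unfolding lo R_def using hi by (simp add: algebra_simps abs_le_iff)
  qed
qed

text \<open>The empty word is excluded since its monomial 1 is a constant term, which jets do not
  have.\<close>

lemma jet_wpow:
  assumes Z: "Z \<subseteq> cball 0 1" and k: "1 \<le> k" and w: "w \<noteq> []"
    and f: "\<And>b. b \<in> set w \<Longrightarrow> jet k Z A (\<lambda>z. f z \<bullet> b)"
  shows "jet k Z (A ^ length w) (\<lambda>z. wpow (f z) w)"
  using w f
proof (induction w rule: list_nonempty_induct)
  case (single x)
  then show ?case by simp
next
  case (cons x xs)
  then show ?case using jet_mult[OF Z k, of A "\<lambda>z. f z \<bullet> x" "A ^ length xs" "\<lambda>z. wpow (f z) xs"]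
    by simp
qed

section \<open>Functions of class \<open>C\<^sup>k\<close> on coordinate boxes\<close>

text \<open>Nonempty factors are nondegenerate intervals, open, closed or unbounded. Nondegeneracy
  makes one-sided partial derivatives unique, and the product structure allows moving along one axis
  at a time. Both the cylinder of the transport equation and the whole space are instances.\<close>

definition coord_box :: "'a::euclidean_space set \<Rightarrow> bool" where
  "coord_box S \<longleftrightarrow> (\<exists>I. (\<forall>b\<in>Basis. convex (I b :: real set) \<and> (\<forall>x\<in>I b. \<exists>y\<in>I b. y \<noteq> x)) \<and>
     S = {x. \<forall>b\<in>Basis. x \<bullet> b \<in> I b})"

abbreviation axis_section :: "'a::euclidean_space set \<Rightarrow> 'a \<Rightarrow> 'a \<Rightarrow> real set" where
  "axis_section S b x \<equiv> {s. x + s *\<^sub>R b \<in> S}"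

text \<open>The product structure in use: changing the coordinates of x into those of y one after
  the other never leaves S, not even at the boundary.\<close>

lemma coord_box_mix:
  assumes "coord_box S" "x \<in> S" "y \<in> S"
    and "\<And>b. b \<in> Basis \<Longrightarrow> z \<bullet> b = x \<bullet> b \<or> z \<bullet> b = y \<bullet> b"
  shows "z \<in> S"
proof -
  obtain I where I: "S = {x. \<forall>b\<in>Basis. x \<bullet> b \<in> I b}" using assms(1) unfolding coord_box_def by blast
  show ?thesis using assms(2-4) unfolding I by force
qed

lemma convex_coord_box:
  assumes "coord_box S"
  shows "convex S"
proof -
  obtain I where I: "S = {x. \<forall>b\<in>Basis. x \<bullet> b \<in> I b}" "\<forall>b\<in>Basis. convex (I b :: real set)"
    using assms unfolding coord_box_def by blast
  show ?thesis
    unfolding convex_def I(1) using I(2) by (auto simp: inner_add_left convex_def)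
qed

lemma convex_axis_section:
  assumes "coord_box S"
  shows "convex (axis_section S b x)"
proof -
  have "u * s + v * t \<in> axis_section S b x"
    if "s \<in> axis_section S b x" "t \<in> axis_section S b x" "0 \<le> u" "0 \<le> v" "u + v = 1" for s t u v
  proof -
    have "u *\<^sub>R (x + s *\<^sub>R b) + v *\<^sub>R (x + t *\<^sub>R b) \<in> S"
      using that convex_coord_box[OF assms] unfolding convex_def by auto
    moreover have "u *\<^sub>R (x + s *\<^sub>R b) + v *\<^sub>R (x + t *\<^sub>R b) = (u + v) *\<^sub>R x + (u * s + v * t) *\<^sub>R b"
      by (simp add: algebra_simps)
    ultimately show ?thesis using that by simp
  qed
  then show ?thesis unfolding convex_def by auto
qed

text \<open>Some other point of the section exists by nondegeneracy; convexity allows shrinking its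
  distance below e.\<close>

lemma axis_section_small:
  assumes "coord_box S" "x \<in> S" "b \<in> Basis" "0 < e"
  obtains s where "s \<noteq> 0" "\<bar>s\<bar> < e" "s \<in> axis_section S b x"
proof -
  obtain I where I: "S = {x. \<forall>b\<in>Basis. x \<bullet> b \<in> I b}"
    "\<forall>b\<in>Basis. convex (I b :: real set) \<and> (\<forall>x\<in>I b. \<exists>y\<in>I b. y \<noteq> x)"
    using assms(1) unfolding coord_box_def by blast
  have xb: "x \<bullet> b \<in> I b" using assms I by auto
  then obtain y where y: "y \<in> I b" "y \<noteq> x \<bullet> b" using I(2) assms(3) by blast
  have "x + (y - x \<bullet> b) *\<^sub>R b \<in> S"
    unfolding I(1)
  proof (intro CollectI ballI)
    fix c :: 'a assume c: "c \<in> Basis"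
    show "(x + (y - x \<bullet> b) *\<^sub>R b) \<bullet> c \<in> I c"
      using c y assms I(1) by (cases "c = b") (auto simp: inner_add_left inner_Basis)
  qed
  then have t: "y - x \<bullet> b \<in> axis_section S b x" by simp
  have z: "0 \<in> axis_section S b x" using assms by simp
  define t where "t = y - x \<bullet> b"
  define u where "u = min 1 (e / (2 * \<bar>t\<bar>))"
  have t0: "t \<noteq> 0" using y by (simp add: t_def)
  have u: "0 < u" "u \<le> 1" using t0 assms by (auto simp: u_def)
  have "u * \<bar>t\<bar> \<le> e / (2 * \<bar>t\<bar>) * \<bar>t\<bar>" by (intro mult_right_mono) (auto simp: u_def)
  then have "\<bar>u * t\<bar> < e" using t0 assms(4) u by (simp add: abs_mult)
  moreover have "u * t \<in> axis_section S b x"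
    using convexD[OF convex_axis_section[OF assms(1), of x b] z t, of "1 - u" u] u
    by (simp add: t_def)
  ultimately show ?thesis using that[of "u * t"] t0 u by auto
qed

lemma axis_section_not_bot:
  assumes "coord_box S" "x \<in> S" "b \<in> Basis"
  shows "at 0 within axis_section S b x \<noteq> bot"
proof -
  have "0 islimpt axis_section S b x"
    unfolding islimpt_approachable
  proof (intro allI impI)
    fix e :: real assume "0 < e"
    then obtain s where "s \<noteq> 0" "\<bar>s\<bar> < e" "s \<in> axis_section S b x"
      using axis_section_small[OF assms] by blast
    then show "\<exists>x'\<in>axis_section S b x. x' \<noteq> 0 \<and> dist x' 0 < e" by (intro bexI[of _ s]) auto
  qed
  then show ?thesis by (simp add: trivial_limit_within)
qed

text \<open>\<open>has_partial\<close> speaks of the derivative at parameter 0 of the line through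
  each point. Recentring the line turns this into a derivative at every parameter of one fixed line,
  the form that mean value arguments require.\<close>

lemma has_vector_derivative_partial:
  assumes "has_partial S b f" "x + s *\<^sub>R b \<in> S"
  shows "((\<lambda>s. f (x + s *\<^sub>R b)) has_vector_derivative partial_deriv S b f (x + s *\<^sub>R b))
    (at s within axis_section S b x)"
proof -
  let ?y = "x + s *\<^sub>R b"
  have "((\<lambda>t. f (?y + t *\<^sub>R b)) has_vector_derivative partial_deriv S b f ?y)
      (at 0 within axis_section S b ?y)"
    using assms unfolding has_partial_def partial_deriv_def vector_derivative_works by blast
  moreover have "axis_section S b ?y = (\<lambda>t. t - s) ` axis_section S b x"
    by (force simp: algebra_simps image_iff intro: exI[of _ "_ + s"])
  ultimately have "((\<lambda>t. f (?y + t *\<^sub>R b)) has_vector_derivative partial_deriv S b f ?y)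
      (at (s - s) within (\<lambda>t. t - s) ` axis_section S b x)" by simp
  moreover have "((\<lambda>t. t - s) has_vector_derivative 1) (at s within axis_section S b x)"
    by (auto intro!: derivative_eq_intros)
  ultimately have "(((\<lambda>t. f (?y + t *\<^sub>R b)) \<circ> (\<lambda>t. t - s)) has_vector_derivative
      1 *\<^sub>R partial_deriv S b f ?y) (at s within axis_section S b x)"
    by (intro vector_diff_chain_within)
  then show ?thesis by (simp add: o_def algebra_simps)
qed

lemma partial_deriv_unique:
  assumes "coord_box S" "x \<in> S" "b \<in> Basis"
    and "((\<lambda>s. f (x + s *\<^sub>R b)) has_vector_derivative D) (at 0 within axis_section S b x)"
  shows "partial_deriv S b f x = D"
  unfolding partial_deriv_def
  by (rule vector_derivative_within[OF axis_section_not_bot[OF assms(1-3)] assms(4)])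

lemma partial_deriv_cong:
  assumes "\<And>x. x \<in> S \<Longrightarrow> f x = g x" "x \<in> S"
  shows "partial_deriv S b f x = partial_deriv S b g x"
proof -
  have "((\<lambda>s. f (x + s *\<^sub>R b)) has_vector_derivative D) (at 0 within axis_section S b x) \<longleftrightarrow>
      ((\<lambda>s. g (x + s *\<^sub>R b)) has_vector_derivative D) (at 0 within axis_section S b x)" for D
    using assms by (auto intro: has_vector_derivative_transform[rotated 2])
  then show ?thesis unfolding partial_deriv_def vector_derivative_def by simp
qed

lemma has_partial_cong:
  assumes "\<And>x. x \<in> S \<Longrightarrow> f x = g x"
  shows "has_partial S b f \<longleftrightarrow> has_partial S b g"
proof -
  have "((\<lambda>s. f (x + s *\<^sub>R b)) has_vector_derivative D) (at 0 within axis_section S b x) \<longleftrightarrow>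
      ((\<lambda>s. g (x + s *\<^sub>R b)) has_vector_derivative D) (at 0 within axis_section S b x)"
    if "x \<in> S" for D x
    using assms that by (auto intro: has_vector_derivative_transform[rotated 2])
  then show ?thesis unfolding has_partial_def
    by (metis (no_types, lifting) differentiableI_vector vector_derivative_works)
qed

lemma Ck_on_cong:
  assumes "\<And>x. x \<in> S \<Longrightarrow> f x = g x"
  shows "Ck_on k S f \<longleftrightarrow> Ck_on k S g"
  using assms
proof (induction k arbitrary: f g)
  case 0
  then show ?case by (auto cong: continuous_on_cong)
next
  case (Suc k)
  have "Ck_on k S (partial_deriv S b f) \<longleftrightarrow> Ck_on k S (partial_deriv S b g)" for b
    by (rule Suc.IH) (rule partial_deriv_cong[OF Suc.prems])
  then show ?case
    using Suc.prems has_partial_cong[of S f g] by (auto cong: continuous_on_cong)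
qed

lemma Ck_on_Suc_imp: "Ck_on (Suc k) S f \<Longrightarrow> Ck_on k S f"
  by (induction k arbitrary: f) auto

lemma Ck_on_mono: "Ck_on k S f \<Longrightarrow> j \<le> k \<Longrightarrow> Ck_on j S f"
  by (induction k) (use le_Suc_eq Ck_on_Suc_imp in blast)+

lemma Ck_on_imp_continuous_on: "Ck_on k S f \<Longrightarrow> continuous_on S f"
  by (cases k) auto

lemma has_partial_inner:
  assumes "coord_box S" "b \<in> Basis" "has_partial S b f"
  shows "has_partial S b (\<lambda>x. f x \<bullet> i)"
    and "x \<in> S \<Longrightarrow> partial_deriv S b (\<lambda>x. f x \<bullet> i) x = partial_deriv S b f x \<bullet> i"
proof -
  have *: "((\<lambda>s. f (x + s *\<^sub>R b) \<bullet> i) has_vector_derivative partial_deriv S b f x \<bullet> i)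
      (at 0 within axis_section S b x)" if "x \<in> S" for x
    using has_vector_derivative_partial[OF assms(3), of x 0] that
    by (auto intro!: bounded_linear.has_vector_derivative[OF bounded_linear_inner_left])
  show "has_partial S b (\<lambda>x. f x \<bullet> i)"
    unfolding has_partial_def using differentiableI_vector[OF *] by blast
  show "x \<in> S \<Longrightarrow> partial_deriv S b (\<lambda>x. f x \<bullet> i) x = partial_deriv S b f x \<bullet> i"
    by (rule partial_deriv_unique[OF assms(1) _ assms(2) *])
qed

lemma Ck_on_inner:
  assumes "coord_box S" "Ck_on k S f"
  shows "Ck_on k S (\<lambda>x. f x \<bullet> i)"
  using assms(2)
proof (induction k arbitrary: f)
  case 0
  then show ?case by (auto intro!: continuous_intros)
next
  case (Suc k)
  have "Ck_on k S (partial_deriv S b (\<lambda>x. f x \<bullet> i))" if b: "b \<in> Basis" for b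
  proof (subst Ck_on_cong)
    show "Ck_on k S (\<lambda>x. partial_deriv S b f x \<bullet> i)" using Suc b by simp
  qed (use has_partial_inner[OF assms(1) b, of f] Suc b in auto)
  moreover have "has_partial S b (\<lambda>x. f x \<bullet> i)" if "b \<in> Basis" for b
    using Suc.prems that by (intro has_partial_inner(1)[OF assms(1)]) auto
  ultimately show ?case using Suc.prems by (auto intro!: continuous_intros)
qed

section \<open>Iterated derivatives along words\<close>

primrec word_deriv :: "'a::euclidean_space set \<Rightarrow> 'a list \<Rightarrow>
    ('a \<Rightarrow> 'b::real_normed_vector) \<Rightarrow> 'a \<Rightarrow> 'b" where
  "word_deriv S [] f = f"
| "word_deriv S (b # w) f = partial_deriv S b (word_deriv S w f)"

lemma Ck_on_word_deriv:
  "Ck_on (k + length w) S f \<Longrightarrow> set w \<subseteq> Basis \<Longrightarrow> Ck_on k S (word_deriv S w f)"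
proof (induction w arbitrary: k)
  case (Cons b w)
  then show ?case using Cons.IH[of "Suc k"] by simp
qed simp

lemma word_deriv_inner:
  assumes "coord_box S" "Ck_on (length w) S f" "set w \<subseteq> Basis" "x \<in> S"
  shows "word_deriv S w (\<lambda>x. f x \<bullet> i) x = word_deriv S w f x \<bullet> i"
  using assms(2-4)
proof (induction w arbitrary: x)
  case (Cons b w)
  have "Ck_on 1 S (word_deriv S w f)" using Cons.prems by (intro Ck_on_word_deriv) auto
  then have hp: "has_partial S b (word_deriv S w f)" using Cons.prems by simp
  have "partial_deriv S b (word_deriv S w (\<lambda>x. f x \<bullet> i)) x
      = partial_deriv S b (\<lambda>x. word_deriv S w f x \<bullet> i) x"
    using Cons Ck_on_Suc_imp by (intro partial_deriv_cong) auto
  then show ?case using has_partial_inner(2)[OF assms(1) _ hp] Cons.prems by simp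
qed simp

text \<open>The mean value inequality for the function
  \<open>g \<sigma> - \<sigma> *\<^sub>R L\<close> of \<sigma>. With \<open>L = 0\<close> it bounds
  increments; with L a derivative at a fixed point it measures the deviation from the
  linearisation.\<close>

lemma segment_derivative_bound:
  fixes g :: "real \<Rightarrow> 'b::real_normed_vector"
  assumes "convex J" "0 \<in> J" "s \<in> J"
    and "\<And>\<sigma>. \<sigma> \<in> J \<Longrightarrow> (g has_vector_derivative g' \<sigma>) (at \<sigma> within J)"
    and "\<And>\<sigma>. \<sigma> \<in> closed_segment 0 s \<Longrightarrow> norm (g' \<sigma> - L) \<le> e"
  shows "norm (g s - g 0 - s *\<^sub>R L) \<le> e * \<bar>s\<bar>"
proof -
  have sub: "closed_segment 0 s \<subseteq> J" using assms by (intro closed_segment_subset)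
  have "norm ((g s - s *\<^sub>R L) - (g 0 - 0 *\<^sub>R L)) \<le> e * norm (s - 0)"
  proof (rule differentiable_bound[where S = "closed_segment 0 s" and f' = "\<lambda>\<sigma> t. t *\<^sub>R (g' \<sigma> - L)"])
    fix \<sigma> assume \<sigma>: "\<sigma> \<in> closed_segment 0 s"
    have "((\<lambda>\<sigma>. g \<sigma> - \<sigma> *\<^sub>R L) has_vector_derivative g' \<sigma> - 1 *\<^sub>R L) (at \<sigma> within closed_segment 0 s)"
      using assms(4)[of \<sigma>] \<sigma> sub
      by (auto intro!: derivative_eq_intros intro: has_vector_derivative_within_subset)
    then show "((\<lambda>\<sigma>. g \<sigma> - \<sigma> *\<^sub>R L) has_derivative (\<lambda>t. t *\<^sub>R (g' \<sigma> - L))) (at \<sigma> within closed_segment 0 s)"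
      by (simp add: has_vector_derivative_def)
    show "onorm (\<lambda>t. t *\<^sub>R (g' \<sigma> - L)) \<le> e"
      using assms(5)[OF \<sigma>] order_trans[OF norm_ge_zero assms(5)[OF \<sigma>]]
      by (intro onorm_bound) (auto simp: mult.commute[of e] intro!: mult_left_mono)
  qed auto
  then show ?thesis by (simp add: algebra_simps)
qed

lemma partial_increment_bound:
  assumes "coord_box S" "has_partial S b f" "y \<in> S" "y + s *\<^sub>R b \<in> S"
    and "\<And>\<sigma>. \<sigma> \<in> closed_segment 0 s \<Longrightarrow> norm (partial_deriv S b f (y + \<sigma> *\<^sub>R b) - L) \<le> e"
  shows "norm (f (y + s *\<^sub>R b) - f y - s *\<^sub>R L) \<le> e * \<bar>s\<bar>"
  using segment_derivative_bound[where J = "axis_section S b y" and g = "\<lambda>s. f (y + s *\<^sub>R b)"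
      and g' = "\<lambda>\<sigma>. partial_deriv S b f (y + \<sigma> *\<^sub>R b)" and s = s and L = L and e = e]
    convex_axis_section[OF assms(1)] has_vector_derivative_partial[OF assms(2)] assms
  by simp

text \<open>Both mixed derivatives are approximated by the second difference over a small rectangle with
  corner \<open>x\<close>, which may point into either direction of each axis if \<open>x\<close> is on the boundary.\<close>

lemma partial_deriv_commute:
  assumes S: "coord_box S" and f: "Ck_on 2 S f" and a: "a \<in> Basis" and b: "b \<in> Basis" and x: "x \<in> S"
  shows "partial_deriv S a (partial_deriv S b f) x = partial_deriv S b (partial_deriv S a f) x"
proof (cases "a = b")
  case False
  have main: "\<exists>d>0. \<forall>s t. \<bar>s\<bar> < d \<longrightarrow> \<bar>t\<bar> < d \<longrightarrow> x + s *\<^sub>R a \<in> S \<longrightarrow> x + t *\<^sub>R b \<in> S \<longrightarrow>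
      norm (f (x + s *\<^sub>R a + t *\<^sub>R b) - f (x + s *\<^sub>R a) - f (x + t *\<^sub>R b) + f x
        - (s * t) *\<^sub>R partial_deriv S b (partial_deriv S a f) x) \<le> e * (\<bar>s\<bar> * \<bar>t\<bar>)"
    if ab: "a \<in> Basis" "b \<in> Basis" "a \<noteq> b" and e: "0 < e" for a b e
  proof -
    let ?L = "partial_deriv S b (partial_deriv S a f)"
    have pa: "has_partial S a f" and pba: "has_partial S b (partial_deriv S a f)"
      and cont: "continuous_on S ?L"
      using f ab by (auto simp: numeral_2_eq_2)
    obtain d where d: "0 < d" "\<And>y. y \<in> S \<Longrightarrow> dist y x < d \<Longrightarrow> dist (?L y) (?L x) \<le> e"
      using cont x e unfolding continuous_on_iff by (meson less_imp_le)
    show ?thesis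
    proof (intro exI[of _ "d / 2"] conjI allI impI)
      fix s t assume st: "\<bar>s\<bar> < d / 2" "\<bar>t\<bar> < d / 2" "x + s *\<^sub>R a \<in> S" "x + t *\<^sub>R b \<in> S"
      have sec: "x + \<sigma> *\<^sub>R a + \<tau> *\<^sub>R b \<in> S" if "\<sigma> \<in> axis_section S a x" "\<tau> \<in> axis_section S b x" for \<sigma> \<tau>
        by (rule coord_box_mix[OF S, of "x + \<sigma> *\<^sub>R a" "x + \<tau> *\<^sub>R b"])
          (use that ab in \<open>auto simp: inner_add_left inner_Basis\<close>)
      have seg: "\<sigma> \<in> axis_section S c x \<and> \<bar>\<sigma>\<bar> \<le> \<bar>s\<bar>"
        if "x + s *\<^sub>R c \<in> S" "\<sigma> \<in> closed_segment 0 s" for \<sigma> c s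
      proof -
        have "closed_segment 0 s \<subseteq> axis_section S c x"
          using convex_axis_section[OF S, of x c] that x by (intro closed_segment_subset) auto
        then show ?thesis using that(2) by (auto simp: closed_segment_eq_real_ivl split: if_splits)
      qed
      have inner: "norm (partial_deriv S a f (x + \<sigma> *\<^sub>R a + t *\<^sub>R b) - partial_deriv S a f (x + \<sigma> *\<^sub>R a)
          - t *\<^sub>R ?L x) \<le> e * \<bar>t\<bar>" if \<sigma>: "\<sigma> \<in> closed_segment 0 s" for \<sigma>
      proof (rule partial_increment_bound[OF S pba])
        note sg = seg[OF st(3) \<sigma>]
        show "x + \<sigma> *\<^sub>R a \<in> S" "x + \<sigma> *\<^sub>R a + t *\<^sub>R b \<in> S"
          using sg st sec by auto
        fix \<tau> assume \<tau>: "\<tau> \<in> closed_segment 0 t"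
        note tg = seg[OF st(4) \<tau>]
        have "dist (x + \<sigma> *\<^sub>R a + \<tau> *\<^sub>R b) x \<le> \<bar>\<sigma>\<bar> + \<bar>\<tau>\<bar>"
          using ab norm_triangle_ineq[of "\<sigma> *\<^sub>R a" "\<tau> *\<^sub>R b"]
          by (simp add: dist_norm add.commute add.left_commute)
        also have "\<dots> < d" using sg tg st by simp
        finally show "norm (?L (x + \<sigma> *\<^sub>R a + \<tau> *\<^sub>R b) - ?L x) \<le> e"
          using d(2) sec sg tg unfolding dist_norm by blast
      qed
      \<comment> \<open>The second difference is an increment in s of the first difference in t,
        whose derivative in s has just been compared with t times the mixed derivative at x.\<close>
      have "norm ((f (x + s *\<^sub>R a + t *\<^sub>R b) - f (x + s *\<^sub>R a)) - (f (x + 0 *\<^sub>R a + t *\<^sub>R b) - f (x + 0 *\<^sub>R a))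
          - s *\<^sub>R (t *\<^sub>R ?L x)) \<le> (e * \<bar>t\<bar>) * \<bar>s\<bar>"
      proof (rule segment_derivative_bound[where J = "axis_section S a x"])
        fix \<sigma> assume \<sigma>: "\<sigma> \<in> axis_section S a x"
        have "((\<lambda>\<sigma>. f (x + t *\<^sub>R b + \<sigma> *\<^sub>R a)) has_vector_derivative
            partial_deriv S a f (x + t *\<^sub>R b + \<sigma> *\<^sub>R a)) (at \<sigma> within axis_section S a (x + t *\<^sub>R b))"
          using sec[OF \<sigma>, of t] st by (intro has_vector_derivative_partial[OF pa]) (simp add: algebra_simps)
        moreover have "axis_section S a x \<subseteq> axis_section S a (x + t *\<^sub>R b)"
          using sec[of _ t] st by (auto simp: algebra_simps)
        ultimately have "((\<lambda>\<sigma>. f (x + t *\<^sub>R b + \<sigma> *\<^sub>R a)) has_vector_derivative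
            partial_deriv S a f (x + t *\<^sub>R b + \<sigma> *\<^sub>R a)) (at \<sigma> within axis_section S a x)"
          by (rule has_vector_derivative_within_subset)
        then have "((\<lambda>\<sigma>. f (x + \<sigma> *\<^sub>R a + t *\<^sub>R b)) has_vector_derivative
            partial_deriv S a f (x + \<sigma> *\<^sub>R a + t *\<^sub>R b)) (at \<sigma> within axis_section S a x)"
          by (simp add: add.commute add.left_commute)
        moreover have "((\<lambda>\<sigma>. f (x + \<sigma> *\<^sub>R a)) has_vector_derivative
            partial_deriv S a f (x + \<sigma> *\<^sub>R a)) (at \<sigma> within axis_section S a x)"
          using \<sigma> by (intro has_vector_derivative_partial[OF pa]) simp
        ultimately show "((\<lambda>\<sigma>. f (x + \<sigma> *\<^sub>R a + t *\<^sub>R b) - f (x + \<sigma> *\<^sub>R a)) has_vector_derivative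
            (partial_deriv S a f (x + \<sigma> *\<^sub>R a + t *\<^sub>R b) - partial_deriv S a f (x + \<sigma> *\<^sub>R a)))
            (at \<sigma> within axis_section S a x)"
          by (rule has_vector_derivative_diff)
      qed (use convex_axis_section[OF S] x st inner in auto)
      then show "norm (f (x + s *\<^sub>R a + t *\<^sub>R b) - f (x + s *\<^sub>R a) - f (x + t *\<^sub>R b) + f x - (s * t) *\<^sub>R ?L x)
          \<le> e * (\<bar>s\<bar> * \<bar>t\<bar>)"
        by (simp add: algebra_simps)
    qed (use d in auto)
  qed
  let ?\<alpha> = "partial_deriv S a (partial_deriv S b f) x" and ?\<beta> = "partial_deriv S b (partial_deriv S a f) x"
  have "norm (?\<alpha> - ?\<beta>) \<le> e" if "0 < e" for e
  proof -
    have e2: "0 < e / 2" using that by simp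
    obtain d where d: "0 < d" "\<And>s t. \<bar>s\<bar> < d \<Longrightarrow> \<bar>t\<bar> < d \<Longrightarrow> x + s *\<^sub>R a \<in> S \<Longrightarrow> x + t *\<^sub>R b \<in> S \<Longrightarrow>
      norm (f (x + s *\<^sub>R a + t *\<^sub>R b) - f (x + s *\<^sub>R a) - f (x + t *\<^sub>R b) + f x - (s * t) *\<^sub>R ?\<beta>) \<le> e / 2 * (\<bar>s\<bar> * \<bar>t\<bar>)"
      using main[OF a b False e2] by blast
    obtain d' where d': "0 < d'" "\<And>s t. \<bar>s\<bar> < d' \<Longrightarrow> \<bar>t\<bar> < d' \<Longrightarrow> x + s *\<^sub>R b \<in> S \<Longrightarrow> x + t *\<^sub>R a \<in> S \<Longrightarrow>
      norm (f (x + s *\<^sub>R b + t *\<^sub>R a) - f (x + s *\<^sub>R b) - f (x + t *\<^sub>R a) + f x - (s * t) *\<^sub>R ?\<alpha>) \<le> e / 2 * (\<bar>s\<bar> * \<bar>t\<bar>)"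
      using main[OF b a False[symmetric] e2] by blast
    have "0 < min d d'" using d d' by simp
    obtain s where s: "s \<noteq> 0" "\<bar>s\<bar> < min d d'" "s \<in> axis_section S a x"
      by (rule axis_section_small[OF S x a \<open>0 < min d d'\<close>])
    obtain t where t: "t \<noteq> 0" "\<bar>t\<bar> < min d d'" "t \<in> axis_section S b x"
      by (rule axis_section_small[OF S x b \<open>0 < min d d'\<close>])
    define \<Delta> where "\<Delta> = f (x + s *\<^sub>R a + t *\<^sub>R b) - f (x + s *\<^sub>R a) - f (x + t *\<^sub>R b) + f x"
    have 1: "norm (\<Delta> - (s * t) *\<^sub>R ?\<beta>) \<le> e / 2 * (\<bar>s\<bar> * \<bar>t\<bar>)"
      unfolding \<Delta>_def using s t by (intro d(2)) auto
    have "x + t *\<^sub>R b + s *\<^sub>R a = x + s *\<^sub>R a + t *\<^sub>R b" by (simp add: algebra_simps)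
    then have "\<Delta> = f (x + t *\<^sub>R b + s *\<^sub>R a) - f (x + t *\<^sub>R b) - f (x + s *\<^sub>R a) + f x"
      unfolding \<Delta>_def by (simp only: diff_diff_add add.commute[of "f (x + s *\<^sub>R a)"])
    then have 2: "norm (\<Delta> - (t * s) *\<^sub>R ?\<alpha>) \<le> e / 2 * (\<bar>t\<bar> * \<bar>s\<bar>)"
      using d'(2)[of t s] s t by simp
    \<comment> \<open>Both estimates concern the same second difference, which cancels; since s and
      t are nonzero, their product can be divided out.\<close>
    have "\<bar>s * t\<bar> * norm (?\<alpha> - ?\<beta>) = norm ((\<Delta> - (s * t) *\<^sub>R ?\<beta>) - (\<Delta> - (t * s) *\<^sub>R ?\<alpha>))"
      unfolding norm_scaleR[symmetric] by (simp add: algebra_simps)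
    also have "\<dots> \<le> e / 2 * (\<bar>s\<bar> * \<bar>t\<bar>) + e / 2 * (\<bar>t\<bar> * \<bar>s\<bar>)"
      by (rule order_trans[OF norm_triangle_ineq4 add_mono[OF 1 2]])
    also have "\<dots> = \<bar>s * t\<bar> * e" by (simp add: abs_mult)
    finally show ?thesis using s t by simp
  qed
  then have "norm (?\<alpha> - ?\<beta>) \<le> 0" using field_le_epsilon[of "norm (?\<alpha> - ?\<beta>)" 0] by simp
  then show ?thesis by simp
qed simp

text \<open>The usual passage from continuous partial derivatives to the total derivative: walk from
  x to y along the axes and apply the mean value inequality to each leg. Boundary points of S cause
  no trouble, since a coordinate box contains the whole path.\<close>

lemma has_derivative_of_partials:
  fixes f :: "'a::euclidean_space \<Rightarrow> 'b::real_normed_vector"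
  assumes S: "coord_box S" and f: "Ck_on 1 S f" and x: "x \<in> S"
  shows "(f has_derivative (\<lambda>v. \<Sum>b\<in>Basis. (v \<bullet> b) *\<^sub>R partial_deriv S b f x)) (at x within S)"
  unfolding has_derivative_within_alt
proof (intro conjI allI impI)
  show "bounded_linear (\<lambda>v. \<Sum>b\<in>Basis. (v \<bullet> b) *\<^sub>R partial_deriv S b f x)"
    by (intro bounded_linear_sum bounded_linear_scaleR_const bounded_linear_inner_left)
  fix e :: real assume e: "0 < e"
  define e' where "e' = e / DIM('a)"
  have e': "0 < e'" using e by (simp add: e'_def)
  have "\<exists>d>0. \<forall>y\<in>S. dist y x < d \<longrightarrow> dist (partial_deriv S b f y) (partial_deriv S b f x) \<le> e'"
    if "b \<in> Basis" for b
  proof -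
    have "continuous_on S (partial_deriv S b f)" using f that by simp
    then show ?thesis using x e' unfolding continuous_on_iff by (meson less_imp_le)
  qed
  then obtain D where D: "\<And>b. b \<in> Basis \<Longrightarrow> 0 < D b"
    "\<And>b y. b \<in> Basis \<Longrightarrow> y \<in> S \<Longrightarrow> dist y x < D b \<Longrightarrow> dist (partial_deriv S b f y) (partial_deriv S b f x) \<le> e'"
    by metis
  define d where "d = Min (D ` Basis)"
  have d: "0 < d" using D by (auto simp: d_def)
  have dD: "dist (partial_deriv S b f y) (partial_deriv S b f x) \<le> e'"
    if "b \<in> Basis" "y \<in> S" "dist y x < d" for b y
    using that D(2)[of b y] by (auto simp: d_def)
  \<comment> \<open>F collects the axes along which y may differ from x. Removing b from F means
    resetting the b-th coordinate of y to that of x, and \<open>partial_increment_bound\<close>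
    accounts for this leg.\<close>
  have main: "norm (f y - f x - (\<Sum>b\<in>F. ((y - x) \<bullet> b) *\<^sub>R partial_deriv S b f x))
      \<le> e' * (\<Sum>b\<in>F. \<bar>(y - x) \<bullet> b\<bar>)"
    if "finite F" "F \<subseteq> Basis" "y \<in> S" "norm (y - x) < d" "\<forall>b\<in>Basis - F. (y - x) \<bullet> b = 0" for F y
    using that
  proof (induction F arbitrary: y rule: finite_induct)
    case empty
    then have "(y - x) \<bullet> i = 0" if "i \<in> Basis" for i using that by simp
    then have "y = x" by (simp add: euclidean_eq_iff[of y x] inner_diff_left)
    then show ?case by simp
  next
    case (insert b F)
    define c where "c = (y - x) \<bullet> b"
    define y' where "y' = y - c *\<^sub>R b"
    have bB: "b \<in> Basis" and F: "F \<subseteq> Basis" using insert.prems by auto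
    have y'c: "(y' - x) \<bullet> i = (if i = b then 0 else (y - x) \<bullet> i)" if "i \<in> Basis" for i
      using that bB by (auto simp: y'_def c_def inner_diff_left inner_Basis)
    have y'S: "y' \<in> S"
    proof (rule coord_box_mix[OF S x insert.prems(2)])
      show "y' \<bullet> i = x \<bullet> i \<or> y' \<bullet> i = y \<bullet> i" if "i \<in> Basis" for i
        using y'c[OF that] by (auto simp: inner_diff_left split: if_splits)
    qed
    have "norm (y' - x) \<le> norm (y - x)"
      by (rule norm_le_componentwise) (auto simp: y'c)
    then have "norm (f y' - f x - (\<Sum>i\<in>F. ((y' - x) \<bullet> i) *\<^sub>R partial_deriv S i f x))
        \<le> e' * (\<Sum>i\<in>F. \<bar>(y' - x) \<bullet> i\<bar>)"
      using insert.prems y'S y'c bB by (intro insert.IH F) auto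
    moreover have "(y' - x) \<bullet> i = (y - x) \<bullet> i" if "i \<in> F" for i
      using y'c[of i] that insert.hyps F by auto
    ultimately have 1: "norm (f y' - f x - (\<Sum>i\<in>F. ((y - x) \<bullet> i) *\<^sub>R partial_deriv S i f x))
        \<le> e' * (\<Sum>i\<in>F. \<bar>(y - x) \<bullet> i\<bar>)" by simp
    have yc: "y' + c *\<^sub>R b = y" by (simp add: y'_def)
    have 2: "norm (f (y' + c *\<^sub>R b) - f y' - c *\<^sub>R partial_deriv S b f x) \<le> e' * \<bar>c\<bar>"
    proof (rule partial_increment_bound[OF S _ y'S])
      show "has_partial S b f" using f bB by simp
      fix \<sigma> assume \<sigma>: "\<sigma> \<in> closed_segment 0 c"
      then have \<sigma>c: "\<bar>\<sigma>\<bar> \<le> \<bar>c\<bar>" by (auto simp: closed_segment_eq_real_ivl split: if_splits)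
      have "closed_segment 0 c \<subseteq> axis_section S b y'"
        using y'S insert.prems yc by (intro closed_segment_subset convex_axis_section[OF S]) auto
      then have in_S: "y' + \<sigma> *\<^sub>R b \<in> S" using \<sigma> by auto
      have "norm (y' + \<sigma> *\<^sub>R b - x) \<le> norm (y - x)"
      proof (rule norm_le_componentwise)
        fix i :: 'a assume i: "i \<in> Basis"
        have "(y' + \<sigma> *\<^sub>R b - x) \<bullet> i = (y' - x) \<bullet> i + \<sigma> * (b \<bullet> i)"
          by (simp add: inner_add_left inner_diff_left)
        then show "\<bar>(y' + \<sigma> *\<^sub>R b - x) \<bullet> i\<bar> \<le> \<bar>(y - x) \<bullet> i\<bar>"
          using y'c[OF i] \<sigma>c bB i by (auto simp: inner_Basis c_def)
      qed
      then have "dist (y' + \<sigma> *\<^sub>R b) x < d" using insert.prems by (simp add: dist_norm)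
      then show "norm (partial_deriv S b f (y' + \<sigma> *\<^sub>R b) - partial_deriv S b f x) \<le> e'"
        using dD[OF bB in_S] by (simp add: dist_norm)
    qed (use yc insert.prems in auto)
    have "f y - f x - (\<Sum>i\<in>insert b F. ((y - x) \<bullet> i) *\<^sub>R partial_deriv S i f x)
        = (f y' - f x - (\<Sum>i\<in>F. ((y - x) \<bullet> i) *\<^sub>R partial_deriv S i f x))
          + (f (y' + c *\<^sub>R b) - f y' - c *\<^sub>R partial_deriv S b f x)"
      using insert.hyps by (simp add: yc c_def[symmetric])
    also have "norm \<dots> \<le> e' * (\<Sum>i\<in>F. \<bar>(y - x) \<bullet> i\<bar>) + e' * \<bar>c\<bar>"
      by (intro norm_triangle_mono 1 2)
    also have "\<dots> = e' * (\<Sum>i\<in>insert b F. \<bar>(y - x) \<bullet> i\<bar>)"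
      using insert.hyps by (simp add: c_def distrib_left)
    finally show ?case .
  qed
  show "\<exists>d>0. \<forall>y\<in>S. norm (y - x) < d \<longrightarrow>
      norm (f y - f x - (\<Sum>b\<in>Basis. ((y - x) \<bullet> b) *\<^sub>R partial_deriv S b f x)) \<le> e * norm (y - x)"
  proof (intro exI[of _ d] conjI ballI impI d)
    fix y assume y: "y \<in> S" "norm (y - x) < d"
    have "(\<Sum>b\<in>Basis. \<bar>(y - x) \<bullet> b\<bar>) \<le> (\<Sum>b\<in>(Basis :: 'a set). norm (y - x))"
      by (intro sum_mono Basis_le_norm)
    then have "e' * (\<Sum>b\<in>Basis. \<bar>(y - x) \<bullet> b\<bar>) \<le> e' * (DIM('a) * norm (y - x))"
      using e' by (intro mult_left_mono) auto
    then show "norm (f y - f x - (\<Sum>b\<in>Basis. ((y - x) \<bullet> b) *\<^sub>R partial_deriv S b f x)) \<le> e * norm (y - x)"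
      using main[of Basis y] y e by (simp add: e'_def)
  qed
qed

lemma has_vector_derivative_along_line:
  fixes f :: "'a::euclidean_space \<Rightarrow> 'b::real_normed_vector"
  assumes S: "coord_box S" and f: "Ck_on 1 S f" and J: "\<And>s. s \<in> J \<Longrightarrow> a + s *\<^sub>R v \<in> S" and s: "s \<in> J"
  shows "((\<lambda>s. f (a + s *\<^sub>R v)) has_vector_derivative
    (\<Sum>b\<in>Basis. (v \<bullet> b) *\<^sub>R partial_deriv S b f (a + s *\<^sub>R v))) (at s within J)"
proof -
  let ?l = "\<lambda>s. a + s *\<^sub>R v"
  have "(?l has_derivative (\<lambda>h. h *\<^sub>R v)) (at s within J)"
    by (auto intro!: derivative_eq_intros)
  moreover have "(f has_derivative (\<lambda>w. \<Sum>b\<in>Basis. (w \<bullet> b) *\<^sub>R partial_deriv S b f (?l s)))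
      (at (?l s) within ?l ` J)"
    by (rule has_derivative_subset[OF has_derivative_of_partials[OF S f]]) (use J s in auto)
  ultimately have "((f \<circ> ?l) has_derivative (\<lambda>w. \<Sum>b\<in>Basis. (w \<bullet> b) *\<^sub>R partial_deriv S b f (?l s)) \<circ> (\<lambda>h. h *\<^sub>R v))
      (at s within J)"
    by (rule diff_chain_within)
  then show ?thesis
    by (simp add: has_vector_derivative_def o_def scaleR_sum_right)
qed

lemma word_deriv_cong_on:
  assumes "\<And>x. x \<in> S \<Longrightarrow> word_deriv S v f x = word_deriv S w g x" "x \<in> S"
  shows "word_deriv S (u @ v) f x = word_deriv S (u @ w) g x"
  using assms(2) by (induction u arbitrary: x) (auto simp: assms(1) intro: partial_deriv_cong)

lemma word_deriv_move_front:
  assumes S: "coord_box S"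
    and "Ck_on (length (p @ b # q)) S f" "set (p @ b # q) \<subseteq> Basis" "x \<in> S"
  shows "word_deriv S (p @ b # q) f x = word_deriv S (b # p @ q) f x"
  using assms(2-4)
proof (induction p arbitrary: x)
  case (Cons c p)
  have Ck: "Ck_on (length (p @ b # q)) S f" by (rule Ck_on_mono[OF Cons.prems(1)]) simp
  have "word_deriv S ([c] @ p @ b # q) f x = word_deriv S ([c] @ b # p @ q) f x"
    by (rule word_deriv_cong_on[OF Cons.IH[OF Ck]]) (use Cons.prems in auto)
  also have "\<dots> = partial_deriv S c (partial_deriv S b (word_deriv S (p @ q) f)) x" by simp
  \<comment> \<open>The remaining word \<open>p @ q\<close> uses up all but two orders of
    differentiability, just enough to exchange b and c.\<close>
  also have "\<dots> = partial_deriv S b (partial_deriv S c (word_deriv S (p @ q) f)) x"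
    using Cons.prems by (intro partial_deriv_commute[OF S] Ck_on_word_deriv) auto
  finally show ?case by simp
qed simp

text \<open>\<open>Ck_norm\<close> bounds only the derivatives taken in the order of \<open>basis_list\<close>, whereas a Taylor
  expansion along a segment involves all words.\<close>

lemma word_deriv_permute:
  assumes S: "coord_box S"
    and "Ck_on (length v) S f" "set v \<subseteq> Basis" "mset v = mset w" "x \<in> S"
  shows "word_deriv S v f x = word_deriv S w f x"
  using assms(2-5)
proof (induction v arbitrary: w x)
  case (Cons b v)
  then have "b \<in> set w" by (metis list.set_intros(1) mset_eq_setD)
  then obtain p q where w: "w = p @ b # q" by (meson split_list)
  then have ms: "mset v = mset (p @ q)" using Cons.prems by simp
  have Ck: "Ck_on (length v) S f" by (rule Ck_on_mono[OF Cons.prems(1)]) simp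
  have "word_deriv S ([b] @ v) f x = word_deriv S ([b] @ p @ q) f x"
    by (rule word_deriv_cong_on[OF Cons.IH[OF Ck _ ms]]) (use Cons.prems in auto)
  also have "\<dots> = word_deriv S w f x"
  proof -
    have "length (p @ b # q) = length (b # v)"
      using Cons.prems w by (metis size_mset)
    moreover have "set (p @ b # q) = set (b # v)"
      using Cons.prems w by (metis mset_eq_setD)
    ultimately show ?thesis unfolding w
      using word_deriv_move_front[OF S, of p b q f x] Cons.prems by simp
  qed
  finally show ?case by simp
qed simp

lemma word_deriv_replicate_append:
  "word_deriv S (replicate n b @ w) f = (partial_deriv S b ^^ n) (word_deriv S w f)"
  by (induction n) simp_all

lemma multi_deriv_eq_word_deriv:
  "multi_deriv S \<alpha> f = word_deriv S (concat (map (\<lambda>b. replicate (\<alpha> b) b) basis_list)) f"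
proof -
  have "foldr (\<lambda>b. partial_deriv S b ^^ \<alpha> b) bs f
      = word_deriv S (concat (map (\<lambda>b. replicate (\<alpha> b) b) bs)) f" for bs
    by (induction bs) (simp_all add: word_deriv_replicate_append)
  then show ?thesis unfolding multi_deriv_def by blast
qed

lemma count_concat_replicate:
  "distinct bs \<Longrightarrow>
    count (mset (concat (map (\<lambda>b. replicate (\<alpha> b) b) bs))) x = (if x \<in> set bs then \<alpha> x else 0)"
  by (induction bs) auto

text \<open>The maximum in \<open>Ck_norm\<close> ranges over this set, and \<open>Max\<close> says
  nothing about infinite sets.\<close>

lemma finite_multi_indices: "finite (multi_indices k :: ('a::euclidean_space \<Rightarrow> nat) set)"
proof (rule finite_subset)
  show "multi_indices k \<subseteq> {\<alpha> :: 'a \<Rightarrow> nat. \<forall>b. (b \<in> Basis \<longrightarrow> \<alpha> b \<in> {..k}) \<and> (b \<notin> Basis \<longrightarrow> \<alpha> b = 0)}"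
    unfolding multi_indices_def using order_trans[OF member_le_sum[of _ Basis]] by fastforce
qed (intro finite_set_of_finite_funs; simp)

text \<open>Sorting the letters of w by \<open>basis_list\<close> gives a derivative that
  \<open>Ck_norm\<close> sees, with the letter counts as multi-index. Compactness of \<Omega> makes
  the supremum a genuine upper bound.\<close>

lemma norm_word_deriv_le_Ck_norm:
  fixes f :: "'a::euclidean_space \<Rightarrow> 'b::real_normed_vector"
  assumes S: "coord_box S" and f: "Ck_on k S f" and \<Omega>: "\<Omega> \<subseteq> S" "compact \<Omega>"
    and w: "set w \<subseteq> Basis" "length w \<le> k" and x: "x \<in> \<Omega>"
  shows "norm (word_deriv S w f x) \<le> Ck_norm k S \<Omega> f"
proof -
  define \<alpha> where "\<alpha> = count (mset w)"
  have \<alpha>: "\<alpha> \<in> multi_indices k"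
  proof -
    have "(\<Sum>b\<in>Basis. count (mset w) b) = (\<Sum>b\<in>set w. count (mset w) b)"
      using w by (intro sum.mono_neutral_right) (auto simp: count_eq_zero_iff)
    also have "\<dots> = length w" by (metis set_mset_mset size_mset size_multiset_overloaded_eq)
    finally show ?thesis using w by (auto simp: multi_indices_def \<alpha>_def count_eq_zero_iff subset_iff)
  qed
  define v where "v = concat (map (\<lambda>b. replicate (\<alpha> b) b) (basis_list :: 'a list))"
  have v: "mset v = mset w"
  proof (rule multiset_eqI)
    fix b show "count (mset v) b = count (mset w) b"
      unfolding v_def count_concat_replicate[OF basis_list(1)] basis_list(2)
      using w by (auto simp: \<alpha>_def subset_iff)
  qed
  have lv: "length v = length w" using v by (metis size_mset)
  have sv: "set v = set w" using v by (metis mset_eq_setD)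
  have eq: "multi_deriv S \<alpha> f y = word_deriv S w f y" if "y \<in> S" for y
    unfolding multi_deriv_eq_word_deriv v_def[symmetric]
    using Ck_on_mono[OF f] w lv sv v that by (intro word_deriv_permute[OF S]) auto
  have "Ck_on 0 S (word_deriv S w f)"
    using Ck_on_mono[OF f w(2)] w by (intro Ck_on_word_deriv) auto
  then have "continuous_on \<Omega> (word_deriv S w f)" using \<Omega> by (auto intro: continuous_on_subset)
  then have "compact ((\<lambda>y. norm (word_deriv S w f y)) ` \<Omega>)"
    using \<Omega> by (intro compact_continuous_image continuous_intros)
  then have "bdd_above ((\<lambda>y. norm (word_deriv S w f y)) ` \<Omega>)"
    by (intro bounded_imp_bdd_above compact_imp_bounded)
  then have "norm (word_deriv S w f x) \<le> (SUP y\<in>\<Omega>. norm (word_deriv S w f y))"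
    using x by (intro cSUP_upper)
  also have "\<dots> = (SUP y\<in>\<Omega>. norm (multi_deriv S \<alpha> f y))"
    using eq \<Omega> by (intro SUP_cong refl) (auto simp: subset_iff)
  also have "\<dots> \<le> Ck_norm k S \<Omega> f"
    unfolding Ck_norm_def using \<alpha> finite_multi_indices by (intro Max_ge) auto
  finally show ?thesis .
qed

section \<open>Taylor expansion in words\<close>

lemma taylor_chain:
  fixes g :: "nat \<Rightarrow> real \<Rightarrow> real"
  assumes "\<And>m s. m < k \<Longrightarrow> s \<in> {0..1} \<Longrightarrow> (g m has_vector_derivative g (Suc m) s) (at s within {0..1})"
    and "\<And>s. s \<in> {0..1} \<Longrightarrow> \<bar>g k s\<bar> \<le> B" and "s \<in> {0..1}"
  shows "\<bar>g 0 s - (\<Sum>m<k. g m 0 * s ^ m / fact m)\<bar> \<le> B"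
  using assms
proof (induction k arbitrary: g s)
  case (Suc k)
  define h where "h s = g 0 s - (\<Sum>m<Suc k. g m 0 * s ^ m / fact m)" for s
  \<comment> \<open>The derivative of the Taylor remainder of \<open>g 0\<close> is the remainder,
    one order lower, of the shifted sequence. The induction hypothesis bounds it by B, and the mean
    value inequality on the unit interval keeps B.\<close>
  define h' where "h' s = g 1 s - (\<Sum>m<k. g (Suc m) 0 * s ^ m / fact m)" for s
  have deriv: "(h has_vector_derivative h' \<sigma>) (at \<sigma> within {0..1})" if "\<sigma> \<in> {0..1}" for \<sigma>
  proof -
    have "((\<lambda>s. \<Sum>m<Suc k. g m 0 * s ^ m / fact m) has_real_derivative
        (\<Sum>m<Suc k. g m 0 * (real m * \<sigma> ^ (m - 1)) / fact m)) (at \<sigma> within {0..1})"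
      by (rule DERIV_sum) (auto intro!: derivative_eq_intros)
    also have "(\<Sum>m<Suc k. g m 0 * (real m * \<sigma> ^ (m - 1)) / fact m) = (\<Sum>m<k. g (Suc m) 0 * \<sigma> ^ m / fact m)"
    proof -
      have "g (Suc m) 0 * (real (Suc m) * \<sigma> ^ m) / fact (Suc m) = g (Suc m) 0 * \<sigma> ^ m / fact m" for m
      proof -
        have "real (Suc m) / fact (Suc m) = 1 / fact m" by (simp add: fact_Suc del: of_nat_Suc)
        then have "g (Suc m) 0 * \<sigma> ^ m * (real (Suc m) / fact (Suc m)) = g (Suc m) 0 * \<sigma> ^ m * (1 / fact m)"
          by simp
        then show ?thesis by (simp add: mult_ac)
      qed
      then show ?thesis unfolding sum.lessThan_Suc_shift by simp
    qed
    finally show ?thesis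
      unfolding h_def h'_def using Suc.prems(1)[of 0 \<sigma>] that
      by (intro has_vector_derivative_diff) (auto simp: has_real_derivative_iff_has_vector_derivative)
  qed
  have h': "\<bar>h' \<sigma>\<bar> \<le> B" if "\<sigma> \<in> {0..1}" for \<sigma>
    using Suc.IH[of "\<lambda>m. g (Suc m)" \<sigma>] Suc.prems that by (simp add: h'_def)
  have "norm (h s - h 0 - s *\<^sub>R 0) \<le> B * \<bar>s\<bar>"
    using Suc.prems(3) by (intro segment_derivative_bound[OF _ _ _ deriv])
      (auto simp: closed_segment_eq_real_ivl h')
  moreover have "h 0 = 0" unfolding h_def sum.lessThan_Suc_shift by simp
  moreover have "B * \<bar>s\<bar> \<le> B * 1"
    using Suc.prems(3) order_trans[OF abs_ge_zero h'[of 0]] by (intro mult_left_mono) auto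
  ultimately show ?case by (simp add: h_def)
qed simp

text \<open>Along the segment from a to z, the m-th derivative is the sum over all words of length
  m, each letter contributing a coordinate of \<open>z - a\<close>. One-variable Taylor expansion
  then gives every word the weight \<open>1 / fact (length w)\<close>, and
  \<open>DIM('a) ^ k\<close> counts the words of length k. Derivatives are formed within S, while
  the bound M is asked for on the convex part \<Omega>, which contains the segment.\<close>

lemma taylor_words:
  fixes f :: "'a::euclidean_space \<Rightarrow> real"
  assumes S: "coord_box S" and f: "Ck_on k S f" and \<Omega>: "\<Omega> \<subseteq> S" "convex \<Omega>"
    and M: "\<And>w x. set w \<subseteq> Basis \<Longrightarrow> length w = k \<Longrightarrow> x \<in> \<Omega> \<Longrightarrow> \<bar>word_deriv S w f x\<bar> \<le> M"
    and a: "a \<in> \<Omega>" and z: "z \<in> \<Omega>"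
  shows "\<bar>f z - (\<Sum>w\<in>words k. word_deriv S w f a / fact (length w) * wpow (z - a) w)\<bar>
    \<le> real DIM('a) ^ k * M * norm (z - a) ^ k"
proof -
  define v where "v = z - a"
  define W where "W m = {w :: 'a list. set w \<subseteq> Basis \<and> length w = m}" for m
  have finW: "finite (W m)" for m unfolding W_def by (rule finite_lists_length_eq) simp
  define g where "g m s = (\<Sum>w\<in>W m. wpow v w * word_deriv S w f (a + s *\<^sub>R v))" for m s
  have seg: "a + s *\<^sub>R v \<in> \<Omega>" if "s \<in> {0..1}" for s
  proof -
    have "(1 - s) *\<^sub>R a + s *\<^sub>R z \<in> \<Omega>" using \<Omega>(2) a z that by (intro convexD) auto
    then show ?thesis by (simp add: v_def algebra_simps)
  qed
  have W_Suc: "W (Suc m) = (\<lambda>(b, w). b # w) ` (Basis \<times> W m)" for m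
    by (force simp: W_def length_Suc_conv image_iff)
  have deriv: "(g m has_vector_derivative g (Suc m) s) (at s within {0..1})"
    if "m < k" "s \<in> {0..1}" for m s
  proof -
    have "((\<lambda>s. \<Sum>w\<in>W m. wpow v w * word_deriv S w f (a + s *\<^sub>R v)) has_vector_derivative
        (\<Sum>w\<in>W m. wpow v w * (\<Sum>b\<in>Basis. (v \<bullet> b) *\<^sub>R partial_deriv S b (word_deriv S w f) (a + s *\<^sub>R v))))
        (at s within {0..1})"
    proof (intro has_vector_derivative_sum has_vector_derivative_mult_right has_vector_derivative_along_line[OF S])
      fix w assume w: "w \<in> W m"
      then have "Ck_on (1 + length w) S f" using that by (intro Ck_on_mono[OF f]) (auto simp: W_def)
      then show "Ck_on 1 S (word_deriv S w f)" using w by (intro Ck_on_word_deriv) (auto simp: W_def)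
    qed (use seg that \<Omega> in auto)
    also have "(\<Sum>w\<in>W m. wpow v w * (\<Sum>b\<in>Basis. (v \<bullet> b) *\<^sub>R partial_deriv S b (word_deriv S w f) (a + s *\<^sub>R v)))
        = (\<Sum>(b, w)\<in>Basis \<times> W m. wpow v (b # w) * word_deriv S (b # w) f (a + s *\<^sub>R v))"
      by (subst sum.cartesian_product[symmetric], subst sum.swap)
        (simp add: sum_distrib_left mult_ac)
    also have "\<dots> = g (Suc m) s"
      unfolding g_def W_Suc by (subst sum.reindex) (auto simp: inj_on_def case_prod_unfold)
    finally show ?thesis unfolding g_def[abs_def] .
  qed
  have bound: "\<bar>g k s\<bar> \<le> real DIM('a) ^ k * M * norm v ^ k" if "s \<in> {0..1}" for s
  proof -
    have "\<bar>g k s\<bar> \<le> (\<Sum>w\<in>W k. norm v ^ k * M)"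
      unfolding g_def
    proof (intro order_trans[OF sum_abs] sum_mono)
      fix w assume w: "w \<in> W k"
      have "\<bar>wpow v w\<bar> \<le> norm v ^ k" using abs_wpow_le[of w v] w by (simp add: W_def)
      moreover have "\<bar>word_deriv S w f (a + s *\<^sub>R v)\<bar> \<le> M" using M w seg[OF that] by (simp add: W_def)
      ultimately show "\<bar>wpow v w * word_deriv S w f (a + s *\<^sub>R v)\<bar> \<le> norm v ^ k * M"
        unfolding abs_mult by (intro mult_mono) auto
    qed
    then show ?thesis by (simp add: W_def card_lists_length_eq mult_ac)
  qed
  have "(\<Sum>w\<in>words k. word_deriv S w f a / fact (length w) * wpow v w)
      = (\<Sum>m<k. \<Sum>w | w \<in> words k \<and> length w = m. word_deriv S w f a / fact (length w) * wpow v w)"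
    by (rule sum.group[symmetric, OF finite_words]) (auto simp: words_def)
  also have "\<dots> = (\<Sum>m<k. g m 0 * 1 ^ m / fact m)"
  proof (rule sum.cong[OF refl])
    fix m assume "m \<in> {..<k}"
    then have "{w \<in> words k. length w = m} = W m" by (auto simp: words_def W_def)
    then show "(\<Sum>w | w \<in> words k \<and> length w = m. word_deriv S w f a / fact (length w) * wpow v w)
        = g m 0 * 1 ^ m / fact m"
      unfolding g_def by (auto simp: sum_divide_distrib W_def intro!: sum.cong)
  qed
  finally have sum_eq: "(\<Sum>w\<in>words k. word_deriv S w f a / fact (length w) * wpow v w)
      = (\<Sum>m<k. g m 0 * 1 ^ m / fact m)" .
  moreover have "g 0 1 = f z"
  proof -
    have "W 0 = {[]}" by (auto simp: W_def)
    then show ?thesis by (simp add: g_def v_def)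
  qed
  ultimately show ?thesis using taylor_chain[of k g "real DIM('a) ^ k * M * norm v ^ k" 1] deriv bound
    by (simp add: v_def)
qed

section \<open>ReLU circuits\<close>

text \<open>\<open>c\<close> counts weights, the constant term included.\<close>

inductive affine_comb :: "('a \<Rightarrow> real) set \<Rightarrow> nat \<Rightarrow> ('a \<Rightarrow> real) \<Rightarrow> bool" for G where
  zero: "affine_comb G 0 (\<lambda>_. 0)"
| const: "affine_comb G c f \<Longrightarrow> affine_comb G (Suc c) (\<lambda>x. f x + b)"
| add: "affine_comb G c f \<Longrightarrow> g \<in> G \<Longrightarrow> affine_comb G (Suc c) (\<lambda>x. f x + a * g x)"

lemma affine_comb_mono: "affine_comb G c f \<Longrightarrow> G \<subseteq> G' \<Longrightarrow> affine_comb G' c f"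
  by (induction rule: affine_comb.induct) (auto intro: affine_comb.intros)

lemma affine_comb_weaken:
  assumes "affine_comb G c f" "c \<le> c'"
  shows "affine_comb G c' f"
  using assms(2) by (induction rule: dec_induct) (use assms(1) affine_comb.const[of _ _ f 0] in auto)

lemma affine_comb_plus:
  assumes "affine_comb G c f" "affine_comb G c' g"
  shows "affine_comb G (c + c') (\<lambda>x. f x + g x)"
  using assms(2)
proof (induction rule: affine_comb.induct)
  case zero
  then show ?case using assms by simp
next
  case (const c' g b)
  then show ?case using affine_comb.const[of G "c + c'" "\<lambda>x. f x + g x" b] by (simp add: add.assoc)
next
  case (add c' g h a)
  then show ?case using affine_comb.add[of G "c + c'" "\<lambda>x. f x + g x" h a] by (simp add: add.assoc)
qed

lemma affine_comb_scale:
  assumes "affine_comb G c f"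
  shows "affine_comb G c (\<lambda>x. a * f x)"
  using assms
proof (induction rule: affine_comb.induct)
  case (const c f b)
  then show ?case using affine_comb.const[of G c "\<lambda>x. a * f x" "a * b"] by (simp add: distrib_left)
next
  case (add c f g a')
  then show ?case using affine_comb.add[of G c "\<lambda>x. a * f x" g "a * a'"] by (simp add: distrib_left mult.assoc)
qed (auto intro: affine_comb.zero)

lemma affine_comb_constant: "affine_comb G 1 (\<lambda>_. b)"
  using affine_comb.const[OF affine_comb.zero, of G b] by simp

lemma affine_comb_member: "g \<in> G \<Longrightarrow> affine_comb G 1 g"
  using affine_comb.add[OF affine_comb.zero, of g G 1] by simp

lemma affine_comb_sum:
  assumes "finite I" "\<And>i. i \<in> I \<Longrightarrow> affine_comb G (c i) (f i)"
  shows "affine_comb G (\<Sum>i\<in>I. c i) (\<lambda>x. \<Sum>i\<in>I. f i x)"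
  using assms by (induction I rule: finite_induct) (auto intro: affine_comb.zero affine_comb_plus)

lemma affine_comb_diff: "affine_comb G c f \<Longrightarrow> affine_comb G c' g \<Longrightarrow> affine_comb G (c + c') (\<lambda>x. f x - g x)"
  using affine_comb_plus[of G c f c' "\<lambda>x. - 1 * g x"] affine_comb_scale[of G c' g "- 1"] by simp

lemma continuous_on_affine_comb:
  "affine_comb G c f \<Longrightarrow> (\<And>g. g \<in> G \<Longrightarrow> continuous_on A g) \<Longrightarrow> continuous_on A f"
  by (induction rule: affine_comb.induct) (auto intro!: continuous_intros)

text \<open>\<open>relu_circuit L W G\<close>: some network with \<open>L\<close> hidden layers and \<open>W\<close> weights has all members of \<open>G\<close> among
  its inputs and neurons.\<close>

fun relu_circuit :: "nat \<Rightarrow> nat \<Rightarrow> ('a::euclidean_space \<Rightarrow> real) set \<Rightarrow> bool" where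
  "relu_circuit 0 W G \<longleftrightarrow> G \<subseteq> (\<lambda>b x. x \<bullet> b) ` Basis"
| "relu_circuit (Suc L) W G \<longleftrightarrow> (\<exists>W' G' hs. relu_circuit L W' G' \<and> (\<forall>(h, c)\<in>set hs. affine_comb G' c h) \<and>
     W' + sum_list (map snd hs) \<le> W \<and> G \<subseteq> G' \<union> (\<lambda>(h, c) x. relu (h x)) ` set hs)"

lemma relu_circuitI:
  assumes "relu_circuit L W' G'" "\<forall>(h, c)\<in>set hs. affine_comb G' c h" "W' + sum_list (map snd hs) \<le> W"
    "G \<subseteq> G' \<union> (\<lambda>(h, c) x. relu (h x)) ` set hs"
  shows "relu_circuit (Suc L) W G"
  using assms by auto

lemma relu_circuitE:
  assumes "relu_circuit (Suc L) W G"
  obtains W' G' hs where "relu_circuit L W' G'" "\<forall>(h, c)\<in>set hs. affine_comb G' c h"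
    "W' + sum_list (map snd hs) \<le> W" "G \<subseteq> G' \<union> (\<lambda>(h, c) x. relu (h x)) ` set hs"
  using assms by auto

declare relu_circuit.simps(2) [simp del]

lemma circuit_mono:
  assumes "relu_circuit L W G" "W \<le> W'" "G' \<subseteq> G"
  shows "relu_circuit L W' G'"
proof (cases L)
  case (Suc L')
  obtain W0 G0 hs where 1: "relu_circuit L' W0 G0" "\<forall>(h, c)\<in>set hs. affine_comb G0 c h" "W0 + sum_list (map snd hs) \<le> W"
      "G \<subseteq> G0 \<union> (\<lambda>(h, c) x. relu (h x)) ` set hs"
    using assms(1) unfolding Suc by (rule relu_circuitE)
  show ?thesis unfolding Suc by (rule relu_circuitI[OF 1(1,2)]) (use assms 1 in auto)
qed (use assms in auto)

text \<open>A layer without new neurons costs nothing, because every layer may read all earlier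
  ones. Depths can therefore be equalised for free before circuits are combined.\<close>

lemma circuit_Suc: "relu_circuit L W G \<Longrightarrow> relu_circuit (Suc L) W G"
  by (rule relu_circuitI[of L W G "[]"]) auto

lemma circuit_deeper:
  assumes "relu_circuit L W G" "L \<le> L'"
  shows "relu_circuit L' W G"
  using assms(2) by (induction rule: dec_induct) (use assms(1) circuit_Suc in auto)

lemma circuit_empty: "relu_circuit L 0 {}"
  by (rule circuit_deeper[of 0]) auto

text \<open>Parallel composition; equal depth is what lets the two circuits be merged layer by
  layer.\<close>

lemma circuit_Un:
  "relu_circuit L W G \<Longrightarrow> relu_circuit L W' G' \<Longrightarrow> relu_circuit L (W + W') (G \<union> G')"
proof (induction L arbitrary: W W' G G')
  case (Suc L)
  obtain W0 G0 hs where 1: "relu_circuit L W0 G0" "\<forall>(h, c)\<in>set hs. affine_comb G0 c h" "W0 + sum_list (map snd hs) \<le> W"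
      "G \<subseteq> G0 \<union> (\<lambda>(h, c) x. relu (h x)) ` set hs"
    using Suc.prems(1) by (rule relu_circuitE)
  obtain W0' G0' hs' where 2: "relu_circuit L W0' G0'" "\<forall>(h, c)\<in>set hs'. affine_comb G0' c h" "W0' + sum_list (map snd hs') \<le> W'"
      "G' \<subseteq> G0' \<union> (\<lambda>(h, c) x. relu (h x)) ` set hs'"
    using Suc.prems(2) by (rule relu_circuitE)
  have "relu_circuit L (W0 + W0') (G0 \<union> G0')" by (rule Suc.IH[OF 1(1) 2(1)])
  moreover have "\<forall>(h, c)\<in>set (hs @ hs'). affine_comb (G0 \<union> G0') c h"
    using 1(2) 2(2) by (auto intro: affine_comb_mono)
  ultimately show ?case by (rule relu_circuitI) (use 1(3-4) 2(3-4) in auto)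
qed auto

lemma circuit_UN:
  assumes "finite I" "\<And>i. i \<in> I \<Longrightarrow> relu_circuit L (W i) (G i)"
  shows "relu_circuit L (\<Sum>i\<in>I. W i) (\<Union>i\<in>I. G i)"
  using assms by (induction I rule: finite_induct) (auto intro: circuit_empty circuit_Un)

text \<open>Positive and negative part of f: their difference gives back f, their sum gives the
  absolute value. With \<open>G \<subseteq> G'\<close> a longer construction can still read the
  older neurons.\<close>

lemma circuit_relu_pair:
  assumes "relu_circuit L W G" "affine_comb G c f"
  obtains G' where "G \<subseteq> G'" "relu_circuit (Suc L) (W + 2 * c) G'"
    "(\<lambda>x. relu (f x)) \<in> G'" "(\<lambda>x. relu (- f x)) \<in> G'"
proof -
  let ?hs = "[(f, c), (\<lambda>x. - f x, c)]"
  have "affine_comb G c (\<lambda>x. - f x)" using affine_comb_scale[OF assms(2), of "- 1"] by simp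
  then have "relu_circuit (Suc L) (W + 2 * c) (G \<union> (\<lambda>(h, c) x. relu (h x)) ` set ?hs)"
    using assms by (intro relu_circuitI[of L W G ?hs]) auto
  then show ?thesis by (rule that[rotated]) auto
qed

lemma continuous_on_circuit:
  "relu_circuit L W G \<Longrightarrow> g \<in> G \<Longrightarrow> continuous_on A g"
proof (induction L arbitrary: W G g)
  case 0
  then show ?case by (auto intro!: continuous_intros)
next
  case (Suc L)
  obtain W0 G0 hs where 1: "relu_circuit L W0 G0" "\<forall>(h, c)\<in>set hs. affine_comb G0 c h"
      "G \<subseteq> G0 \<union> (\<lambda>(h, c) x. relu (h x)) ` set hs"
    using Suc.prems(1) by (rule relu_circuitE)
  have "continuous_on A h" if "(h, c) \<in> set hs" for h c
    using 1 that Suc.IH[OF 1(1)] by (auto intro: continuous_on_affine_comb)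
  then show ?case using 1 Suc.prems Suc.IH[OF 1(1)]
    by (auto simp: relu_def intro!: continuous_intros)
qed

text \<open>The constant \<open>2\<close> is the cost of \<open>f = relu f - relu (- f)\<close>: after one more layer every affine
  combination can be reused at this cost.\<close>

definition computes :: "nat \<Rightarrow> nat \<Rightarrow> ('a::euclidean_space \<Rightarrow> real) \<Rightarrow> bool" where
  "computes L W f \<longleftrightarrow> (\<exists>G. relu_circuit L W G \<and> affine_comb G 2 f)"

lemma computes_mono: "computes L W f \<Longrightarrow> L \<le> L' \<Longrightarrow> W \<le> W' \<Longrightarrow> computes L' W' f"
  unfolding computes_def using circuit_deeper circuit_mono by (metis order_refl)

lemma computes_materialise:
  assumes "relu_circuit L W G" "affine_comb G c f"
  shows "computes (Suc L) (W + 2 * c) f"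
proof -
  obtain G' where G': "relu_circuit (Suc L) (W + 2 * c) G'" "(\<lambda>x. relu (f x)) \<in> G'" "(\<lambda>x. relu (- f x)) \<in> G'"
    using circuit_relu_pair[OF assms] by metis
  have "affine_comb G' (1 + 1) (\<lambda>x. relu (f x) - relu (- f x))"
    by (intro affine_comb_diff affine_comb_member G')
  moreover have "relu (f x) - relu (- f x) = f x" for x by (simp add: relu_def max_def)
  ultimately show ?thesis unfolding computes_def using G'(1) by (auto simp: numeral_2_eq_2)
qed

lemma computes_const: "computes L 0 (\<lambda>_. b)"
  unfolding computes_def using circuit_empty[of L] affine_comb_weaken[OF affine_comb_constant, of 2] by force

lemma computes_affine_coord:
  assumes "b \<in> Basis"
  shows "computes 0 0 (\<lambda>x. a * (x \<bullet> b) + c)"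
proof -
  have "affine_comb {\<lambda>x. x \<bullet> b} (1 + 1) (\<lambda>x. a * (x \<bullet> b) + c)"
    by (intro affine_comb_plus affine_comb_scale affine_comb_constant affine_comb_member) simp
  then show ?thesis unfolding computes_def using assms
    by (intro exI[of _ "{\<lambda>x. x \<bullet> b}"]) (auto simp: numeral_2_eq_2)
qed

text \<open>A summand costs 2 in the linear combination, and materialising the result as positive
  and negative part doubles this to 4.\<close>

lemma computes_linear_comb:
  assumes "finite I" "\<And>i. i \<in> I \<Longrightarrow> computes L (W i) (f i)"
  shows "computes (Suc L) ((\<Sum>i\<in>I. W i) + 4 * card I) (\<lambda>x. \<Sum>i\<in>I. a i * f i x)"
proof -
  obtain G where G: "\<And>i. i \<in> I \<Longrightarrow> relu_circuit L (W i) (G i)" "\<And>i. i \<in> I \<Longrightarrow> affine_comb (G i) 2 (f i)"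
    using assms(2) unfolding computes_def by metis
  have "relu_circuit L (\<Sum>i\<in>I. W i) (\<Union>i\<in>I. G i)" by (rule circuit_UN[OF assms(1) G(1)])
  moreover have "affine_comb (\<Union>i\<in>I. G i) (\<Sum>i\<in>I. 2) (\<lambda>x. \<Sum>i\<in>I. a i * f i x)"
    using G(2) by (intro affine_comb_sum[OF assms(1)] affine_comb_scale) (auto intro: affine_comb_mono)
  ultimately have "computes (Suc L) ((\<Sum>i\<in>I. W i) + 2 * (\<Sum>i\<in>I. 2)) (\<lambda>x. \<Sum>i\<in>I. a i * f i x)"
    by (rule computes_materialise)
  then show ?thesis by (simp add: mult.commute)
qed

section \<open>Realising circuits by weight matrices\<close>

fun state :: "nn \<Rightarrow> real Matrix.vec \<Rightarrow> real Matrix.vec" where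
  "state [] z = z"
| "state ((A, b) # ls) z = state ls (z @\<^sub>v map_vec relu (A *\<^sub>v z + b))"

lemma state_append: "state (ls @ ls') z = state ls' (state ls z)"
  by (induction ls z rule: state.induct) auto

text \<open>\<open>state\<close> treats all layers as hidden ones, so that it composes; a network is
  such a state followed by one affine layer.\<close>

lemma realise_snoc: "realise (ls @ [(A, b)]) z = A *\<^sub>v state ls z + b"
proof (induction ls z rule: state.induct)
  case (2 A' b' ls z)
  then show ?case by (cases ls) auto
qed simp

definition layers_ok :: "nat \<Rightarrow> nn \<Rightarrow> bool" where
  "layers_ok m ls \<longleftrightarrow> (\<forall>l<length ls. 0 < width ls l \<and>
        fst (ls ! l) \<in> carrier_mat (width ls l) (m + (\<Sum>j<l. width ls j)) \<and>
        snd (ls ! l) \<in> carrier_vec (width ls l))"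

abbreviation state_dim :: "nat \<Rightarrow> nn \<Rightarrow> nat" where
  "state_dim m ls \<equiv> m + (\<Sum>j<length ls. width ls j)"

lemma width_append: "j < length ls \<Longrightarrow> width (ls @ ls') j = width ls j"
  by (simp add: width_def nth_append)

lemma layers_ok_snoc:
  "layers_ok m (ls @ [(A, b)]) \<longleftrightarrow> layers_ok m ls \<and> 0 < dim_row A \<and> dim_col A = state_dim m ls \<and>
     dim_vec b = dim_row A"
proof -
  have s: "(\<Sum>j<l. width (ls @ [(A, b)]) j) = (\<Sum>j<l. width ls j)" if "l \<le> length ls" for l
    using that by (intro sum.cong) (auto simp: width_append)
  have w: "width (ls @ [(A, b)]) (length ls) = dim_row A" by (simp add: width_def)
  define P where "P ls l \<longleftrightarrow> 0 < width ls l \<and> fst (ls ! l) \<in> carrier_mat (width ls l) (m + (\<Sum>j<l. width ls j)) \<and>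
    snd (ls ! l) \<in> carrier_vec (width ls l)" for ls l
  have 1: "P (ls @ [(A, b)]) l \<longleftrightarrow> P ls l" if "l < length ls" for l
    unfolding P_def s[OF less_imp_le[OF that]] using that by (simp add: width_append nth_append)
  have 2: "P (ls @ [(A, b)]) (length ls) \<longleftrightarrow> 0 < dim_row A \<and> dim_col A = state_dim m ls \<and> dim_vec b = dim_row A"
    unfolding P_def s[OF order_refl] w nth_append_length fst_conv snd_conv carrier_mat_def carrier_vec_def by blast
  have 3: "layers_ok m ls' \<longleftrightarrow> (\<forall>l<length ls'. P ls' l)" for ls' unfolding layers_ok_def P_def ..
  show ?thesis
    unfolding 3 length_append_singleton All_less_Suc 2 using 1 by auto
qed

lemma state_dim_snoc: "state_dim m (ls @ [(A, b)]) = state_dim m ls + dim_row A"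
  by (simp add: width_append) (simp add: width_def)

lemma state_snoc:
  "state (ls @ [(A, b)]) z = state ls z @\<^sub>v map_vec relu (A *\<^sub>v state ls z + b)"
  by (simp add: state_append)

lemma dim_state:
  assumes "layers_ok m ls" "dim_vec z = m"
  shows "dim_vec (state ls z) = state_dim m ls"
  using assms(1)
proof (induction ls rule: rev_induct)
  case (snoc l ls)
  then show ?case
    by (cases l) (simp add: state_snoc layers_ok_snoc state_dim_snoc del: sum.lessThan_Suc length_append)
qed (use assms in simp)

lemma is_nn_snoc:
  "is_nn m (ls @ [(A, b)]) \<longleftrightarrow> 0 < m \<and> layers_ok m (ls @ [(A, b)])"
  by (simp add: is_nn_def layers_ok_def)

lemma dim_coords [simp]: "dim_vec (coords (x :: 'a::euclidean_space)) = DIM('a)"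
  using distinct_card[OF basis_list(1), where 'a1='a] by (simp add: coords_def basis_list(2))

lemma length_basis_list [simp]: "length (basis_list :: 'a::euclidean_space list) = DIM('a)"
  using distinct_card[OF basis_list(1), where 'a1='a] by (simp add: basis_list(2))

lemma coords_index: "i < DIM('a) \<Longrightarrow> coords (x :: 'a::euclidean_space) $ i = x \<bullet> (basis_list ! i)"
  by (simp add: coords_def vec_of_list_index)

text \<open>Each \<open>add\<close> step changes one entry of the row and each \<open>const\<close>
  step only the bias, so c dominates the number of nonzero entries. Equality may fail because steps
  can hit the same entry or cancel. The index of a member of G is the same for all x, hence one row
  serves all inputs.\<close>

lemma affine_comb_imp_row:
  assumes "affine_comb G c f" and dim: "\<And>x. dim_vec (z x) = D" and G: "\<And>g. g \<in> G \<Longrightarrow> \<exists>i<D. \<forall>x. g x = z x $ i"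
  shows "\<exists>r b. dim_vec r = D \<and> (\<forall>x. f x = Matrix.scalar_prod r (z x) + b) \<and>
    card {j. j < D \<and> r $ j \<noteq> 0} + (if b = 0 then 0 else 1) \<le> c"
  using assms(1)
proof (induction rule: affine_comb.induct)
  case zero
  show ?case
    by (rule exI[of _ "0\<^sub>v D"], rule exI[of _ 0]) (auto simp: scalar_prod_def dim)
next
  case (const c f b)
  then obtain r b' where r: "dim_vec r = D" "\<forall>x. f x = Matrix.scalar_prod r (z x) + b'"
    "card {j. j < D \<and> r $ j \<noteq> 0} + (if b' = 0 then 0 else 1) \<le> c" by blast
  then show ?case by (intro exI[of _ r] exI[of _ "b' + b"]) auto
next
  case (add c f g a)
  then obtain r b where r: "dim_vec r = D" "\<forall>x. f x = Matrix.scalar_prod r (z x) + b"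
    "card {j. j < D \<and> r $ j \<noteq> 0} + (if b = 0 then 0 else 1) \<le> c" by blast
  obtain i where i: "i < D" "\<And>x. g x = z x $ i" using G[OF add(2)] by blast
  let ?r = "r + a \<cdot>\<^sub>v unit_vec D i"
  have "Matrix.scalar_prod ?r (z x) = Matrix.scalar_prod r (z x) + a * g x" for x
  proof -
    have zc: "z x \<in> carrier_vec D" "r \<in> carrier_vec D"
      using dim r(1) by (simp_all only: carrier_vecI)
    have "Matrix.scalar_prod ?r (z x) = Matrix.scalar_prod r (z x) + Matrix.scalar_prod (a \<cdot>\<^sub>v unit_vec D i) (z x)"
      by (rule add_scalar_prod_distrib) (use zc in auto)
    also have "Matrix.scalar_prod (a \<cdot>\<^sub>v unit_vec D i) (z x) = a * g x"
      using zc i by (simp add: scalar_prod_smult_left scalar_prod_left_unit)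
    finally show ?thesis .
  qed
  moreover have "card {j. j < D \<and> ?r $ j \<noteq> 0} \<le> Suc (card {j. j < D \<and> r $ j \<noteq> 0})"
  proof -
    have "{j. j < D \<and> ?r $ j \<noteq> 0} \<subseteq> insert i {j. j < D \<and> r $ j \<noteq> 0}"
      using r(1) by (auto simp: unit_vec_def)
    then have "card {j. j < D \<and> ?r $ j \<noteq> 0} \<le> card (insert i {j. j < D \<and> r $ j \<noteq> 0})"
      by (intro card_mono) auto
    also have "\<dots> \<le> Suc (card {j. j < D \<and> r $ j \<noteq> 0})" by (simp add: card_insert_if)
    finally show ?thesis .
  qed
  ultimately show ?case using r by (intro exI[of _ ?r] exI[of _ b]) auto
qed

lemma mat_nonzeros_rows:
  assumes "\<And>i. i < n \<Longrightarrow> dim_vec (R i) = D"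
  shows "mat_nonzeros (mat n D (\<lambda>(i, j). R i $ j)) = (\<Sum>i<n. card {j. j < D \<and> R i $ j \<noteq> 0})"
proof -
  have "{(i, j). i < n \<and> j < D \<and> mat n D (\<lambda>(i, j). R i $ j) $$ (i, j) \<noteq> 0}
      = (SIGMA i:{..<n}. {j. j < D \<and> R i $ j \<noteq> 0})" by auto
  then show ?thesis unfolding mat_nonzeros_def by simp
qed

lemma vec_nonzeros_vec: "vec_nonzeros (vec n \<beta>) = (\<Sum>i<n. if \<beta> i = 0 then 0 else 1)"
proof -
  have "{i. i < n \<and> vec n \<beta> $ i \<noteq> 0} = {i \<in> {..<n}. \<beta> i \<noteq> 0}" by auto
  then show ?thesis unfolding vec_nonzeros_def by (simp add: sum.If_cases Int_def)
qed

lemma affine_comb_layer: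
  fixes z :: "'a \<Rightarrow> real Matrix.vec"
  assumes hs: "\<forall>(h, c)\<in>set hs. affine_comb G c h" and dim: "\<And>x. dim_vec (z x) = D"
    and G: "\<And>g. g \<in> G \<Longrightarrow> \<exists>i<D. \<forall>x. g x = z x $ i"
  obtains A b where "A \<in> carrier_mat (length hs) D" "b \<in> carrier_vec (length hs)"
    "mat_nonzeros A + vec_nonzeros b \<le> sum_list (map snd hs)"
    "\<And>i x. i < length hs \<Longrightarrow> (A *\<^sub>v z x + b) $ i = fst (hs ! i) x"
proof -
  define P where "P i r b \<longleftrightarrow> dim_vec r = D \<and> (\<forall>x. fst (hs ! i) x = Matrix.scalar_prod r (z x) + b) \<and>
    card {j. j < D \<and> r $ j \<noteq> 0} + (if b = 0 then 0 else 1) \<le> snd (hs ! i)" for i r and b :: real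
  have "\<exists>r b. P i r b" if "i < length hs" for i
  proof -
    have "affine_comb G (snd (hs ! i)) (fst (hs ! i))"
      using hs nth_mem[OF that] by (auto simp: case_prod_unfold)
    then show ?thesis
      unfolding P_def by (rule affine_comb_imp_row) (use dim G in auto)
  qed
  then obtain R \<beta> where P: "\<And>i. i < length hs \<Longrightarrow> P i (R i) (\<beta> i)" by metis
  have R: "\<And>i. i < length hs \<Longrightarrow> dim_vec (R i) = D"
      "\<And>i x. i < length hs \<Longrightarrow> fst (hs ! i) x = Matrix.scalar_prod (R i) (z x) + \<beta> i"
      "\<And>i. i < length hs \<Longrightarrow> card {j. j < D \<and> R i $ j \<noteq> 0} + (if \<beta> i = 0 then 0 else 1) \<le> snd (hs ! i)"
    using P unfolding P_def by blast+
  define A where "A = mat (length hs) D (\<lambda>(i, j). R i $ j)"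
  define b where "b = vec (length hs) \<beta>"
  have "mat_nonzeros A + vec_nonzeros b
      = (\<Sum>i<length hs. card {j. j < D \<and> R i $ j \<noteq> 0} + (if \<beta> i = 0 then 0 else 1))"
    unfolding A_def b_def by (simp add: mat_nonzeros_rows R(1) vec_nonzeros_vec sum.distrib)
  also have "\<dots> \<le> (\<Sum>i<length hs. snd (hs ! i))" by (intro sum_mono R(3)) auto
  also have "\<dots> = sum_list (map snd hs)" by (simp add: sum_list_sum_nth atLeast0LessThan)
  finally have "mat_nonzeros A + vec_nonzeros b \<le> sum_list (map snd hs)" .
  moreover have "(A *\<^sub>v z x + b) $ i = fst (hs ! i) x" if "i < length hs" for i x
  proof -
    have "row A i = R i" using that R(1) by (auto simp: A_def)
    then show ?thesis using that R(2) by (simp add: A_def b_def)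
  qed
  ultimately show ?thesis by (intro that[of A b]) (auto simp: A_def b_def)
qed

lemma num_weights_snoc: "num_weights (ls @ [(A, b)]) = num_weights ls + (mat_nonzeros A + vec_nonzeros b)"
  by (simp add: num_weights_def)

text \<open>Old members of G keep their index when a layer is appended, since the state grows only
  at its end; the new members occupy the appended coordinates.\<close>

lemma circuit_imp_layers:
  fixes G :: "('a::euclidean_space \<Rightarrow> real) set"
  assumes "relu_circuit L W G"
  shows "\<exists>ls. length ls = L \<and> layers_ok DIM('a) ls \<and> num_weights ls \<le> W \<and>
    (\<forall>g\<in>G. \<exists>i<state_dim DIM('a) ls. \<forall>x. g x = state ls (coords x) $ i)"
  using assms
proof (induction L arbitrary: W G)
  case 0
  have "\<exists>i<DIM('a). \<forall>x. x \<bullet> b = coords x $ i" if b: "b \<in> Basis" for b :: 'a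
  proof -
    obtain i where "i < length (basis_list :: 'a list)" "basis_list ! i = b"
      using b unfolding basis_list(2)[symmetric] in_set_conv_nth by blast
    then show ?thesis by (intro exI[of _ i]) (simp add: coords_index)
  qed
  then have "\<forall>g\<in>G. \<exists>i<DIM('a). \<forall>x. g x = coords x $ i" using 0 by auto
  then show ?case by (intro exI[of _ "[]"]) (simp add: layers_ok_def num_weights_def)
next
  case (Suc L)
  obtain W0 G0 hs where 1: "relu_circuit L W0 G0" "\<forall>(h, c)\<in>set hs. affine_comb G0 c h" "W0 + sum_list (map snd hs) \<le> W"
      "G \<subseteq> G0 \<union> (\<lambda>(h, c) x. relu (h x)) ` set hs"
    using Suc.prems(1) by (rule relu_circuitE)
  obtain ls where ls: "length ls = L" "layers_ok DIM('a) ls" "num_weights ls \<le> W0"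
    "\<And>g. g \<in> G0 \<Longrightarrow> \<exists>i<state_dim DIM('a) ls. \<forall>x. g x = state ls (coords x) $ i"
    using Suc.IH[OF 1(1)] by blast
  \<comment> \<open>The additional zero neuron has no weights and keeps the width positive.\<close>
  let ?hs = "(\<lambda>_. 0, 0) # hs" and ?D = "state_dim DIM('a) ls"
  have dim: "dim_vec (state ls (coords x)) = ?D" for x :: 'a by (rule dim_state[OF ls(2)]) simp
  have "\<forall>(h, c)\<in>set ?hs. affine_comb G0 c h" using 1(2) by (auto intro: affine_comb.zero)
  then obtain A b where A: "A \<in> carrier_mat (length ?hs) ?D" "b \<in> carrier_vec (length ?hs)"
    "mat_nonzeros A + vec_nonzeros b \<le> sum_list (map snd ?hs)"
    "\<And>i x. i < length ?hs \<Longrightarrow> (A *\<^sub>v state ls (coords x) + b) $ i = fst (?hs ! i) x"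
    by (rule affine_comb_layer[OF _ dim ls(4)]) blast+
  let ?ls = "ls @ [(A, b)]"
  have D': "state_dim DIM('a) ?ls = ?D + length ?hs"
    using A(1) unfolding state_dim_snoc by simp
  show ?case
  proof (intro exI[of _ ?ls] conjI ballI)
    show "layers_ok DIM('a) ?ls" unfolding layers_ok_snoc using ls(2) A by auto
    show "num_weights ?ls \<le> W" unfolding num_weights_snoc using A(3) 1(3) ls(3) by simp
    fix g assume "g \<in> G"
    then consider "g \<in> G0" | h c where "(h, c) \<in> set hs" "g = (\<lambda>x. relu (h x))" using 1(4) by fastforce
    then show "\<exists>i<state_dim DIM('a) ?ls. \<forall>x. g x = state ?ls (coords x) $ i"
    proof cases
      case 1
      then obtain i where "i < ?D" "\<And>x. g x = state ls (coords x) $ i" using ls(4) by blast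
      then show ?thesis unfolding D' state_snoc
        by (intro exI[of _ i]) (simp add: dim)
    next
      case 2
      then obtain i where i: "i < length ?hs" "?hs ! i = (h, c)"
        by (metis in_set_conv_nth list.set_intros(2))
      have "g x = state ?ls (coords x) $ (?D + i)" for x
        using A(1,2) A(4)[OF i(1), of x] i unfolding state_snoc
        by (simp add: dim 2 del: length_Cons list.size)
      then show ?thesis unfolding D' using i(1) by (intro exI[of _ "?D + i"]) simp
    qed
  qed (use ls in simp)
qed

lemma network_of_circuit:
  fixes f :: "'a::euclidean_space \<Rightarrow> real"
  assumes "relu_circuit L W G" "affine_comb G c f"
  obtains \<Phi> where "is_nn DIM('a) \<Phi>" "output_dim \<Phi> = 1" "num_layers \<Phi> = Suc L"
    "num_weights \<Phi> \<le> W + c" "\<And>x. nn_fun \<Phi> x = f x"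
proof -
  obtain ls where ls: "length ls = L" "layers_ok DIM('a) ls" "num_weights ls \<le> W"
    "\<And>g. g \<in> G \<Longrightarrow> \<exists>i<state_dim DIM('a) ls. \<forall>x. g x = state ls (coords x) $ i"
    using circuit_imp_layers[OF assms(1)] by blast
  let ?D = "state_dim DIM('a) ls"
  have dim: "dim_vec (state ls (coords x)) = ?D" for x :: 'a by (rule dim_state[OF ls(2)]) simp
  have "\<forall>(h, c)\<in>set [(f, c)]. affine_comb G c h" using assms by simp
  then obtain A b where A: "A \<in> carrier_mat (length [(f, c)]) ?D" "b \<in> carrier_vec (length [(f, c)])"
    "mat_nonzeros A + vec_nonzeros b \<le> sum_list (map snd [(f, c)])"
    "\<And>i x. i < length [(f, c)] \<Longrightarrow> (A *\<^sub>v state ls (coords x) + b) $ i = fst ([(f, c)] ! i) x"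
    by (rule affine_comb_layer[OF _ dim ls(4)]) blast+
  show ?thesis
  proof (rule that[of "ls @ [(A, b)]"])
    show "is_nn DIM('a) (ls @ [(A, b)])" unfolding is_nn_snoc layers_ok_snoc using ls(2) A by auto
    show "output_dim (ls @ [(A, b)]) = 1" using A by (simp add: output_dim_def width_def)
    show "num_layers (ls @ [(A, b)]) = Suc L" by (simp add: num_layers_def ls)
    show "num_weights (ls @ [(A, b)]) \<le> W + c" unfolding num_weights_snoc using A(3) ls(3) by simp
    show "nn_fun (ls @ [(A, b)]) x = f x" for x
      using A(4)[of 0 x] by (simp add: nn_fun_def realise_snoc)
  qed
qed

section \<open>Feeding circuits into a network\<close>

lemma affine_comb_matrix_row:
  assumes "i < dim_row A" "dim_vec b = dim_row A" "\<And>p. dim_vec (z p) = dim_col A"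
    and "\<And>j. j < dim_col A \<Longrightarrow> affine_comb G 2 (\<lambda>p. z p $ j)"
  shows "affine_comb G (2 * card {j. j < dim_col A \<and> A $$ (i, j) \<noteq> 0} + (if b $ i = 0 then 0 else 1))
    (\<lambda>p. (A *\<^sub>v z p + b) $ i)"
proof -
  let ?J = "{j. j < dim_col A \<and> A $$ (i, j) \<noteq> 0}"
  have "(A *\<^sub>v z p + b) $ i = (\<Sum>j\<in>?J. A $$ (i, j) * z p $ j) + b $ i" for p
  proof -
    have "(A *\<^sub>v z p + b) $ i = (\<Sum>j\<in>{0..<dim_col A}. A $$ (i, j) * z p $ j) + b $ i"
      using assms by (simp add: scalar_prod_def)
    also have "(\<Sum>j\<in>{0..<dim_col A}. A $$ (i, j) * z p $ j) = (\<Sum>j\<in>?J. A $$ (i, j) * z p $ j)"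
      by (intro sum.mono_neutral_right) auto
    finally show ?thesis .
  qed
  moreover have "affine_comb G (\<Sum>j\<in>?J. 2) (\<lambda>p. \<Sum>j\<in>?J. A $$ (i, j) * z p $ j)"
    by (intro affine_comb_sum affine_comb_scale assms(4)) auto
  moreover have "affine_comb G (if b $ i = 0 then 0 else 1) (\<lambda>p. b $ i)"
    using affine_comb_constant[of G "b $ i"] affine_comb.zero[of G] by auto
  ultimately show ?thesis using affine_comb_plus[of G "\<Sum>j\<in>?J. 2" _ "if b $ i = 0 then 0 else 1"]
    by (simp add: mult.commute)
qed

lemma mat_nonzeros_sum: "mat_nonzeros A = (\<Sum>i<dim_row A. card {j. j < dim_col A \<and> A $$ (i, j) \<noteq> 0})"
proof -
  have "{(i, j). i < dim_row A \<and> j < dim_col A \<and> A $$ (i, j) \<noteq> 0}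
      = (SIGMA i:{..<dim_row A}. {j. j < dim_col A \<and> A $$ (i, j) \<noteq> 0})" by auto
  then show ?thesis unfolding mat_nonzeros_def by simp
qed

lemma vec_nonzeros_sum: "vec_nonzeros b = (\<Sum>i<dim_vec b. if b $ i = 0 then 0 else 1)"
proof -
  have "{i. i < dim_vec b \<and> b $ i \<noteq> 0} = {i \<in> {..<dim_vec b}. b $ i \<noteq> 0}" by auto
  then show ?thesis unfolding vec_nonzeros_def by (simp add: sum.If_cases Int_def)
qed

text \<open>A coordinate of F is an affine combination of cost 2 instead of an input, so every
  nonzero matrix entry is paid twice; this is the factor 2 in front of
  \<open>num_weights ls\<close>. The cost does not accumulate over the layers, since a neuron is a
  member of the circuit and thus again available at cost at most 2.\<close>

lemma circuit_compose_layers: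
  fixes F :: "'a::euclidean_space \<Rightarrow> 'b::euclidean_space"
  assumes G: "relu_circuit L W G" "\<And>b. b \<in> Basis \<Longrightarrow> affine_comb G 2 (\<lambda>p. F p \<bullet> b)" and ls: "layers_ok DIM('b) ls"
  shows "\<exists>G'. relu_circuit (L + length ls) (W + 2 * num_weights ls) G' \<and>
    (\<forall>i<state_dim DIM('b) ls. affine_comb G' 2 (\<lambda>p. state ls (coords (F p)) $ i))"
  using ls
proof (induction ls rule: rev_induct)
  case Nil
  have "affine_comb G 2 (\<lambda>p. coords (F p) $ i)" if "i < DIM('b)" for i
    using that G(2)[of "basis_list ! i"] basis_list(2)[where 'a='b] nth_mem[of i "basis_list :: 'b list"]
    by (simp add: coords_index)
  then show ?case using G(1) by (intro exI[of _ G]) (simp add: num_weights_def)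
next
  case (snoc l ls)
  obtain A b where l: "l = (A, b)" by (cases l)
  have ok: "layers_ok DIM('b) ls" "0 < dim_row A" "dim_col A = state_dim DIM('b) ls" "dim_vec b = dim_row A"
    using snoc.prems unfolding l layers_ok_snoc by auto
  obtain G' where G': "relu_circuit (L + length ls) (W + 2 * num_weights ls) G'"
    "\<And>i. i < state_dim DIM('b) ls \<Longrightarrow> affine_comb G' 2 (\<lambda>p. state ls (coords (F p)) $ i)"
    using snoc.IH[OF ok(1)] by blast
  let ?z = "\<lambda>p. state ls (coords (F p))"
  have dim: "dim_vec (?z p) = dim_col A" for p unfolding ok(3) by (rule dim_state[OF ok(1)]) simp
  define c where "c i = 2 * card {j. j < dim_col A \<and> A $$ (i, j) \<noteq> 0} + (if b $ i = 0 then 0 else 1)" for i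
  define h where "h i = (\<lambda>p. (A *\<^sub>v ?z p + b) $ i)" for i
  define hs where "hs = map (\<lambda>i. (h i, c i)) [0..<dim_row A]"
  have row: "affine_comb G' (c i) (h i)" if "i < dim_row A" for i
    unfolding c_def h_def by (rule affine_comb_matrix_row) (use that ok dim G' in auto)
  have "sum_list (map snd hs) = (\<Sum>i<dim_row A. c i)"
    by (simp add: hs_def o_def interv_sum_list_conv_sum_set_nat atLeast0LessThan)
  also have "\<dots> = 2 * mat_nonzeros A + vec_nonzeros b"
    unfolding c_def mat_nonzeros_sum vec_nonzeros_sum ok(4) by (simp add: sum.distrib sum_distrib_left)
  finally have W: "W + 2 * num_weights ls + sum_list (map snd hs) \<le> W + 2 * num_weights (ls @ [(A, b)])"
    unfolding num_weights_snoc by simp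
  let ?G = "G' \<union> (\<lambda>(h, c) x. relu (h x)) ` set hs"
  have "relu_circuit (Suc (L + length ls)) (W + 2 * num_weights (ls @ [(A, b)])) ?G"
    by (rule relu_circuitI[OF G'(1) _ W]) (auto simp: hs_def row)
  moreover have "affine_comb ?G 2 (\<lambda>p. state (ls @ [(A, b)]) (coords (F p)) $ i)"
    if i: "i < state_dim DIM('b) (ls @ [(A, b)])" for i
  proof (cases "i < state_dim DIM('b) ls")
    case True
    then have "(\<lambda>p. state (ls @ [(A, b)]) (coords (F p)) $ i) = (\<lambda>p. ?z p $ i)"
      unfolding state_snoc using ok by (simp add: dim)
    then show ?thesis using G'(2)[OF True] by (auto intro: affine_comb_mono)
  next
    case False
    define i' where "i' = i - state_dim DIM('b) ls"
    have i': "i' < dim_row A" "i = state_dim DIM('b) ls + i'"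
      using False i unfolding state_dim_snoc by (auto simp: i'_def)
    have "(\<lambda>p. state (ls @ [(A, b)]) (coords (F p)) $ i) = (\<lambda>p. relu (h i' p))"
      unfolding state_snoc using ok i' by (simp add: dim h_def)
    moreover have "(\<lambda>p. relu (h i' p)) \<in> ?G"
      using i' by (force simp: hs_def)
    ultimately show ?thesis using affine_comb_weaken[OF affine_comb_member, of _ ?G 2] by simp
  qed
  ultimately show ?case unfolding l by (intro exI[of _ ?G]) simp
qed

text \<open>The last layer of \<Phi> has no activation, so the row that \<open>nn_fun\<close> reads
  is returned as an affine combination rather than as a further hidden layer. Its cost is charged to
  the weights of that layer.\<close>

lemma circuit_compose:
  fixes F :: "'a::euclidean_space \<Rightarrow> 'b::euclidean_space"
  assumes F: "\<And>b. b \<in> Basis \<Longrightarrow> computes L (W b) (\<lambda>p. F p \<bullet> b)"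
    and \<Phi>: "is_nn DIM('b) \<Phi>"
  obtains G W' c where "relu_circuit (L + length \<Phi> - 1) W' G" "affine_comb G c (\<lambda>p. nn_fun \<Phi> (F p))"
    "W' + c \<le> (\<Sum>b\<in>Basis. W b) + 2 * num_weights \<Phi>"
proof -
  obtain G where G: "\<And>b. b \<in> Basis \<Longrightarrow> relu_circuit L (W b) (G b)" "\<And>b. b \<in> Basis \<Longrightarrow> affine_comb (G b) 2 (\<lambda>p. F p \<bullet> b)"
    using F unfolding computes_def by metis
  have 1: "relu_circuit L (\<Sum>b\<in>Basis. W b) (\<Union>b\<in>Basis. G b)" by (rule circuit_UN[OF finite_Basis G(1)])
  have 2: "affine_comb (\<Union>b\<in>Basis. G b) 2 (\<lambda>p. F p \<bullet> b)" if "b \<in> Basis" for b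
    using G(2)[OF that] that by (auto intro: affine_comb_mono)
  have ne: "\<Phi> \<noteq> []" using \<Phi> by (simp add: is_nn_def)
  define ls where "ls = butlast \<Phi>"
  obtain A b where "last \<Phi> = (A, b)" by (cases "last \<Phi>")
  then have \<Phi>_eq: "\<Phi> = ls @ [(A, b)]" using ne unfolding ls_def by (metis append_butlast_last_id)
  have ok: "layers_ok DIM('b) ls" "0 < dim_row A" "dim_col A = state_dim DIM('b) ls" "dim_vec b = dim_row A"
    using \<Phi> unfolding \<Phi>_eq is_nn_snoc layers_ok_snoc by auto
  obtain G' where G': "relu_circuit (L + length ls) ((\<Sum>b\<in>Basis. W b) + 2 * num_weights ls) G'"
    "\<And>i. i < state_dim DIM('b) ls \<Longrightarrow> affine_comb G' 2 (\<lambda>p. state ls (coords (F p)) $ i)"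
    using circuit_compose_layers[OF 1 2 ok(1)] by blast
  have dim: "dim_vec (state ls (coords (F p))) = dim_col A" for p
    unfolding ok(3) by (rule dim_state[OF ok(1)]) simp
  define c where "c = 2 * card {j. j < dim_col A \<and> A $$ (0, j) \<noteq> 0} + (if b $ 0 = 0 then 0 else 1)"
  have "affine_comb G' c (\<lambda>p. (A *\<^sub>v state ls (coords (F p)) + b) $ 0)"
    unfolding c_def by (rule affine_comb_matrix_row) (use ok dim G' in auto)
  then have "affine_comb G' c (\<lambda>p. nn_fun \<Phi> (F p))" by (simp add: nn_fun_def \<Phi>_eq realise_snoc)
  moreover have "c \<le> 2 * (mat_nonzeros A + vec_nonzeros b)"
  proof -
    have "card {j. j < dim_col A \<and> A $$ (0, j) \<noteq> 0} \<le> mat_nonzeros A"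
      unfolding mat_nonzeros_sum using ok(2) by (intro member_le_sum) auto
    moreover have "(if b $ 0 = 0 then 0 else 1) \<le> vec_nonzeros b"
      unfolding vec_nonzeros_sum using ok by (intro member_le_sum[of 0]) auto
    ultimately show ?thesis unfolding c_def by simp
  qed
  ultimately show ?thesis using G'(1)
    by (intro that[of _ G' c]) (auto simp: \<Phi>_eq num_weights_snoc)
qed

text \<open>Feeding the identity into \<Phi> presents it as an affine combination over a circuit,
  and those are continuous. Continuity later lets essential bounds be read pointwise.\<close>

lemma continuous_on_nn_fun:
  fixes \<Phi> :: nn
  assumes "is_nn DIM('a) \<Phi>"
  shows "continuous_on A (nn_fun \<Phi> :: 'a::euclidean_space \<Rightarrow> real)"
proof -
  have "computes 0 0 (\<lambda>p :: 'a. p \<bullet> b)" if "b \<in> Basis" for b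
    using computes_affine_coord[OF that, of 1 0] by simp
  then obtain G W' c where "relu_circuit (0 + length \<Phi> - 1) W' G" "affine_comb G c (\<lambda>p :: 'a. nn_fun \<Phi> p)"
    using circuit_compose[of 0 "\<lambda>_. 0" "\<lambda>p :: 'a. p" \<Phi>] assms by metis
  then show ?thesis by (auto intro: continuous_on_affine_comb continuous_on_circuit)
qed

section \<open>Circuits for products and local polynomials\<close>

definition tent :: "real \<Rightarrow> real" where
  "tent y = 1 - \<bar>2 * y - 1\<bar>"

text \<open>On the unit interval, y - y * y is the sum of tent^i(y) / 4^i over i \<ge> 1, so |x|
  minus a partial sum approximates the square of x. Each iterate costs one layer and divides the
  error by 4; this is where the logarithmic depth comes from.\<close>

definition sq_approx :: "nat \<Rightarrow> real \<Rightarrow> real" where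
  "sq_approx m x = \<bar>x\<bar> - (\<Sum>i<m. (tent ^^ Suc i) \<bar>x\<bar> / 4 ^ Suc i)"

lemma tent_bounds: "0 \<le> y \<Longrightarrow> y \<le> 1 \<Longrightarrow> 0 \<le> tent y \<and> tent y \<le> 1"
  by (simp add: tent_def abs_if)

lemma funpow_tent_bounds: "0 \<le> y \<Longrightarrow> y \<le> 1 \<Longrightarrow> 0 \<le> (tent ^^ i) y \<and> (tent ^^ i) y \<le> 1"
  by (induction i) (simp_all add: tent_bounds)

text \<open>Iterates \<open>y - y\<^sup>2 = tent y / 4 + (tent y - (tent y)\<^sup>2) / 4\<close>.\<close>

lemma tent_series:
  assumes "0 \<le> y" "y \<le> 1"
  shows "0 \<le> y - y\<^sup>2 - (\<Sum>i<m. (tent ^^ Suc i) y / 4 ^ Suc i) \<and>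
    y - y\<^sup>2 - (\<Sum>i<m. (tent ^^ Suc i) y / 4 ^ Suc i) \<le> (1 / 4) ^ m"
  using assms
proof (induction m arbitrary: y)
  case 0
  then have "y\<^sup>2 \<le> y" by (simp add: power2_eq_square mult_left_le)
  moreover have "0 \<le> y\<^sup>2" by simp
  ultimately show ?case using 0 by (auto intro: order_trans[of _ y])
next
  case (Suc m)
  define r where "r y = y - y\<^sup>2 - (\<Sum>i<m. (tent ^^ Suc i) y / 4 ^ Suc i)" for y
  have gen: "A = t / 4 + X / 4 \<Longrightarrow> v = t / 4 + (t - u) / 4 \<Longrightarrow> v - A = (t - u - X) / 4"
    for A X t u v :: real by simp
  have "(\<Sum>i<Suc m. (tent ^^ Suc i) y / 4 ^ Suc i)
      = tent y / 4 + (\<Sum>i<m. (tent ^^ Suc i) (tent y) / 4 ^ Suc i) / 4"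
    unfolding sum.lessThan_Suc_shift by (simp add: funpow_swap1 sum_divide_distrib)
  moreover have "y - y\<^sup>2 = tent y / 4 + (tent y - (tent y)\<^sup>2) / 4"
  proof (cases "y \<le> 1 / 2")
    case True
    then have t: "tent y = 2 * y" by (simp add: tent_def)
    show ?thesis unfolding t by (simp add: power2_eq_square field_simps)
  next
    case False
    then have t: "tent y = 2 - 2 * y" by (simp add: tent_def)
    show ?thesis unfolding t by (simp add: power2_eq_square field_simps)
  qed
  ultimately have "y - y\<^sup>2 - (\<Sum>i<Suc m. (tent ^^ Suc i) y / 4 ^ Suc i) = r (tent y) / 4"
    unfolding r_def by (rule gen)
  moreover have "0 \<le> r (tent y) \<and> r (tent y) \<le> (1 / 4) ^ m"
    unfolding r_def using Suc.prems tent_bounds by (intro Suc.IH) auto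
  ultimately show ?case by simp
qed

text \<open>The series has nonnegative terms, so the square is approached from above and the
  approximation never exceeds |x|. Staying in [0, 1] is what keeps iterated products in
  range.\<close>

lemma sq_approx_bounds:
  assumes "\<bar>x\<bar> \<le> 1"
  shows "x\<^sup>2 \<le> sq_approx m x" "sq_approx m x \<le> x\<^sup>2 + (1 / 4) ^ m" "sq_approx m x \<le> 1"
proof -
  show "x\<^sup>2 \<le> sq_approx m x" "sq_approx m x \<le> x\<^sup>2 + (1 / 4) ^ m"
    using tent_series[of "\<bar>x\<bar>" m] assms by (auto simp: sq_approx_def)
  have "0 \<le> (\<Sum>i<m. (tent ^^ Suc i) \<bar>x\<bar> / 4 ^ Suc i)"
    using funpow_tent_bounds[of "\<bar>x\<bar>"] assms
    by (intro sum_nonneg divide_nonneg_nonneg) (auto simp del: funpow.simps)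
  then show "sq_approx m x \<le> 1" using assms by (simp add: sq_approx_def)
qed

text \<open>Polarisation; the halves keep both arguments of the square in [-1, 1] if the factors
  are.\<close>

definition mul_approx :: "nat \<Rightarrow> real \<Rightarrow> real \<Rightarrow> real" where
  "mul_approx m x y = sq_approx m ((x + y) / 2) - sq_approx m ((x - y) / 2)"

text \<open>Both squares are overestimated by at most \<open>(1 / 4) ^ m\<close>, so the difference
  of the two errors obeys the same bound. As both approximations lie in [0, 1], the result is again
  an admissible factor.\<close>

lemma mul_approx_bounds:
  assumes "\<bar>x\<bar> \<le> 1" "\<bar>y\<bar> \<le> 1"
  shows "\<bar>mul_approx m x y - x * y\<bar> \<le> (1 / 4) ^ m" "\<bar>mul_approx m x y\<bar> \<le> 1"
proof -
  have 1: "\<bar>(x + y) / 2\<bar> \<le> 1" "\<bar>(x - y) / 2\<bar> \<le> 1" using assms by auto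
  have "x * y = ((x + y) / 2)\<^sup>2 - ((x - y) / 2)\<^sup>2" by (simp add: power2_eq_square field_simps)
  then show "\<bar>mul_approx m x y - x * y\<bar> \<le> (1 / 4) ^ m"
    using sq_approx_bounds(1,2)[OF 1(1), of m] sq_approx_bounds(1,2)[OF 1(2), of m]
    unfolding mul_approx_def by linarith
  show "\<bar>mul_approx m x y\<bar> \<le> 1"
    using sq_approx_bounds[OF 1(1), of m] sq_approx_bounds[OF 1(2), of m]
      zero_le_power2[of "(x + y) / 2"] zero_le_power2[of "(x - y) / 2"]
    unfolding mul_approx_def by linarith
qed

primrec prod_approx :: "nat \<Rightarrow> real list \<Rightarrow> real" where
  "prod_approx m [] = 1"
| "prod_approx m (x # xs) = mul_approx m x (prod_approx m xs)"

text \<open>Since every partial product stays in [-1, 1], an error made in the tail is not amplified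
  by the next factor: the errors add up, one per factor.\<close>

lemma prod_approx_bounds:
  assumes "\<forall>x\<in>set xs. \<bar>x\<bar> \<le> 1"
  shows "\<bar>prod_approx m xs\<bar> \<le> 1 \<and> \<bar>prod_approx m xs - prod_list xs\<bar> \<le> length xs * (1 / 4) ^ m"
  using assms
proof (induction xs)
  case (Cons x xs)
  let ?P = "prod_approx m xs"
  have x: "\<bar>x\<bar> \<le> 1" and P: "\<bar>?P\<bar> \<le> 1" using Cons by auto
  have e: "\<bar>?P - prod_list xs\<bar> \<le> length xs * (1 / 4) ^ m" using Cons by auto
  have "\<bar>x * (?P - prod_list xs)\<bar> \<le> 1 * (length xs * (1 / 4) ^ m)"
    unfolding abs_mult using x e by (intro mult_mono) auto
  moreover have "mul_approx m x ?P - x * prod_list xs = (mul_approx m x ?P - x * ?P) + x * (?P - prod_list xs)"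
    by (simp add: algebra_simps)
  ultimately show ?case using mul_approx_bounds[OF x P, of m] by (auto simp: distrib_right)
qed simp

text \<open>The current iterate is a combination of a constant and two neurons, hence of cost 3; the
  next one takes the relu pair of 2 * y - 1, of cost 4, which adds 8 weights in one layer. The
  partial sum is not materialised but carried along as an affine combination that grows by 3 per
  step.\<close>

lemma circuit_sq_approx:
  assumes "relu_circuit L W G" "affine_comb G c f"
  shows "\<exists>G'. G \<subseteq> G' \<and> relu_circuit (Suc L + m) (W + 2 * c + 8 * m) G' \<and>
    affine_comb G' 3 (\<lambda>p. (tent ^^ m) \<bar>f p\<bar>) \<and> affine_comb G' (2 + 3 * m) (\<lambda>p. sq_approx m (f p))"
proof (induction m)
  case 0
  obtain G' where G': "G \<subseteq> G'" "relu_circuit (Suc L) (W + 2 * c) G'" "(\<lambda>p. relu (f p)) \<in> G'" "(\<lambda>p. relu (- f p)) \<in> G'"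
    by (rule circuit_relu_pair[OF assms])
  have "affine_comb G' (1 + 1) (\<lambda>p. relu (f p) + relu (- f p))" by (intro affine_comb_plus affine_comb_member G')
  moreover have "relu (f p) + relu (- f p) = \<bar>f p\<bar>" for p by (simp add: relu_def)
  ultimately have "affine_comb G' 2 (\<lambda>p. \<bar>f p\<bar>)" by (simp add: numeral_2_eq_2)
  then show ?case using G' affine_comb_weaken[of G' 2 "\<lambda>p. \<bar>f p\<bar>" 3]
    by (intro exI[of _ G']) (auto simp: sq_approx_def)
next
  case (Suc m)
  then obtain G' where G': "G \<subseteq> G'" "relu_circuit (Suc L + m) (W + 2 * c + 8 * m) G'"
    "affine_comb G' 3 (\<lambda>p. (tent ^^ m) \<bar>f p\<bar>)" "affine_comb G' (2 + 3 * m) (\<lambda>p. sq_approx m (f p))"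
    by blast
  define h where "h p = 2 * (tent ^^ m) \<bar>f p\<bar> - 1" for p
  have "affine_comb G' (3 + 1) h"
    unfolding h_def[abs_def] by (intro affine_comb_diff affine_comb_scale affine_comb_constant G')
  then obtain G'' where G'': "G' \<subseteq> G''" "relu_circuit (Suc (Suc L + m)) (W + 2 * c + 8 * m + 2 * (3 + 1)) G''"
      "(\<lambda>p. relu (h p)) \<in> G''" "(\<lambda>p. relu (- h p)) \<in> G''"
    by (rule circuit_relu_pair[OF G'(2)])
  have "affine_comb G'' (1 + (1 + 1)) (\<lambda>p. 1 - (relu (h p) + relu (- h p)))"
    by (intro affine_comb_diff affine_comb_plus affine_comb_constant affine_comb_member G'')
  moreover have "1 - (relu (h p) + relu (- h p)) = (tent ^^ Suc m) \<bar>f p\<bar>" for p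
    by (simp add: relu_def tent_def h_def)
  ultimately have t: "affine_comb G'' 3 (\<lambda>p. (tent ^^ Suc m) \<bar>f p\<bar>)" by (simp add: numeral_3_eq_3)
  have "affine_comb G'' (2 + 3 * m + 3) (\<lambda>p. sq_approx m (f p) - (1 / 4 ^ Suc m) * (tent ^^ Suc m) \<bar>f p\<bar>)"
    by (intro affine_comb_diff affine_comb_scale t affine_comb_mono[OF G'(4) G''(1)])
  then have "affine_comb G'' (2 + 3 * Suc m) (\<lambda>p. sq_approx (Suc m) (f p))"
    by (simp add: sq_approx_def add.commute diff_diff_eq)
  then show ?case using t G' G'' by (intro exI[of _ G'']) (auto simp: algebra_simps)
qed

text \<open>The two squares are built one after the other on a growing circuit, in
  \<open>m + 1\<close> layers each, and one more layer materialises their difference. The weights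
  are \<open>8 + 8 * m\<close> per square and \<open>2 * (4 + 6 * m)\<close> for the
  difference.\<close>

lemma computes_mul_approx:
  assumes "computes L W f" "computes L W' g"
  shows "computes (L + (2 * m + 3)) (W + W' + (28 * m + 24)) (\<lambda>p. mul_approx m (f p) (g p))"
proof -
  obtain G G' where G: "relu_circuit L W G" "affine_comb G 2 f" "relu_circuit L W' G'" "affine_comb G' 2 g"
    using assms unfolding computes_def by blast
  have 0: "relu_circuit L (W + W') (G \<union> G')" by (rule circuit_Un[OF G(1,3)])
  have fg: "affine_comb (G \<union> G') 2 f" "affine_comb (G \<union> G') 2 g" using G by (auto intro: affine_comb_mono)
  have s: "affine_comb (G \<union> G') (2 + 2) (\<lambda>p. (1 / 2) * (f p + g p))" by (intro affine_comb_plus affine_comb_scale fg)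
  have d: "affine_comb (G \<union> G') (2 + 2) (\<lambda>p. (1 / 2) * (f p - g p))" by (intro affine_comb_diff affine_comb_scale fg)
  obtain G1 where G1: "G \<union> G' \<subseteq> G1" "relu_circuit (Suc L + m) (W + W' + 2 * (2 + 2) + 8 * m) G1"
    "affine_comb G1 (2 + 3 * m) (\<lambda>p. sq_approx m ((1 / 2) * (f p + g p)))"
    using circuit_sq_approx[OF 0 s, of m] by blast
  obtain G2 where G2: "G1 \<subseteq> G2" "relu_circuit (Suc (Suc L + m) + m) (W + W' + 2 * (2 + 2) + 8 * m + 2 * (2 + 2) + 8 * m) G2"
    "affine_comb G2 (2 + 3 * m) (\<lambda>p. sq_approx m ((1 / 2) * (f p - g p)))"
    using circuit_sq_approx[OF G1(2) affine_comb_mono[OF d G1(1)], of m] by blast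
  have "affine_comb G2 (2 + 3 * m + (2 + 3 * m))
      (\<lambda>p. sq_approx m ((1 / 2) * (f p + g p)) - sq_approx m ((1 / 2) * (f p - g p)))"
    by (intro affine_comb_diff G2 affine_comb_mono[OF G1(3) G2(1)])
  from computes_materialise[OF G2(2) this]
  have "computes (Suc (Suc (Suc L + m) + m)) (W + W' + 2 * (2 + 2) + 8 * m + 2 * (2 + 2) + 8 * m +
      2 * (2 + 3 * m + (2 + 3 * m))) (\<lambda>p. mul_approx m (f p) (g p))"
    by (simp add: mul_approx_def)
  then show ?thesis by (rule computes_mono) auto
qed

text \<open>The factors are multiplied in sequence; the next factor waits at no cost until the
  product of the others is ready.\<close>

lemma computes_prod_approx:
  assumes "\<forall>f\<in>set fs. computes L W f"
  shows "computes (L + length fs * (2 * m + 3)) (length fs * (W + 28 * m + 24))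
    (\<lambda>p. prod_approx m (map (\<lambda>f. f p) fs))"
  using assms
proof (induction fs)
  case Nil
  then show ?case by (simp add: computes_const)
next
  case (Cons f fs)
  let ?n = "length fs"
  have "computes (L + ?n * (2 * m + 3)) W f" using Cons.prems by (auto intro: computes_mono)
  moreover have "computes (L + ?n * (2 * m + 3)) (?n * (W + 28 * m + 24)) (\<lambda>p. prod_approx m (map (\<lambda>f. f p) fs))"
    using Cons by simp
  ultimately have "computes (L + ?n * (2 * m + 3) + (2 * m + 3)) (W + ?n * (W + 28 * m + 24) + (28 * m + 24))
      (\<lambda>p. mul_approx m (f p) (prod_approx m (map (\<lambda>f. f p) fs)))"
    by (rule computes_mul_approx)
  then show ?case by (simp add: algebra_simps)
qed

section \<open>Gluing local polynomials by a partition of unity\<close>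

definition hat :: "real \<Rightarrow> real" where
  "hat t = max 0 (1 - \<bar>t\<bar>)"

lemma hat_bounds: "0 \<le> hat t" "hat t \<le> 1"
  by (auto simp: hat_def)

lemma hat_nonzero: "hat t \<noteq> 0 \<Longrightarrow> \<bar>t\<bar> < 1"
  by (simp add: hat_def split: if_splits) 

lemma computes_hat:
  assumes "b \<in> Basis"
  shows "computes 2 10 (\<lambda>x. hat (a * (x \<bullet> b) + c))"
proof -
  obtain G where G: "relu_circuit 0 0 G" "affine_comb G 2 (\<lambda>x. a * (x \<bullet> b) + c)"
    using computes_affine_coord[OF assms, of a c] unfolding computes_def by blast
  define t where "t x = a * (x \<bullet> b) + c" for x
  obtain G' where G': "relu_circuit (Suc 0) (0 + 2 * 2) G'" "(\<lambda>x. relu (t x)) \<in> G'" "(\<lambda>x. relu (- t x)) \<in> G'"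
    using circuit_relu_pair[OF G] unfolding t_def by metis
  have "affine_comb G' (1 + (1 + 1)) (\<lambda>x. 1 - (relu (t x) + relu (- t x)))"
    by (intro affine_comb_diff affine_comb_plus affine_comb_constant affine_comb_member G')
  then obtain G'' where G'': "relu_circuit (Suc (Suc 0)) (0 + 2 * 2 + 2 * (1 + (1 + 1))) G''"
      "(\<lambda>x. relu (1 - (relu (t x) + relu (- t x)))) \<in> G''"
    by (rule circuit_relu_pair[OF G'(1)])
  have "relu (1 - (relu (t x) + relu (- t x))) = hat (t x)" for x
    by (simp add: relu_def hat_def)
  then have "affine_comb G'' 2 (\<lambda>x. hat (t x))"
    using affine_comb_weaken[OF affine_comb_member[OF G''(2)], of 2] by simp
  moreover have "relu_circuit 2 10 G''" unfolding numeral_2_eq_2 by (rule circuit_mono[OF G''(1)]) auto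
  ultimately show ?thesis unfolding computes_def t_def by blast
qed

lemma sum_hat_shifts:
  fixes I :: int
  assumes "\<bar>s\<bar> + 1 \<le> of_int I"
  shows "(\<Sum>i\<in>{-I..I}. hat (s - of_int i)) = 1"
proof -
  \<comment> \<open>Only the shifts by j and j + 1 can be nonzero at s, with values adding up to 1;
    the hypothesis on I leaves room for both.\<close>
  define j where "j = \<lfloor>s\<rfloor>"
  have j: "of_int j \<le> s" "s < of_int j + 1" unfolding j_def by linarith+
  have "-I \<le> j" "j + 1 \<le> I" using assms j by linarith+
  then have sub: "{j, j + 1} \<subseteq> {-I..I}" by auto
  have "hat (s - of_int i) = 0" if "i \<notin> {j, j + 1}" for i
  proof -
    have "i \<le> j - 1 \<or> j + 2 \<le> i" using that by auto
    then have "real_of_int i \<le> real_of_int j - 1 \<or> real_of_int j + 2 \<le> real_of_int i" by linarith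
    then have "1 \<le> \<bar>s - of_int i\<bar>" using j by linarith
    then show ?thesis by (simp add: hat_def)
  qed
  then have "(\<Sum>i\<in>{-I..I}. hat (s - of_int i)) = (\<Sum>i\<in>{j, j + 1}. hat (s - of_int i))"
    using sub by (intro sum.mono_neutral_right) auto
  also have "\<dots> = 1" using j by (simp add: hat_def)
  finally show ?thesis .
qed

text \<open>A tensor product of hats centred at the grid point with coordinates
  \<open>\<gamma> b / N\<close>.\<close>

definition bump :: "real \<Rightarrow> ('a::euclidean_space \<Rightarrow> int) \<Rightarrow> 'a \<Rightarrow> real" where
  "bump N \<gamma> q = (\<Prod>b\<in>Basis. hat (N * (q \<bullet> b) - of_int (\<gamma> b)))"

lemma bump_bounds: "0 \<le> bump N \<gamma> q" "bump N \<gamma> q \<le> 1"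
  unfolding bump_def by (auto intro!: prod_nonneg prod_le_1 simp: hat_bounds)

lemma sum_bump:
  fixes q :: "'a::euclidean_space" and I :: int
  assumes "\<And>b. b \<in> Basis \<Longrightarrow> \<bar>N * (q \<bullet> b)\<bar> + 1 \<le> of_int I"
  shows "(\<Sum>\<gamma>\<in>Basis \<rightarrow>\<^sub>E {-I..I}. bump N \<gamma> q) = 1"
proof -
  have "(\<Sum>\<gamma>\<in>Basis \<rightarrow>\<^sub>E {-I..I}. bump N \<gamma> q) = (\<Prod>b\<in>Basis. \<Sum>i\<in>{-I..I}. hat (N * (q \<bullet> b) - of_int i))"
    unfolding bump_def by (rule prod_sum_PiE[symmetric]) auto
  also have "\<dots> = 1" using sum_hat_shifts[OF assms] by (intro prod.neutral) auto
  finally show ?thesis .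
qed

lemma bump_support_diam:
  fixes p q :: "'a::euclidean_space"
  assumes "0 < N" "bump N \<gamma> p \<noteq> 0" "bump N \<gamma> q \<noteq> 0"
  shows "norm (q - p) \<le> 2 * real DIM('a) / N"
proof -
  have "\<bar>(q - p) \<bullet> b\<bar> \<le> 2 / N" if b: "b \<in> Basis" for b
  proof -
    have "\<bar>N * (p \<bullet> b) - of_int (\<gamma> b)\<bar> < 1" "\<bar>N * (q \<bullet> b) - of_int (\<gamma> b)\<bar> < 1"
      using assms(2,3) b unfolding bump_def by (auto simp: prod_zero_iff intro!: hat_nonzero)
    then have "\<bar>N * (q \<bullet> b) - N * (p \<bullet> b)\<bar> \<le> 2" by linarith
    then have "N * \<bar>(q - p) \<bullet> b\<bar> \<le> 2"
      using assms(1) by (simp add: inner_diff_left right_diff_distrib[symmetric] abs_mult)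
    then show ?thesis using assms(1) by (simp add: field_simps)
  qed
  then have "(\<Sum>b\<in>Basis. \<bar>(q - p) \<bullet> b\<bar>) \<le> (\<Sum>b\<in>(Basis::'a set). 2 / N)" by (intro sum_mono)
  then show ?thesis using norm_le_l1[of "q - p"] by (simp add: mult.commute)
qed

text \<open>All that the approximation sees of smoothness: expansions at every point of S, valid up
  to distance \<rho>, with bounds uniform in the point. The coefficients are arbitrary numbers
  rather than derivatives, so that jets can supply them for the Euler map.\<close>

definition locally_poly :: "nat \<Rightarrow> real \<Rightarrow> real \<Rightarrow> real \<Rightarrow> 'a::euclidean_space set \<Rightarrow> ('a \<Rightarrow> real) \<Rightarrow> bool" where
  "locally_poly k A B \<rho> S f \<longleftrightarrow> (\<forall>p\<in>S. \<exists>a. (\<forall>w\<in>words k. \<bar>a w\<bar> \<le> A) \<and>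
     (\<forall>q\<in>S. norm (q - p) \<le> \<rho> \<longrightarrow>
       \<bar>f q - (\<Sum>w\<in>words k. a w * wpow (q - p) w)\<bar> \<le> B * norm (q - p) ^ k))"

text \<open>A bump that does not vanish on S uses the expansion at some point of S where it is
  nonzero, not at the grid point, which may lie outside S. At each q the error is a weighted mean of
  local errors, because the bumps sum to 1 and those active at q have their centre close to
  q.\<close>

lemma bump_poly_approx:
  fixes S :: "'a::euclidean_space set" and I :: int
  assumes f: "locally_poly k A B \<rho> S f" and N: "0 < N" "2 * real DIM('a) / N \<le> \<rho>"
    and I: "\<And>q b. q \<in> S \<Longrightarrow> b \<in> Basis \<Longrightarrow> \<bar>N * (q \<bullet> b)\<bar> + 1 \<le> of_int I"
    and A: "0 \<le> A" and B: "0 \<le> B"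
  obtains \<alpha> P where
    "\<And>\<gamma> w. w \<in> words k \<Longrightarrow> \<bar>\<alpha> \<gamma> w\<bar> \<le> A" "\<And>\<gamma> w. \<alpha> \<gamma> w \<noteq> 0 \<Longrightarrow> P \<gamma> \<in> S"
    "\<And>q. q \<in> S \<Longrightarrow> \<bar>f q - (\<Sum>\<gamma>\<in>Basis \<rightarrow>\<^sub>E {-I..I}. bump N \<gamma> q * (\<Sum>w\<in>words k. \<alpha> \<gamma> w * wpow (q - P \<gamma>) w))\<bar>
       \<le> B * (2 * real DIM('a) / N) ^ k"
proof -
  obtain a where a: "\<And>p w. p \<in> S \<Longrightarrow> w \<in> words k \<Longrightarrow> \<bar>a p w\<bar> \<le> A"
    "\<And>p q. p \<in> S \<Longrightarrow> q \<in> S \<Longrightarrow> norm (q - p) \<le> \<rho> \<Longrightarrow>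
       \<bar>f q - (\<Sum>w\<in>words k. a p w * wpow (q - p) w)\<bar> \<le> B * norm (q - p) ^ k"
    using f unfolding locally_poly_def by metis
  define ok where "ok \<gamma> p \<longleftrightarrow> p \<in> S \<and> bump N \<gamma> p \<noteq> 0" for \<gamma> p
  define P where "P \<gamma> = (SOME p. ok \<gamma> p)" for \<gamma>
  \<comment> \<open>Bumps that vanish on S get zero coefficients; for them the choice of
    \<open>P \<gamma>\<close> is arbitrary.\<close>
  define \<alpha> where "\<alpha> \<gamma> w = (if \<exists>p. ok \<gamma> p then a (P \<gamma>) w else 0)" for \<gamma> w
  have P: "ok \<gamma> (P \<gamma>)" if "ok \<gamma> p" for \<gamma> p
    unfolding P_def using that by (rule someI)
  show ?thesis
  proof (rule that[of \<alpha> P])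
    show "\<bar>\<alpha> \<gamma> w\<bar> \<le> A" if "w \<in> words k" for \<gamma> w
      using a(1)[OF _ that] P A unfolding \<alpha>_def ok_def by auto
    show "P \<gamma> \<in> S" if "\<alpha> \<gamma> w \<noteq> 0" for \<gamma> w
      using that P unfolding \<alpha>_def ok_def by (auto split: if_splits)
    fix q assume q: "q \<in> S"
    let ?\<Gamma> = "Basis \<rightarrow>\<^sub>E {-I..I} :: ('a \<Rightarrow> int) set"
    let ?p = "\<lambda>\<gamma>. \<Sum>w\<in>words k. \<alpha> \<gamma> w * wpow (q - P \<gamma>) w"
    let ?e = "B * (2 * real DIM('a) / N) ^ k"
    have one: "(\<Sum>\<gamma>\<in>?\<Gamma>. bump N \<gamma> q) = 1" by (rule sum_bump[OF I[OF q]])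
    have "\<bar>bump N \<gamma> q * (f q - ?p \<gamma>)\<bar> \<le> bump N \<gamma> q * ?e" for \<gamma>
    proof (cases "bump N \<gamma> q = 0")
      case False
      then have "ok \<gamma> q" using q by (simp add: ok_def)
      note Pq = P[OF this]
      have n: "norm (q - P \<gamma>) \<le> 2 * real DIM('a) / N"
        using Pq False by (intro bump_support_diam[OF N(1)]) (auto simp: ok_def)
      have \<alpha>: "\<alpha> \<gamma> w = a (P \<gamma>) w" for w using \<open>ok \<gamma> q\<close> by (auto simp: \<alpha>_def)
      have "\<bar>f q - ?p \<gamma>\<bar> \<le> B * norm (q - P \<gamma>) ^ k"
        using a(2)[of "P \<gamma>" q] Pq q n N(2) unfolding \<alpha> ok_def by simp
      also have "\<dots> \<le> ?e" using n B by (intro mult_left_mono power_mono) auto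
      finally show ?thesis unfolding abs_mult using bump_bounds(1)[of N \<gamma> q] by (simp add: mult_left_mono)
    qed simp
    then have "\<bar>\<Sum>\<gamma>\<in>?\<Gamma>. bump N \<gamma> q * (f q - ?p \<gamma>)\<bar> \<le> (\<Sum>\<gamma>\<in>?\<Gamma>. bump N \<gamma> q * ?e)"
      by (intro order_trans[OF sum_abs] sum_mono)
    also have "\<dots> = ?e" using one by (simp add: sum_distrib_right[symmetric])
    finally have "\<bar>\<Sum>\<gamma>\<in>?\<Gamma>. bump N \<gamma> q * (f q - ?p \<gamma>)\<bar> \<le> ?e" .
    moreover have "(\<Sum>\<gamma>\<in>?\<Gamma>. bump N \<gamma> q * (f q - ?p \<gamma>)) = f q - (\<Sum>\<gamma>\<in>?\<Gamma>. bump N \<gamma> q * ?p \<gamma>)"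
      using one by (simp add: right_diff_distrib sum_subtractf sum_distrib_right[symmetric])
    ultimately show "\<bar>f q - (\<Sum>\<gamma>\<in>?\<Gamma>. bump N \<gamma> q * ?p \<gamma>)\<bar> \<le> ?e" by simp
  qed
qed

text \<open>Dividing each letter of the monomial by \<open>2 * R\<close> puts all factors into
  [-1, 1] for points of the ball of radius R; the coefficient of the term makes up for it.\<close>

definition term_factors :: "real \<Rightarrow> real \<Rightarrow> ('a::euclidean_space \<Rightarrow> int) \<Rightarrow> 'a \<Rightarrow> 'a list \<Rightarrow> ('a \<Rightarrow> real) list" where
  "term_factors N R \<gamma> p w = map (\<lambda>b q. hat (N * (q \<bullet> b) - of_int (\<gamma> b))) basis_list @
     map (\<lambda>b q. (q - p) \<bullet> b / (2 * R)) w"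

lemma length_term_factors: "length (term_factors N R \<gamma> (p :: 'a::euclidean_space) w) = DIM('a) + length w"
  by (simp add: term_factors_def)

lemma computes_term_factors:
  assumes "set w \<subseteq> Basis" "f \<in> set (term_factors N R \<gamma> p w)"
  shows "computes 2 10 f"
proof -
  consider b where "b \<in> Basis" "f = (\<lambda>q. hat (N * (q \<bullet> b) - of_int (\<gamma> b)))"
    | b where "b \<in> Basis" "f = (\<lambda>q. (q - p) \<bullet> b / (2 * R))"
    using assms basis_list(2)[where 'a='a] unfolding term_factors_def by auto
  then show ?thesis
  proof cases
    case 1
    then show ?thesis using computes_hat[of b N "- of_int (\<gamma> b)"] by simp
  next
    case 2
    have "computes 0 0 (\<lambda>q. (1 / (2 * R)) * (q \<bullet> b) + - (p \<bullet> b) / (2 * R))"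
      by (rule computes_affine_coord[OF 2(1)])
    then have "computes 0 0 f" unfolding 2(2) by (simp add: inner_diff_left diff_divide_distrib)
    then show ?thesis by (rule computes_mono) auto
  qed
qed

lemma prod_list_term_factors:
  assumes "R \<noteq> 0"
  shows "prod_list (map (\<lambda>f. f q) (term_factors N R \<gamma> p w)) = bump N \<gamma> q * wpow (q - p) w / (2 * R) ^ length w"
proof -
  have "prod_list (map (\<lambda>b. hat (N * (q \<bullet> b) - of_int (\<gamma> b))) basis_list) = bump N \<gamma> q"
    unfolding bump_def basis_list(2)[symmetric]
    by (rule prod.distinct_set_conv_list[OF basis_list(1), symmetric])
  moreover have "prod_list (map (\<lambda>b. (q - p) \<bullet> b / (2 * R)) w) = wpow (q - p) w / (2 * R) ^ length w"
    by (induction w) (use assms in \<open>auto simp: field_simps\<close>)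
  ultimately show ?thesis by (simp add: term_factors_def o_def)
qed

lemma term_factors_bounded:
  assumes "norm q \<le> R" "norm p \<le> R" "0 < R" "set w \<subseteq> Basis"
  shows "\<forall>x\<in>set (map (\<lambda>f. f q) (term_factors N R \<gamma> p w)). \<bar>x\<bar> \<le> 1"
proof -
  have "\<bar>(q - p) \<bullet> b / (2 * R)\<bar> \<le> 1" if "b \<in> Basis" for b
  proof -
    have "\<bar>(q - p) \<bullet> b\<bar> \<le> norm (q - p)" by (rule Basis_le_norm[OF that])
    also have "\<dots> \<le> 2 * R" using assms norm_triangle_ineq4[of q p] by simp
    finally show ?thesis using assms by simp
  qed
  then show ?thesis using assms(4) hat_bounds unfolding term_factors_def by auto
qed

text \<open>There are J terms, one for each grid index and word, and each is a product of at most n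
  factors. The summand 3 in the depth is two layers for the hats and one for the final sum. Of the
  two errors, the first comes from gluing and the second from approximate multiplication, which m
  controls.\<close>

lemma bump_poly_circuit:
  fixes S :: "'a::euclidean_space set" and I :: int
  assumes f: "locally_poly k A B \<rho> S f" and S: "S \<subseteq> cball 0 R" and N: "0 < N" "2 * real DIM('a) / N \<le> \<rho>"
    and I: "N * R + 1 \<le> of_int I" and A: "0 \<le> A" and B: "0 \<le> B" and R: "1 \<le> R"
  defines "n \<equiv> DIM('a) + k" and "J \<equiv> nat (2 * I + 1) ^ DIM('a) * card (words k :: 'a list set)"
  obtains g where "computes (3 + n * (2 * m + 3)) (J * (n * (28 * m + 34) + 4)) g"
    "\<And>q. q \<in> S \<Longrightarrow> \<bar>g q - f q\<bar> \<le> B * (2 * real DIM('a) / N) ^ k + J * (A * (2 * R) ^ k * n * (1 / 4) ^ m)"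
proof -
  let ?\<Gamma> = "Basis \<rightarrow>\<^sub>E {-I..I} :: ('a \<Rightarrow> int) set"
  have Ib: "\<bar>N * (q \<bullet> b)\<bar> + 1 \<le> of_int I" if "q \<in> S" "b \<in> Basis" for q b
  proof -
    have "\<bar>q \<bullet> b\<bar> \<le> R" using Basis_le_norm[OF that(2), of q] S that(1) by auto
    then have "N * \<bar>q \<bullet> b\<bar> \<le> N * R" using N by (intro mult_left_mono) auto
    moreover have "\<bar>N * (q \<bullet> b)\<bar> = N * \<bar>q \<bullet> b\<bar>" using N by (simp add: abs_mult)
    ultimately show ?thesis using I by linarith
  qed
  obtain \<alpha> P where \<alpha>: "\<And>\<gamma> w. w \<in> words k \<Longrightarrow> \<bar>\<alpha> \<gamma> w\<bar> \<le> A" "\<And>\<gamma> w. \<alpha> \<gamma> w \<noteq> 0 \<Longrightarrow> P \<gamma> \<in> S"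
    "\<And>q. q \<in> S \<Longrightarrow> \<bar>f q - (\<Sum>\<gamma>\<in>?\<Gamma>. bump N \<gamma> q * (\<Sum>w\<in>words k. \<alpha> \<gamma> w * wpow (q - P \<gamma>) w))\<bar>
       \<le> B * (2 * real DIM('a) / N) ^ k"
    using bump_poly_approx[OF f N Ib A B] by blast
  define X where "X = ?\<Gamma> \<times> (words k :: 'a list set)"
  have finX: "finite X" unfolding X_def by (intro finite_cartesian_product finite_PiE) auto
  have cardX: "card X = J"
    unfolding X_def J_def by (simp add: card_cartesian_product card_PiE prod_constant)
  define c where "c x = \<alpha> (fst x) (snd x) * (2 * R) ^ length (snd x)" for x
  define fs where "fs x = term_factors N R (fst x) (P (fst x)) (snd x)" for x
  define T where "T x q = prod_approx m (map (\<lambda>f. f q) (fs x))" for x q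
  define g where "g q = (\<Sum>x\<in>X. c x * T x q)" for q
  have T_computed: "computes (2 + n * (2 * m + 3)) (n * (28 * m + 34)) (T x)" if "x \<in> X" for x
  proof -
    have w: "set (snd x) \<subseteq> Basis" "length (snd x) < k" using that by (auto simp: X_def words_def)
    have len: "length (fs x) \<le> n" using w unfolding fs_def length_term_factors n_def by simp
    have "computes (2 + length (fs x) * (2 * m + 3)) (length (fs x) * (10 + 28 * m + 24)) (T x)"
      unfolding T_def by (rule computes_prod_approx) (use computes_term_factors[OF w(1)] in \<open>auto simp: fs_def\<close>)
    then show ?thesis
    proof (rule computes_mono)
      show "2 + length (fs x) * (2 * m + 3) \<le> 2 + n * (2 * m + 3)" using len by (intro add_left_mono mult_right_mono) auto
      have "length (fs x) * (10 + 28 * m + 24) \<le> n * (10 + 28 * m + 24)" using len by (intro mult_right_mono) auto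
      moreover have "10 + 28 * m + 24 = 28 * m + 34" by simp
      ultimately show "length (fs x) * (10 + 28 * m + 24) \<le> n * (28 * m + 34)" by (simp only:)
    qed
  qed
  have "computes (Suc (2 + n * (2 * m + 3))) ((\<Sum>x\<in>X. n * (28 * m + 34)) + 4 * card X) g"
    unfolding g_def[abs_def] by (rule computes_linear_comb[OF finX T_computed])
  then have "computes (3 + n * (2 * m + 3)) (J * (n * (28 * m + 34) + 4)) g"
  proof -
    have "Suc (2 + n * (2 * m + 3)) = 3 + n * (2 * m + 3)" by simp
    moreover have "(\<Sum>x\<in>X. n * (28 * m + 34)) + 4 * card X = J * (n * (28 * m + 34) + 4)"
      by (simp add: cardX distrib_left)
    ultimately show "computes (Suc (2 + n * (2 * m + 3))) ((\<Sum>x\<in>X. n * (28 * m + 34)) + 4 * card X) g \<Longrightarrow> ?thesis"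
      by (simp only:)
  qed
  moreover have "\<bar>g q - f q\<bar> \<le> B * (2 * real DIM('a) / N) ^ k + J * (A * (2 * R) ^ k * n * (1 / 4) ^ m)"
    if q: "q \<in> S" for q
  proof -
    define e where "e x = bump N (fst x) q * (\<alpha> (fst x) (snd x) * wpow (q - P (fst x)) (snd x))" for x
    have "(\<Sum>\<gamma>\<in>?\<Gamma>. bump N \<gamma> q * (\<Sum>w\<in>words k. \<alpha> \<gamma> w * wpow (q - P \<gamma>) w)) = (\<Sum>x\<in>X. e x)"
      unfolding X_def e_def by (simp add: sum_distrib_left sum.cartesian_product case_prod_unfold)
    then have 1: "\<bar>f q - (\<Sum>x\<in>X. e x)\<bar> \<le> B * (2 * real DIM('a) / N) ^ k" using \<alpha>(3)[OF q] by simp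
    have "\<bar>c x * T x q - e x\<bar> \<le> A * (2 * R) ^ k * n * (1 / 4) ^ m" if x: "x \<in> X" for x
    proof (cases "\<alpha> (fst x) (snd x) = 0")
      case True
      then show ?thesis using A R by (simp add: c_def e_def)
    next
      case False
      have w: "snd x \<in> words k" "set (snd x) \<subseteq> Basis" "length (snd x) < k" using x by (auto simp: X_def words_def)
      have p: "norm (P (fst x)) \<le> R" "norm q \<le> R" using \<alpha>(2)[OF False] S q by auto
      have len: "length (fs x) \<le> n" using w unfolding fs_def length_term_factors n_def by simp
      let ?\<pi> = "prod_list (map (\<lambda>f. f q) (fs x))"
      have \<pi>: "?\<pi> = bump N (fst x) q * wpow (q - P (fst x)) (snd x) / (2 * R) ^ length (snd x)"
        unfolding fs_def by (rule prod_list_term_factors) (use R in simp)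
      have "\<bar>T x q - ?\<pi>\<bar> \<le> length (map (\<lambda>f. f q) (fs x)) * (1 / 4) ^ m"
        unfolding T_def using term_factors_bounded[OF p(2,1) _ w(2)] R
        by (intro conjunct2[OF prod_approx_bounds]) (simp add: fs_def)
      also have "\<dots> \<le> n * (1 / 4) ^ m" using len by (intro mult_right_mono) auto
      finally have T: "\<bar>T x q - ?\<pi>\<bar> \<le> n * (1 / 4) ^ m" .
      have "(2 * R) ^ length (snd x) \<le> (2 * R) ^ k" using R w by (intro power_increasing) auto
      then have c: "\<bar>c x\<bar> \<le> A * (2 * R) ^ k"
        unfolding c_def abs_mult using \<alpha>(1)[OF w(1)] A R by (intro mult_mono) auto
      have "c x * T x q - e x = c x * (T x q - ?\<pi>)"
        using R unfolding \<pi> by (simp add: c_def e_def right_diff_distrib)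
      then have "\<bar>c x * T x q - e x\<bar> \<le> (A * (2 * R) ^ k) * (n * (1 / 4) ^ m)"
        using c T A R unfolding abs_mult by (simp add: abs_mult mult_mono)
      then show ?thesis by (simp add: mult.assoc)
    qed
    then have 2: "(\<Sum>x\<in>X. \<bar>c x * T x q - e x\<bar>) \<le> (\<Sum>x\<in>X. A * (2 * R) ^ k * n * (1 / 4) ^ m)" by (intro sum_mono)
    have "\<bar>g q - (\<Sum>x\<in>X. e x)\<bar> = \<bar>\<Sum>x\<in>X. c x * T x q - e x\<bar>" by (simp add: g_def sum_subtractf)
    also have "\<dots> \<le> (\<Sum>x\<in>X. A * (2 * R) ^ k * n * (1 / 4) ^ m)" by (rule order_trans[OF sum_abs 2])
    also have "\<dots> = J * (A * (2 * R) ^ k * n * (1 / 4) ^ m)" by (simp add: cardX)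
    finally have "\<bar>g q - (\<Sum>x\<in>X. e x)\<bar> \<le> J * (A * (2 * R) ^ k * n * (1 / 4) ^ m)" .
    then show ?thesis using 1 by linarith
  qed
  ultimately show ?thesis by (rule that)
qed

text \<open>The grid width is proportional to \<open>\<epsilon> powr (1 / k)\<close>, so the number
  of terms is of order \<open>\<epsilon> powr (- d / k)\<close>. As the multiplication errors of all
  terms add up, m has to be about (1 + d / k) * ln (1 / \<epsilon>), which is still logarithmic. The
  constant precedes S and f because it may see them only through k, A, B, \<rho> and R.\<close>

lemma locally_poly_circuit:
  fixes k :: nat and A B \<rho> R :: real
  assumes k: "1 \<le> k" and A: "0 \<le> A" and B: "0 \<le> B" and \<rho>: "0 < \<rho>" and R: "1 \<le> R"
  shows "\<exists>c>0. \<forall>(S :: 'a::euclidean_space set) f (\<epsilon> :: real). S \<subseteq> cball 0 R \<longrightarrow> locally_poly k A B \<rho> S f \<longrightarrow>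
    0 < \<epsilon> \<longrightarrow> \<epsilon> < 1 \<longrightarrow> (\<exists>L W g. computes L W g \<and> real L \<le> c * (ln (1 / \<epsilon>) + 1) \<and>
      real W \<le> c * \<epsilon> powr (- real DIM('a) / real k) * (ln (1 / \<epsilon>) + 1) \<and> (\<forall>q\<in>S. \<bar>g q - f q\<bar> \<le> \<epsilon>))"
proof -
  define d where "d = real DIM('a)"
  define n where "n = DIM('a) + k"
  \<comment> \<open>The summands ensure in turn \<open>1 \<le> N\<close>, a bump diameter of at most
    \<rho>, and a gluing error of at most \<epsilon> / 2.\<close>
  define c1 where "c1 = 1 + 2 * d / \<rho> + 2 * d * (2 * B + 1)"
  define C2 where "C2 = ((2 * R + 5) * c1) ^ DIM('a) * card (words k :: 'a list set)"
  define Q where "Q = A * (2 * R) ^ k * n"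
  \<comment> \<open>With this denominator \<open>C2 * Q / Q'\<close> is at most 1 / 2, and
    \<open>1 \<le> Q'\<close> makes its logarithm nonnegative.\<close>
  define Q' where "Q' = 2 * C2 * Q + 1"
  define c3 where "c3 = ln Q' + d + 2"
  define c where "c = (3 + n * (2 * c3 + 3)) + C2 * (n * (28 * c3 + 34) + 4)"
  have d: "1 \<le> d" unfolding d_def using DIM_positive[where 'a='a] by linarith
  have "0 \<le> 2 * d / \<rho>" "0 \<le> 2 * d * (2 * B + 1)" using d \<rho> B by auto
  then have c1: "1 \<le> c1" "2 * d / \<rho> \<le> c1" "2 * d * (2 * B + 1) \<le> c1" unfolding c1_def by linarith+
  have C2: "0 \<le> C2" unfolding C2_def using c1 R by simp
  have Q: "0 \<le> Q" unfolding Q_def using A R by simp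
  have Q': "1 \<le> Q'" unfolding Q'_def using C2 Q by simp
  have c3: "0 \<le> c3" unfolding c3_def using Q' d by simp
  have p1: "0 < 3 + n * (2 * c3 + 3)" using c3 by (simp add: add_pos_nonneg)
  have p2: "0 \<le> C2 * (n * (28 * c3 + 34) + 4)" using c3 C2 by simp
  have c: "0 < c" "3 + n * (2 * c3 + 3) \<le> c" "C2 * (n * (28 * c3 + 34) + 4) \<le> c"
    using p1 p2 unfolding c_def by linarith+
  show ?thesis
  proof (intro exI[of _ c] conjI allI impI)
    fix S :: "'a set" and f and \<epsilon> :: real
    assume S: "S \<subseteq> cball 0 R" and f: "locally_poly k A B \<rho> S f" and \<epsilon>: "0 < \<epsilon>" "\<epsilon> < 1"
    define l where "l = ln (1 / \<epsilon>)"
    define E where "E = \<epsilon> powr (- d / k)"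
    define s where "s = \<epsilon> powr (1 / k)"
    define N where "N = c1 / s"
    define I where "I = \<lceil>N * R\<rceil> + 1"
    \<comment> \<open>Chosen so that \<open>exp (- real m)\<close> is at most
      \<open>\<epsilon> powr (1 + d / k) / Q'\<close>: one factor \<epsilon> is the accuracy, the
      rest cancels the number of terms.\<close>
    define m where "m = nat \<lceil>ln Q' + (1 + d / k) * l\<rceil>"
    have l: "0 \<le> l" unfolding l_def using \<epsilon> by simp
    have s: "0 < s" "s \<le> 1" unfolding s_def using \<epsilon> powr_mono2[of "1 / k" \<epsilon> 1] by auto
    have sk: "s ^ k = \<epsilon>" unfolding s_def using \<epsilon> k by (simp add: powr_powr flip: powr_realpow)
    have N1: "1 \<le> N" unfolding N_def using s c1 by (simp add: field_simps)
    have dN: "2 * d / N = 2 * d / c1 * s" unfolding N_def using s by simp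
    have "2 * d \<le> c1 * \<rho>" using c1(2) \<rho> by (simp add: field_simps)
    then have "2 * d / c1 \<le> \<rho>" using c1(1) by (simp add: field_simps)
    then have "2 * d / c1 * s \<le> \<rho> * 1" using s \<rho> by (intro mult_mono) auto
    then have N\<rho>: "2 * d / N \<le> \<rho>" unfolding dN by simp
    have "2 * d / c1 \<le> 1 / (2 * B + 1)" using c1 B by (simp add: field_simps)
    then have "(2 * d / c1) ^ k \<le> (1 / (2 * B + 1)) ^ k" using d c1 by (intro power_mono) auto
    also have "\<dots> \<le> (1 / (2 * B + 1)) ^ 1" using k B by (intro power_decreasing) auto
    finally have "(2 * d / N) ^ k \<le> 1 / (2 * B + 1) * \<epsilon>"
      unfolding dN power_mult_distrib sk using \<epsilon> by (intro mult_right_mono) auto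
    then have "B * (2 * d / N) ^ k \<le> B * (1 / (2 * B + 1) * \<epsilon>)" using B by (intro mult_left_mono)
    also have "\<dots> \<le> \<epsilon> / 2" using B \<epsilon> by (simp add: field_simps)
    finally have err1: "B * (2 * d / N) ^ k \<le> \<epsilon> / 2" .
    have I: "N * R + 1 \<le> of_int I" unfolding I_def by linarith
    have "0 \<le> N * R" using N1 R by simp
    then have "0 \<le> I" unfolding I_def by simp
    then have "real (nat (2 * I + 1)) = 2 * of_int I + 1" by simp
    also have "\<dots> \<le> 2 * (N * R + 2) + 1"
    proof -
      have "real_of_int \<lceil>N * R\<rceil> + 1 \<le> N * R + 1 + 1"
        by (rule add_right_mono[OF of_int_ceiling_le_add_one])
      then have "real_of_int I \<le> N * R + 2" unfolding I_def of_int_add of_int_1 by (simp only: add.assoc one_add_one)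
      then show ?thesis by simp
    qed
    also have "\<dots> \<le> (2 * R + 5) * N" using N1 by (simp add: algebra_simps)
    also have "\<dots> = (2 * R + 5) * c1 * (1 / s)" by (simp add: N_def)
    finally have "real (nat (2 * I + 1)) ^ DIM('a) \<le> ((2 * R + 5) * c1 * (1 / s)) ^ DIM('a)"
      by (intro power_mono) auto
    also have "\<dots> = ((2 * R + 5) * c1) ^ DIM('a) * E"
    proof -
      have "(1 / s) ^ DIM('a) = (\<epsilon> powr (- 1 / k)) ^ DIM('a)"
        unfolding s_def using \<epsilon> by (simp add: powr_minus_divide)
      also have "\<dots> = E" unfolding E_def d_def using \<epsilon> by (simp add: powr_powr flip: powr_realpow)
      finally show ?thesis by (simp only: power_mult_distrib)
    qed
    finally have "real (nat (2 * I + 1)) ^ DIM('a) \<le> ((2 * R + 5) * c1) ^ DIM('a) * E" .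
    then have J': "real (nat (2 * I + 1)) ^ DIM('a) * card (words k :: 'a list set)
        \<le> ((2 * R + 5) * c1) ^ DIM('a) * E * card (words k :: 'a list set)"
      by (rule mult_right_mono) simp
    define J where "J = nat (2 * I + 1) ^ DIM('a) * card (words k :: 'a list set)"
    have J: "real J \<le> C2 * E" using J' unfolding J_def C2_def by (simp add: mult_ac)
    have E: "0 \<le> E" by (simp add: E_def)
    have "ln Q' + (1 + d / k) * l \<le> real m" unfolding m_def by (simp add: real_nat_ceiling_ge)
    then have "exp (- real m) \<le> exp (- (ln Q' + (1 + d / k) * l))" by simp
    also have "\<dots> = \<epsilon> powr (1 + d / k) / Q'"
      unfolding l_def powr_def using Q' \<epsilon> by (simp add: exp_minus exp_add ln_div field_simps exp_diff)
    finally have em: "exp (- real m) \<le> \<epsilon> powr (1 + d / k) / Q'" .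
    have "(1 / 4 :: real) ^ m \<le> exp (- 1) ^ m"
      using exp_le by (intro power_mono) (auto simp: exp_minus field_simps intro: order_trans[of _ 3])
    also have "\<dots> = exp (- real m)" by (simp flip: exp_of_nat_mult)
    finally have qm: "(1 / 4) ^ m \<le> \<epsilon> powr (1 + d / k) / Q'" using em by linarith
    have "J * (Q * (1 / 4) ^ m) \<le> C2 * E * (Q * (\<epsilon> powr (1 + d / k) / Q'))"
      using J qm Q E C2 by (intro mult_mono) auto
    also have "\<dots> = C2 * Q / Q' * (E * \<epsilon> powr (1 + d / k))" by simp
    also have "E * \<epsilon> powr (1 + d / k) = \<epsilon>"
      unfolding E_def powr_add[symmetric] using \<epsilon> by simp
    also have "C2 * Q / Q' * \<epsilon> \<le> 1 / 2 * \<epsilon>"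
      using Q' \<epsilon> unfolding Q'_def by (intro mult_right_mono) (auto simp: field_simps)
    finally have err2: "J * (Q * (1 / 4) ^ m) \<le> \<epsilon> / 2" by simp
    have "0 \<le> ln Q' + (1 + d / k) * l" using Q' l d by simp
    then have "real m = of_int \<lceil>ln Q' + (1 + d / k) * l\<rceil>" unfolding m_def by simp
    also have "\<dots> \<le> ln Q' + (1 + d / k) * l + 1" by (rule of_int_ceiling_le_add_one)
    also have "\<dots> \<le> c3 * (l + 1)"
    proof -
      have "d / k \<le> d / 1" using d k by (intro divide_left_mono) auto
      then have "(1 + d / k) * l \<le> (1 + d) * l" using l by (intro mult_right_mono) auto
      moreover have "0 \<le> ln Q' * l" using Q' l by simp
      ultimately show ?thesis unfolding c3_def using d l by (simp add: algebra_simps)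
    qed
    finally have m: "real m \<le> c3 * (l + 1)" .
    have N0: "0 < N" using N1 by simp
    obtain g where g0: "computes (3 + (DIM('a) + k) * (2 * m + 3))
        (nat (2 * I + 1) ^ DIM('a) * card (words k :: 'a list set) * ((DIM('a) + k) * (28 * m + 34) + 4)) g"
      "\<And>q. q \<in> S \<Longrightarrow> \<bar>g q - f q\<bar> \<le> B * (2 * real DIM('a) / N) ^ k +
        real (nat (2 * I + 1) ^ DIM('a) * card (words k :: 'a list set)) *
          (A * (2 * R) ^ k * real (DIM('a) + k) * (1 / 4) ^ m)"
      by (rule bump_poly_circuit[OF f S N0 N\<rho>[unfolded d_def] I A B R, where m = m]) blast
    note g = g0[folded n_def J_def d_def, folded Q_def]
    have l1: "1 \<le> l + 1" using l by simp
    have "real (3 + n * (2 * m + 3)) \<le> 3 + n * (2 * (c3 * (l + 1)) + 3)"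
      using m by (auto intro!: mult_left_mono)
    also have "\<dots> \<le> 3 * (l + 1) + n * (2 * (c3 * (l + 1)) + 3 * (l + 1))"
      using l1 c3 by (intro add_mono mult_left_mono) auto
    also have "\<dots> = (3 + n * (2 * c3 + 3)) * (l + 1)" by (simp add: algebra_simps)
    also have "\<dots> \<le> c * (l + 1)" using c l1 by (intro mult_right_mono) auto
    finally have L: "real (3 + n * (2 * m + 3)) \<le> c * (l + 1)" .
    have "real (n * (28 * m + 34) + 4) \<le> n * (28 * (c3 * (l + 1)) + 34) + 4"
      using m by (auto intro!: mult_left_mono)
    also have "\<dots> \<le> n * (28 * (c3 * (l + 1)) + 34 * (l + 1)) + 4 * (l + 1)"
      using l1 c3 by (intro add_mono mult_left_mono) auto
    also have "\<dots> = (n * (28 * c3 + 34) + 4) * (l + 1)" by (simp add: algebra_simps)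
    finally have "real (J * (n * (28 * m + 34) + 4)) \<le> C2 * E * ((n * (28 * c3 + 34) + 4) * (l + 1))"
      unfolding of_nat_mult[of J] using J C2 E by (intro mult_mono) auto
    also have "\<dots> = C2 * (n * (28 * c3 + 34) + 4) * (E * (l + 1))" by simp
    also have "\<dots> \<le> c * (E * (l + 1))" using c E l1 by (intro mult_right_mono) auto
    finally have W: "real (J * (n * (28 * m + 34) + 4)) \<le> c * E * (l + 1)" by simp
    show "\<exists>L W g. computes L W g \<and> real L \<le> c * (ln (1 / \<epsilon>) + 1) \<and>
        real W \<le> c * \<epsilon> powr (- real DIM('a) / real k) * (ln (1 / \<epsilon>) + 1) \<and> (\<forall>q\<in>S. \<bar>g q - f q\<bar> \<le> \<epsilon>)"
    proof (intro exI conjI ballI)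
      show "computes (3 + n * (2 * m + 3)) (J * (n * (28 * m + 34) + 4)) g" by (rule g(1))
      show "\<bar>g q - f q\<bar> \<le> \<epsilon>" if "q \<in> S" for q using g(2)[OF that] err1 err2 by linarith
    qed (use L W in \<open>simp_all add: l_def E_def d_def\<close>)
  qed (rule c(1))
qed

section \<open>The Euler scheme for the characteristics\<close>

text \<open>The step size is proportional to the starting time, so that every start reaches time 0
  after exactly N steps. It thereby depends on the starting point, which produces extra terms in the
  jets.\<close>

primrec euler :: "(real \<times> 'x::euclidean_space \<times> 'e::euclidean_space \<Rightarrow> 'x) \<Rightarrow> nat \<Rightarrow> real \<times> 'x \<times> 'e \<Rightarrow> nat \<Rightarrow> 'x" where
  "euler V N p 0 = fst (snd p)"
| "euler V N p (Suc j) = euler V N p j -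
     (fst p / N) *\<^sub>R V (fst p * (1 - j / N), euler V N p j, snd (snd p))"

definition euler_point :: "(real \<times> 'x::euclidean_space \<times> 'e::euclidean_space \<Rightarrow> 'x) \<Rightarrow> nat \<Rightarrow> real \<times> 'x \<times> 'e \<Rightarrow> nat \<Rightarrow> real \<times> 'x \<times> 'e" where
  "euler_point V N p j = (fst p * (1 - j / N), euler V N p j, snd (snd p))"

lemma euler_Suc: "euler V N p (Suc j) = euler V N p j - (fst p / N) *\<^sub>R V (euler_point V N p j)"
  by (simp add: euler_point_def)

lemma power_one_plus_le_exp:
  assumes "0 \<le> y" "j \<le> N" "0 < N"
  shows "(1 + y / real N) ^ j \<le> exp y"
proof -
  have "(1 + y / N) ^ j \<le> exp (y / N) ^ j"
    using assms by (intro power_mono exp_ge_add_one_self) auto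
  also have "\<dots> = exp (y * (j / N))" by (simp flip: exp_of_nat_mult)
  also have "\<dots> \<le> exp (y * 1)" unfolding exp_le_cancel_iff using assms by (intro mult_left_mono) auto
  finally show ?thesis by simp
qed

text \<open>Matches the discrete growth bound for \<open>1 + norm x\<close> with the radius G; it
  amounts to (1 - y) * exp y \<le> 1.\<close>

lemma gronwall_radius:
  fixes \<kappa> y :: real
  assumes "0 \<le> y"
  shows "(1 + \<kappa>) * exp y - 1 \<le> (\<kappa> + y) * exp y"
proof -
  have "(1 - y) * exp y \<le> exp (- y) * exp y"
    using exp_ge_add_one_self[of "- y"] by (intro mult_right_mono) auto
  then show ?thesis by (simp add: exp_minus algebra_simps)
qed

text \<open>\<open>G\<close> is the radius of the ball over which the norm of \<open>V\<close> is taken; the iterates that start in the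
  ball of radius \<open>\<kappa>\<close> do not leave it.\<close>

locale euler_scheme =
  fixes V :: "real \<times> 'x::euclidean_space \<times> 'e::euclidean_space \<Rightarrow> 'x" and T C \<kappa> G M :: real and Y :: "'e set" and N :: nat
  assumes T: "0 < T" and C: "0 < C" and \<kappa>: "0 \<le> \<kappa>" and N: "0 < N"
    and G: "G = (\<kappa> + C * T) * exp (C * T)"
    and growth: "\<And>t x \<eta>. t \<in> {0..T} \<Longrightarrow> \<eta> \<in> Y \<Longrightarrow> norm (V (t, x, \<eta>)) \<le> C * (1 + norm x)"
    and VM: "\<And>P. P \<in> {0..T} \<times> cball 0 G \<times> Y \<Longrightarrow> norm (V P) \<le> M"
begin

abbreviation "\<Omega>\<^sub>0 \<equiv> {0..T} \<times> cball (0 :: 'x) \<kappa> \<times> Y"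
abbreviation "\<Omega> \<equiv> {0..T} \<times> cball (0 :: 'x) G \<times> Y"

lemma time_in:
  assumes "0 \<le> t" "t \<le> T" "j \<le> N"
  shows "t * (1 - real j / real N) \<in> {0..T}"
proof -
  have "0 \<le> 1 - real j / N" "1 - real j / N \<le> 1" using assms N by auto
  then have "t * (1 - real j / N) \<le> T * 1" "0 \<le> t * (1 - real j / N)"
    using assms by (intro mult_mono mult_nonneg_nonneg; simp)+
  then show ?thesis by simp
qed

text \<open>The growth condition is linear in \<open>1 + norm x\<close>, so this quantity obeys a
  homogeneous recursion, whereas the norm alone would leave an inhomogeneous term.\<close>

lemma euler_growth:
  assumes "p \<in> \<Omega>\<^sub>0" "j \<le> N"
  shows "1 + norm (euler V N p j) \<le> (1 + \<kappa>) * (1 + C * T / N) ^ j"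
  using assms(2)
proof (induction j)
  case 0
  then show ?case using assms(1) by auto
next
  case (Suc j)
  have p: "0 \<le> fst p" "fst p \<le> T" "snd (snd p) \<in> Y" using assms(1) by auto
  let ?x = "euler V N p j"
  have "norm (euler V N p (Suc j)) \<le> norm ?x + norm ((fst p / N) *\<^sub>R V (euler_point V N p j))"
    unfolding euler_Suc by (rule norm_triangle_ineq4)
  also have "norm ((fst p / N) *\<^sub>R V (euler_point V N p j)) = fst p / N * norm (V (euler_point V N p j))"
    using p by simp
  also have "\<dots> \<le> T / N * (C * (1 + norm ?x))"
  proof (intro mult_mono divide_right_mono)
    show "norm (V (euler_point V N p j)) \<le> C * (1 + norm ?x)"
      unfolding euler_point_def using time_in[OF p(1,2)] Suc.prems p(3) by (intro growth) auto
  qed (use p T C in auto)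
  finally have "1 + norm (euler V N p (Suc j)) \<le> (1 + norm ?x) * (1 + C * T / N)"
    by (simp add: algebra_simps)
  also have "\<dots> \<le> ((1 + \<kappa>) * (1 + C * T / N) ^ j) * (1 + C * T / N)"
    using Suc C T by (intro mult_right_mono) auto
  finally show ?case by (simp add: mult_ac)
qed

lemma euler_point_in:
  assumes "p \<in> \<Omega>\<^sub>0" "j \<le> N"
  shows "euler_point V N p j \<in> \<Omega>"
proof -
  have p: "0 \<le> fst p" "fst p \<le> T" "snd (snd p) \<in> Y" using assms(1) by auto
  have "1 + norm (euler V N p j) \<le> (1 + \<kappa>) * (1 + C * T / N) ^ j" by (rule euler_growth[OF assms])
  also have "\<dots> \<le> (1 + \<kappa>) * exp (C * T)"
    using power_one_plus_le_exp[of "C * T" j N] assms C T N \<kappa> by (intro mult_left_mono) auto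
  finally have "norm (euler V N p j) \<le> G" using gronwall_radius[of "C * T" \<kappa>] C T unfolding G by simp
  then show ?thesis using time_in[OF p(1,2) assms(2)] p(3) by (simp add: euler_point_def)
qed

text \<open>A second bound, by the speed M on \<open>\<Omega>\<close> instead of the growth
  constant. It is available once the iterates are known to stay in \<open>\<Omega>\<close>, and it
  keeps C out of the final constant.\<close>

lemma euler_displacement:
  assumes "p \<in> \<Omega>\<^sub>0" "j \<le> N"
  shows "norm (euler V N p j) \<le> \<kappa> + j / N * (T * M)"
  using assms(2)
proof (induction j)
  case 0
  then show ?case using assms(1) by auto
next
  case (Suc j)
  have p: "0 \<le> fst p" "fst p \<le> T" using assms(1) by auto
  have V: "norm (V (euler_point V N p j)) \<le> M" using euler_point_in[OF assms(1)] Suc by (intro VM) auto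
  have "norm ((fst p / N) *\<^sub>R V (euler_point V N p j)) = fst p / N * norm (V (euler_point V N p j))"
    using p by simp
  also have "\<dots> \<le> T / N * M"
    using p V T by (intro mult_mono divide_right_mono) auto
  finally have "norm (euler V N p (Suc j)) \<le> \<kappa> + j / N * (T * M) + T / N * M"
    unfolding euler_Suc using Suc norm_triangle_ineq4[of "euler V N p j" "(fst p / N) *\<^sub>R V (euler_point V N p j)"] by simp
  then show ?case using N by (simp add: field_simps)
qed

lemma euler_final_norm:
  assumes "p \<in> \<Omega>\<^sub>0"
  shows "norm (euler V N p N) \<le> \<kappa> + T * M"
  using euler_displacement[OF assms order_refl] N by simp

end

section \<open>Jets of the Euler scheme\<close>

lemma jet_scaled:
  assumes "jet k Z A f" "\<bar>c\<bar> * A \<le> A'"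
  shows "jet k Z A' (\<lambda>z. c * f z)"
  by (rule jet_mono[OF jet_cmult[OF assms(1)] assms(2)])

text \<open>Substitution of jets into the expansion of f at P. Since \<open>A \<le> 1\<close>, both
  \<open>A ^ length w\<close> and \<open>A ^ k\<close> are at most A, so the result is linear in A,
  as the recursion requires. The expansion is valid up to distance \<open>DIM('a)\<close>, which
  covers \<open>Q z\<close> because each coordinate moves by at most
  \<open>A * norm z \<le> 1\<close>.\<close>

lemma field_jet:
  fixes f :: "'a::euclidean_space \<Rightarrow> real" and Q :: "'b::euclidean_space \<Rightarrow> 'a" and M B A :: real
  assumes f: "locally_poly k M B (real DIM('a)) \<Omega> f" and k: "1 \<le> k" and M: "0 \<le> M" and B: "0 \<le> B"
    and Z: "Z \<subseteq> cball 0 1" and A: "0 \<le> A" "A \<le> 1" and P: "P \<in> \<Omega>" and Q: "\<And>z. z \<in> Z \<Longrightarrow> Q z \<in> \<Omega>"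
    and J: "\<And>b. b \<in> Basis \<Longrightarrow> jet k Z A (\<lambda>z. (Q z - P) \<bullet> b)"
  shows "jet k Z ((card (words k :: 'a list set) * M + B * real DIM('a) ^ k) * A) (\<lambda>z. f (Q z) - f P)"
proof -
  let ?W = "words k - {[]} :: 'a list set" and ?d = "real DIM('a)"
  obtain a where a: "\<And>w. w \<in> words k \<Longrightarrow> \<bar>a w\<bar> \<le> M"
    "\<And>q. q \<in> \<Omega> \<Longrightarrow> norm (q - P) \<le> ?d \<Longrightarrow> \<bar>f q - (\<Sum>w\<in>words k. a w * wpow (q - P) w)\<bar> \<le> B * norm (q - P) ^ k"
    using f P unfolding locally_poly_def by blast
  have nil: "[] \<in> (words k :: 'a list set)" using k by (simp add: words_def)
  have split: "(\<Sum>w\<in>words k. a w * wpow q w) = a [] + (\<Sum>w\<in>?W. a w * wpow q w)" for q :: 'a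
    using sum.remove[OF finite_words nil, of "\<lambda>w. a w * wpow q w"] by simp
  have "wpow (0 :: 'a) w = 0" if "w \<in> ?W" for w
    using that by (cases w) auto
  \<comment> \<open>At the centre all nonempty monomials vanish and, as \<open>1 \<le> k\<close>, so
    does the remainder.\<close>
  then have "a [] = f P" using a(2)[OF P] k unfolding split by (simp add: power_0_left)
  note split = split[unfolded this]
  have QP: "norm (Q z - P) \<le> ?d * (A * norm z)" if z: "z \<in> Z" for z
  proof -
    have "norm (Q z - P) \<le> (\<Sum>b\<in>Basis. \<bar>(Q z - P) \<bullet> b\<bar>)" by (rule norm_le_l1)
    also have "\<dots> \<le> (\<Sum>b\<in>(Basis :: 'a set). A * norm z)"
      using J z Z k by (intro sum_mono jet_bound) auto
    finally show ?thesis by simp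
  qed
  have "jet k Z (\<Sum>w\<in>?W. M * A) (\<lambda>z. \<Sum>w\<in>?W. a w * wpow (Q z - P) w)"
  proof (intro jet_sum jet_scaled)
    fix w assume w: "w \<in> ?W"
    show "jet k Z (A ^ length w) (\<lambda>z. wpow (Q z - P) w)"
      using w J by (intro jet_wpow[OF Z k]) (auto simp: words_def)
    have "A ^ length w \<le> A ^ 1" using w A by (intro power_decreasing) (auto simp: Suc_le_eq)
    then show "\<bar>a w\<bar> * A ^ length w \<le> M * A" using a(1)[of w] w A M by (intro mult_mono) auto
  qed simp
  moreover have "jet k Z (B * ?d ^ k * A) (\<lambda>z. f (Q z) - f P - (\<Sum>w\<in>?W. a w * wpow (Q z - P) w))"
  proof (rule jet_remainder)
    fix z assume z: "z \<in> Z"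
    then have nz: "norm z \<le> 1" using Z by auto
    have "A * norm z \<le> 1" using A nz by (simp add: mult_le_one)
    then have "?d * (A * norm z) \<le> ?d" by (rule mult_left_le) simp
    then have "norm (Q z - P) \<le> ?d" using QP[OF z] by linarith
    then have "\<bar>f (Q z) - f P - (\<Sum>w\<in>?W. a w * wpow (Q z - P) w)\<bar> \<le> B * norm (Q z - P) ^ k"
      using a(2)[OF Q[OF z]] unfolding split by (simp add: diff_diff_eq)
    also have "\<dots> \<le> B * (?d * (A * norm z)) ^ k"
      using QP[OF z] B by (intro mult_left_mono power_mono) auto
    also have "\<dots> = B * ?d ^ k * A ^ k * norm z ^ k" by (simp add: power_mult_distrib)
    also have "\<dots> \<le> B * ?d ^ k * A ^ 1 * norm z ^ k"
      using A B k by (intro mult_right_mono mult_left_mono power_decreasing) auto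
    finally show "\<bar>f (Q z) - f P - (\<Sum>w\<in>?W. a w * wpow (Q z - P) w)\<bar> \<le> B * ?d ^ k * A * norm z ^ k" by simp
  qed (use A B in auto)
  ultimately have "jet k Z ((\<Sum>w\<in>?W. M * A) + B * ?d ^ k * A) (\<lambda>z. f (Q z) - f P)"
    using jet_add by fastforce
  then show ?thesis
  proof (rule jet_mono)
    have "(\<Sum>w\<in>?W. M * A) \<le> card (words k :: 'a list set) * (M * A)"
      using M A by (auto intro!: mult_right_mono card_mono)
    then show "(\<Sum>w\<in>?W. M * A) + B * ?d ^ k * A \<le> (card (words k :: 'a list set) * M + B * ?d ^ k) * A"
      by (simp add: algebra_simps)
  qed
qed

context euler_scheme
begin

text \<open>In the variable z = (q - p) / \<rho>, a step adds 1 / N times a jet with bound C2 * A,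
  so A grows by the factor \<open>1 + C2 / N\<close>, and \<open>\<rho> * exp C2 \<le> 1\<close>
  keeps it at most 1 up to step N. The induction runs over all directions i at once, since V couples
  them.\<close>

lemma euler_jet:
  fixes k :: nat and B \<rho> :: real
  defines "d \<equiv> DIM(real \<times> 'x \<times> 'e)"
  defines "C1 \<equiv> card (words k :: (real \<times> 'x \<times> 'e) list set) * M + B * real d ^ k"
  defines "C2 \<equiv> (T + 1) * C1 + M"
  assumes f: "\<And>i. i \<in> Basis \<Longrightarrow> locally_poly k M B (real d) \<Omega> (\<lambda>P. V P \<bullet> i)"
    and k: "1 \<le> k" and M: "0 \<le> M" and B: "0 \<le> B"
    and \<rho>: "0 < \<rho>" "\<rho> * exp C2 \<le> 1" and p: "p \<in> \<Omega>\<^sub>0" and j: "j \<le> N" and i: "i \<in> Basis"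
  shows "jet k {z \<in> cball 0 1. p + \<rho> *\<^sub>R z \<in> \<Omega>\<^sub>0} (\<rho> * (1 + C2 / N) ^ j)
    (\<lambda>z. (euler V N (p + \<rho> *\<^sub>R z) j - euler V N p j) \<bullet> i)"
  using j i
proof (induction j arbitrary: i)
  let ?Z = "{z \<in> cball 0 1. p + \<rho> *\<^sub>R z \<in> \<Omega>\<^sub>0}"
  have C1: "0 \<le> C1" unfolding C1_def using M B by simp
  have C2: "0 \<le> C2" unfolding C2_def using C1 M T by simp
  have "\<rho> * 1 \<le> \<rho> * exp C2" using \<rho> C2 by (intro mult_left_mono) auto
  from order_trans[OF this \<rho>(2)] have \<rho>1: "\<rho> \<le> 1" by simp
  case 0
  have "(0, i, 0) \<in> (Basis :: (real \<times> 'x \<times> 'e) set)" using 0 by (simp add: Basis_prod_def)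
  from jet_coord[OF this k, of ?Z] have "jet k ?Z 1 (\<lambda>z. fst (snd z) \<bullet> i)" by (simp add: inner_prod_def)
  then have "jet k ?Z \<rho> (\<lambda>z. \<rho> * (fst (snd z) \<bullet> i))" by (rule jet_scaled) (use \<rho> in simp)
  then show ?case by simp
next
  let ?Z = "{z \<in> cball 0 1. p + \<rho> *\<^sub>R z \<in> \<Omega>\<^sub>0}"
  have C1: "0 \<le> C1" unfolding C1_def using M B by simp
  have C2: "0 \<le> C2" unfolding C2_def using C1 M T by simp
  have "\<rho> * 1 \<le> \<rho> * exp C2" using \<rho> C2 by (intro mult_left_mono) auto
  from order_trans[OF this \<rho>(2)] have \<rho>1: "\<rho> \<le> 1" by simp
  have Z: "?Z \<subseteq> cball 0 1" by auto
  case (Suc j)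
  define A where "A = \<rho> * (1 + C2 / N) ^ j"
  define P where "P = euler_point V N p j"
  define Q where "Q z = euler_point V N (p + \<rho> *\<^sub>R z) j" for z
  define \<theta> where "\<theta> = 1 - real j / N"
  have jN: "j \<le> N" using Suc.prems by simp
  have \<theta>: "0 \<le> \<theta>" "\<theta> \<le> 1" using jN N by (auto simp: \<theta>_def)
  have "\<rho> * 1 \<le> A" unfolding A_def using \<rho> C2 by (intro mult_left_mono one_le_power) auto
  then have A\<rho>: "\<rho> \<le> A" by simp
  have "A \<le> \<rho> * exp C2"
    unfolding A_def using power_one_plus_le_exp[OF C2 jN N] \<rho> by (intro mult_left_mono) auto
  then have A1: "A \<le> 1" using \<rho> by simp
  have A0: "0 \<le> A" using A\<rho> \<rho> by simp
  have PQ: "P \<in> \<Omega>" "\<And>z. z \<in> ?Z \<Longrightarrow> Q z \<in> \<Omega>"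
    unfolding P_def Q_def using euler_point_in p jN by auto
  have coord: "jet k ?Z A (\<lambda>z. \<rho> * c * (z \<bullet> b))" if "b \<in> Basis" "\<bar>c\<bar> \<le> 1" for c b
  proof (rule jet_scaled[OF jet_coord[OF that(1) k]])
    have "\<rho> * \<bar>c\<bar> \<le> A" by (rule order_trans[OF mult_left_le A\<rho>]) (use \<rho> that in auto)
    then show "\<bar>\<rho> * c\<bar> * 1 \<le> A" using \<rho> by (simp add: abs_mult)
  qed
  \<comment> \<open>The bound A covers all coordinates: time moves by \<rho> * \<theta> and the
    parameter by \<rho> times a coordinate of z, both with bound at most A, and space is left to the
    induction hypothesis.\<close>
  have comp: "jet k ?Z A (\<lambda>z. (Q z - P) \<bullet> b)" if b: "b \<in> Basis" for b
  proof -
    consider "b = (1, 0, 0)" | i where "i \<in> Basis" "b = (0, i, 0)" | e where "e \<in> Basis" "b = (0, 0, e)"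
      using b by (auto simp: Basis_prod_def zero_prod_def)
    then show ?thesis
    proof cases
      case 1
      have "(Q z - P) \<bullet> b = \<rho> * \<theta> * (z \<bullet> b)" for z
        unfolding 1 Q_def P_def euler_point_def \<theta>_def by (simp add: inner_prod_def algebra_simps)
      then show ?thesis using coord[OF b, of \<theta>] \<theta> by simp
    next
      case 2
      have "(Q z - P) \<bullet> b = (euler V N (p + \<rho> *\<^sub>R z) j - euler V N p j) \<bullet> i" for z
        unfolding 2 Q_def P_def euler_point_def by (simp add: inner_prod_def)
      then show ?thesis using Suc.IH[OF jN 2(1)] unfolding A_def by simp
    next
      case 3
      have "(Q z - P) \<bullet> b = \<rho> * 1 * (z \<bullet> b)" for z
        unfolding 3 Q_def P_def euler_point_def by (simp add: inner_prod_def)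
      then show ?thesis using coord[OF b, of 1] by simp
    qed
  qed
  have F: "jet k ?Z (C1 * A) (\<lambda>z. V (Q z) \<bullet> i - V P \<bullet> i)"
    unfolding C1_def d_def
    by (rule field_jet[OF f[OF Suc.prems(2), unfolded d_def] k M B Z A0 A1 PQ comp])
  have e1: "(1, 0, 0) \<in> (Basis :: (real \<times> 'x \<times> 'e) set)" by (simp add: Basis_prod_def zero_prod_def)
  have tp: "\<bar>fst p\<bar> \<le> T" using p by auto
  have VP: "\<bar>V P \<bullet> i\<bar> \<le> M"
    using order_trans[OF Basis_le_norm[OF Suc.prems(2)] VM[OF PQ(1)]] .
  \<comment> \<open>The difference of \<open>fst p * V P\<close> and its shifted counterpart splits
    by the product rule: old time times change of V, change of time times change of V, change of
    time times old V. The three bounds T * C1, C1 and M make up C2.\<close>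
  have J1: "jet k ?Z (T * (C1 * A)) (\<lambda>z. fst p * (V (Q z) \<bullet> i - V P \<bullet> i))"
    by (rule jet_scaled[OF F]) (use tp C1 A0 in \<open>intro mult_right_mono; simp\<close>)
  have J2: "jet k ?Z (1 * (C1 * A)) (\<lambda>z. (\<rho> * (z \<bullet> (1, 0, 0))) * (V (Q z) \<bullet> i - V P \<bullet> i))"
  proof (rule jet_mult[OF Z k _ F])
    show "jet k ?Z 1 (\<lambda>z. \<rho> * (z \<bullet> (1, 0, 0)))"
      by (rule jet_scaled[OF jet_coord[OF e1 k]]) (use \<rho> \<rho>1 in simp)
  qed
  have J3: "jet k ?Z (M * A) (\<lambda>z. (\<rho> * (V P \<bullet> i)) * (z \<bullet> (1, 0, 0)))"
  proof (rule jet_scaled[OF jet_coord[OF e1 k]])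
    show "\<bar>\<rho> * (V P \<bullet> i)\<bar> * 1 \<le> M * A"
      using mult_mono[OF A\<rho> VP] A0 \<rho> by (simp add: abs_mult mult.commute)
  qed
  have J: "jet k ?Z (T * (C1 * A) + 1 * (C1 * A) + M * A)
     (\<lambda>z. fst p * (V (Q z) \<bullet> i - V P \<bullet> i) + (\<rho> * (z \<bullet> (1, 0, 0))) * (V (Q z) \<bullet> i - V P \<bullet> i)
        + (\<rho> * (V P \<bullet> i)) * (z \<bullet> (1, 0, 0)))"
    by (intro jet_add J1 J2 J3)
  have "jet k ?Z (A + \<bar>- 1 / N\<bar> * (T * (C1 * A) + 1 * (C1 * A) + M * A))
      (\<lambda>z. (euler V N (p + \<rho> *\<^sub>R z) j - euler V N p j) \<bullet> i + (- 1 / N) *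
       (fst p * (V (Q z) \<bullet> i - V P \<bullet> i) + (\<rho> * (z \<bullet> (1, 0, 0))) * (V (Q z) \<bullet> i - V P \<bullet> i)
        + (\<rho> * (V P \<bullet> i)) * (z \<bullet> (1, 0, 0))))"
    by (intro jet_add jet_cmult J) (use Suc.IH[OF jN Suc.prems(2)] in \<open>simp add: A_def\<close>)
  moreover have "A + \<bar>- 1 / N\<bar> * (T * (C1 * A) + 1 * (C1 * A) + M * A) = \<rho> * (1 + C2 / N) ^ Suc j"
    unfolding A_def C2_def by (simp add: field_simps)
  moreover have "(euler V N (p + \<rho> *\<^sub>R z) j - euler V N p j) \<bullet> i + (- 1 / N) *
       (fst p * (V (Q z) \<bullet> i - V P \<bullet> i) + (\<rho> * (z \<bullet> (1, 0, 0))) * (V (Q z) \<bullet> i - V P \<bullet> i)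
        + (\<rho> * (V P \<bullet> i)) * (z \<bullet> (1, 0, 0)))
      = (euler V N (p + \<rho> *\<^sub>R z) (Suc j) - euler V N p (Suc j)) \<bullet> i" for z
  proof -
    have "z \<bullet> (1, 0, 0) = fst z" by (simp add: inner_prod_def)
    then show ?thesis
      unfolding euler_Suc Q_def[symmetric] P_def[symmetric]
      by (simp add: inner_diff_left inner_add_left diff_divide_distrib add_divide_distrib algebra_simps)
  qed
  ultimately show ?case by simp
qed

text \<open>Undoing the rescaling divides the coefficient of w by \<open>\<rho> ^ length w\<close>
  and the remainder by \<open>\<rho> ^ k\<close>; the value at p becomes the coefficient of the
  empty word. The resulting bounds contain neither N nor C.\<close>

lemma euler_locally_poly:
  fixes k :: nat and B \<rho> :: real
  defines "d \<equiv> DIM(real \<times> 'x \<times> 'e)"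
  defines "C1 \<equiv> card (words k :: (real \<times> 'x \<times> 'e) list set) * M + B * real d ^ k"
  defines "C2 \<equiv> (T + 1) * C1 + M"
  assumes f: "\<And>i. i \<in> Basis \<Longrightarrow> locally_poly k M B (real d) \<Omega> (\<lambda>P. V P \<bullet> i)"
    and k: "1 \<le> k" and M: "0 \<le> M" and B: "0 \<le> B"
    and \<rho>: "0 < \<rho>" "\<rho> * exp C2 \<le> 1" and i: "i \<in> Basis"
  shows "locally_poly k (\<kappa> + T * M + (1 / \<rho>) ^ k) ((1 / \<rho>) ^ k) \<rho> \<Omega>\<^sub>0 (\<lambda>p. euler V N p N \<bullet> i)"
  unfolding locally_poly_def
proof
  fix p assume p: "p \<in> \<Omega>\<^sub>0"
  let ?Z = "{z \<in> cball 0 1. p + \<rho> *\<^sub>R z \<in> \<Omega>\<^sub>0}" and ?W = "words k - {[]} :: (real \<times> 'x \<times> 'e) list set"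
  have C1: "0 \<le> C1" unfolding C1_def using M B by simp
  have C2: "0 \<le> C2" unfolding C2_def using C1 M T by simp
  have "\<rho> * 1 \<le> \<rho> * exp C2" using \<rho> C2 by (intro mult_left_mono) auto
  from order_trans[OF this \<rho>(2)] have \<rho>1: "\<rho> \<le> 1" by simp
  have "\<rho> * (1 + C2 / N) ^ N \<le> \<rho> * exp C2"
    using power_one_plus_le_exp[OF C2 order_refl N] \<rho> by (intro mult_left_mono) auto
  then have 1: "\<rho> * (1 + C2 / N) ^ N \<le> 1" using \<rho> by linarith
  have "jet k ?Z 1 (\<lambda>z. (euler V N (p + \<rho> *\<^sub>R z) N - euler V N p N) \<bullet> i)"
    by (rule jet_mono[OF euler_jet[OF f[unfolded d_def] k M B \<rho>(1) _ p order_refl i]])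
      (use \<rho> 1 in \<open>auto simp: C2_def C1_def d_def\<close>)
  then obtain a :: "_ \<Rightarrow> real" and B' where a: "0 \<le> B'" "(\<Sum>w\<in>?W. \<bar>a w\<bar>) + B' \<le> 1"
    "\<And>z. z \<in> ?Z \<Longrightarrow> \<bar>(euler V N (p + \<rho> *\<^sub>R z) N - euler V N p N) \<bullet> i - (\<Sum>w\<in>?W. a w * wpow z w)\<bar> \<le> B' * norm z ^ k"
    by (rule jetE) blast
  define b where "b w = (if w = [] then euler V N p N \<bullet> i else a w / \<rho> ^ length w)" for w
  have nil: "[] \<in> (words k :: (real \<times> 'x \<times> 'e) list set)" using k by (simp add: words_def)
  have MT: "0 \<le> \<kappa> + T * M" using \<kappa> T M by simp
  show "\<exists>a. (\<forall>w\<in>words k. \<bar>a w\<bar> \<le> \<kappa> + T * M + (1 / \<rho>) ^ k) \<and>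
      (\<forall>q\<in>\<Omega>\<^sub>0. norm (q - p) \<le> \<rho> \<longrightarrow>
        \<bar>euler V N q N \<bullet> i - (\<Sum>w\<in>words k. a w * wpow (q - p) w)\<bar> \<le> (1 / \<rho>) ^ k * norm (q - p) ^ k)"
  proof (intro exI[of _ b] conjI ballI impI)
    fix w :: "(real \<times> 'x \<times> 'e) list" assume w: "w \<in> words k"
    show "\<bar>b w\<bar> \<le> \<kappa> + T * M + (1 / \<rho>) ^ k"
    proof (cases "w = []")
      case True
      have "\<bar>euler V N p N \<bullet> i\<bar> \<le> \<kappa> + T * M"
        by (rule order_trans[OF Basis_le_norm[OF i] euler_final_norm[OF p]])
      moreover have "0 \<le> (1 / \<rho>) ^ k" using \<rho> by simp
      ultimately show ?thesis using True by (simp add: b_def)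
    next
      case False
      have "\<bar>a w\<bar> \<le> (\<Sum>w\<in>?W. \<bar>a w\<bar>)" using w False by (intro member_le_sum) auto
      then have "\<bar>a w\<bar> \<le> 1" using a by linarith
      then have "\<bar>b w\<bar> \<le> 1 / \<rho> ^ length w"
        using False \<rho> by (simp add: b_def divide_right_mono)
      also have "\<dots> = (1 / \<rho>) ^ length w" by (simp add: power_one_over)
      also have "\<dots> \<le> (1 / \<rho>) ^ k" using \<rho> \<rho>1 w by (intro power_increasing) (auto simp: words_def)
      finally show ?thesis using MT by linarith
    qed
  next
    fix q assume q: "q \<in> \<Omega>\<^sub>0" "norm (q - p) \<le> \<rho>"
    define z where "z = (1 / \<rho>) *\<^sub>R (q - p)"
    have qz: "p + \<rho> *\<^sub>R z = q" using \<rho> by (simp add: z_def)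
    have nz: "norm z = norm (q - p) / \<rho>" using \<rho> by (simp add: z_def)
    have "norm z \<le> 1" unfolding nz using q \<rho> by simp
    then have "z \<in> ?Z" using q qz by simp
    from a(3)[OF this] have e: "\<bar>(euler V N q N - euler V N p N) \<bullet> i - (\<Sum>w\<in>?W. a w * wpow z w)\<bar> \<le> B' * norm z ^ k"
      unfolding qz .
    have "(\<Sum>w\<in>words k. b w * wpow (q - p) w) = euler V N p N \<bullet> i + (\<Sum>w\<in>?W. b w * wpow (q - p) w)"
      using sum.remove[OF finite_words nil, of "\<lambda>w. b w * wpow (q - p) w"] by (simp add: b_def)
    also have "(\<Sum>w\<in>?W. b w * wpow (q - p) w) = (\<Sum>w\<in>?W. a w * wpow z w)"
      by (intro sum.cong) (auto simp: b_def z_def wpow_scaleR power_one_over)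
    finally have s: "(\<Sum>w\<in>words k. b w * wpow (q - p) w) = euler V N p N \<bullet> i + (\<Sum>w\<in>?W. a w * wpow z w)" .
    have "0 \<le> (\<Sum>w\<in>?W. \<bar>a w\<bar>)" by (simp add: sum_nonneg)
    then have "B' \<le> 1" using a(2) by linarith
    then have "B' * norm z ^ k \<le> 1 * norm z ^ k" by (intro mult_right_mono) auto
    moreover have "norm z ^ k = (1 / \<rho>) ^ k * norm (q - p) ^ k" unfolding nz by (simp add: power_divide)
    moreover have "euler V N q N \<bullet> i - (\<Sum>w\<in>words k. b w * wpow (q - p) w)
        = (euler V N q N - euler V N p N) \<bullet> i - (\<Sum>w\<in>?W. a w * wpow z w)"
      unfolding s by (simp add: inner_diff_left)
    ultimately show "\<bar>euler V N q N \<bullet> i - (\<Sum>w\<in>words k. b w * wpow (q - p) w)\<bar> \<le> (1 / \<rho>) ^ k * norm (q - p) ^ k"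
      using e by simp
  qed
qed

end

section \<open>The scheme and the transport equation\<close>

lemma sum_Basis_cart:
  fixes f :: "real^'n \<Rightarrow> 'c::comm_monoid_add"
  shows "(\<Sum>b\<in>Basis. f b) = (\<Sum>i\<in>UNIV. f (axis i 1))"
proof -
  have B: "Basis = range (\<lambda>i. axis i 1 :: real^'n)" by (auto simp: Basis_vec_def)
  have "inj (\<lambda>i. axis i 1 :: real^'n)" by (auto simp: inj_on_def axis_eq_axis)
  then show ?thesis unfolding B by (subst sum.reindex) simp_all
qed

lemma sum_Basis_prod:
  fixes f :: "'a::euclidean_space \<times> 'b::euclidean_space \<Rightarrow> 'c::comm_monoid_add"
  shows "(\<Sum>b\<in>Basis. f b) = (\<Sum>i\<in>Basis. f (i, 0)) + (\<Sum>i\<in>Basis. f (0, i))"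
proof -
  have "(\<lambda>u. (u, 0)) ` Basis \<inter> (\<lambda>v. (0, v)) ` Basis = ({} :: ('a \<times> 'b) set)" by auto
  then show ?thesis unfolding Basis_prod_def
    by (subst sum.union_disjoint) (auto simp: sum.reindex inj_on_def)
qed

lemma coord_box_param_cyl:
  assumes "0 < T"
  shows "coord_box (param_cyl T UNIV :: (real \<times> (real^'n) \<times> (real^'D)) set)"
proof -
  define I where "I b = (if fst b \<noteq> 0 then {0..T} else if fst (snd b) \<noteq> 0 then UNIV else {0..1})"
    for b :: "real \<times> (real^'n) \<times> (real^'D)"
  have B: "b \<in> Basis \<Longrightarrow> b = (1, 0, 0) \<or> (\<exists>i. b = (0, axis i 1, 0)) \<or> (\<exists>i. b = (0, 0, axis i 1))"
    for b :: "real \<times> (real^'n) \<times> (real^'D)" by (auto simp: Basis_prod_def Basis_vec_def zero_prod_def)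
  have ax: "axis i (1 :: real) \<noteq> 0" for i :: "'m::finite" by (simp add: axis_eq_0_iff)
  have "x \<in> param_cyl T UNIV \<longleftrightarrow> (\<forall>b\<in>Basis. x \<bullet> b \<in> I b)" for x :: "real \<times> (real^'n) \<times> (real^'D)"
  proof
    assume x: "x \<in> param_cyl T UNIV"
    show "\<forall>b\<in>Basis. x \<bullet> b \<in> I b"
    proof
      fix b :: "real \<times> (real^'n) \<times> (real^'D)" assume b: "b \<in> Basis"
      from B[OF b] show "x \<bullet> b \<in> I b"
        using x by (auto simp: I_def param_cyl_def inner_prod_def ax mem_box_cart inner_axis)
    qed
  next
    assume x: "\<forall>b\<in>Basis. x \<bullet> b \<in> I b"
    have b1: "(1, 0, 0) \<in> (Basis :: (real \<times> (real^'n) \<times> (real^'D)) set)"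
      by (simp add: Basis_prod_def zero_prod_def)
    have b3: "(0, 0, axis i 1) \<in> (Basis :: (real \<times> (real^'n) \<times> (real^'D)) set)" for i
    proof -
      have "axis i (1 :: real) \<in> Basis" by (auto simp: Basis_vec_def)
      then show ?thesis unfolding Basis_prod_def by blast
    qed
    have "fst x \<in> {0..T}" using bspec[OF x b1] by (simp add: I_def inner_prod_def)
    moreover have "vec_nth (snd (snd x)) i \<in> {0..1}" for i
      using bspec[OF x b3[of i]] by (simp add: I_def inner_prod_def inner_axis)
    ultimately show "x \<in> param_cyl T UNIV"
      by (cases x) (auto simp: param_cyl_def mem_box_cart)
  qed
  then have "param_cyl T UNIV = {x :: real \<times> (real^'n) \<times> (real^'D). \<forall>b\<in>Basis. x \<bullet> b \<in> I b}" by blast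
  moreover have "convex (I b)" for b unfolding I_def by auto
  moreover have "\<exists>y\<in>I b. y \<noteq> x" for b x
  proof -
    have "\<exists>y\<in>{0..c}. y \<noteq> x" if "0 < c" for c :: real
      using that by (cases "x = 0") (auto intro: bexI[of _ c] bexI[of _ 0])
    moreover have "\<exists>y. y \<noteq> x" by (rule exI[of _ "x + 1"]) simp
    ultimately show ?thesis using assms unfolding I_def by auto
  qed
  ultimately show ?thesis unfolding coord_box_def by blast
qed

text \<open>Along the segment of one step, u changes at a rate given by its derivative in the
  direction of (1, V (P j), 0), times - \<tau>. The equation at the current point Q replaces the
  time derivative, so that only the spatial gradient paired with V (P j) - V Q remains. This is
  small by the continuity of V, and no second derivative of u enters.\<close>

lemma transport_euler_error:
  fixes V :: "real \<times> (real^'n) \<times> (real^'D) \<Rightarrow> real^'n" and T C \<kappa> G M L \<delta> e :: real and N :: nat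
  assumes E: "euler_scheme V T C \<kappa> G M (cbox 0 1) N"
    and u: "transport_solution T V u0 u"
    and L: "\<And>P i. P \<in> {0..T} \<times> cball 0 G \<times> cbox 0 1 \<Longrightarrow> \<bar>partial_deriv (param_cyl T UNIV) (0, axis i 1, 0) u P\<bar> \<le> L"
    and V: "\<And>P Q. P \<in> {0..T} \<times> cball 0 G \<times> cbox 0 1 \<Longrightarrow> Q \<in> {0..T} \<times> cball 0 G \<times> cbox 0 1 \<Longrightarrow>
      dist P Q \<le> \<delta> \<Longrightarrow> norm (V P - V Q) \<le> e"
    and step: "T / N * (1 + M) \<le> \<delta>" and p: "p \<in> {0..T} \<times> cball 0 \<kappa> \<times> cbox 0 1"
  shows "\<bar>u p - u0 (euler V N p N)\<bar> \<le> T * (CARD('n) * (e * L))"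
proof -
  interpret euler_scheme V T C \<kappa> G M "cbox 0 1" N by (rule E)
  define S where "S = (param_cyl T UNIV :: (real \<times> (real^'n) \<times> (real^'D)) set)"
  have S: "coord_box S" unfolding S_def by (rule coord_box_param_cyl[OF T])
  have \<Omega>S: "\<Omega> \<subseteq> S" by (auto simp: S_def param_cyl_def)
  have conv: "convex \<Omega>" by (intro convex_Times convex_cball convex_box) simp
  have u1: "Ck_on 1 S u"
    and pde: "\<And>P. P \<in> S \<Longrightarrow> partial_deriv S (1, 0, 0) u P +
         V P \<bullet> vec_lambda (\<lambda>i. partial_deriv S (0, axis i 1, 0) u P) = 0"
    and init: "\<And>x \<eta>. \<eta> \<in> cbox 0 1 \<Longrightarrow> u (0, x, \<eta>) = u0 x"
    using u by (auto simp: transport_solution_def S_def Let_def)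
  define \<tau> where "\<tau> = fst p / N"
  define P where "P j = euler_point V N p j" for j
  have \<tau>: "0 \<le> \<tau>" "\<tau> \<le> T / N" using p N unfolding \<tau>_def by (auto simp: divide_right_mono)
  have P_in: "P j \<in> \<Omega>" if "j \<le> N" for j unfolding P_def by (rule euler_point_in[OF p that])
  have e0: "0 \<le> e" "0 \<le> L" 
  proof -
    have "0 \<le> M" using order_trans[OF norm_ge_zero VM[OF P_in[of 0]]] by simp
    then have "0 \<le> T / N * (1 + M)" using T by simp
    then have "0 \<le> \<delta>" using step by linarith
    then show "0 \<le> e" using V[OF P_in[of 0] P_in[of 0]] by simp
    show "0 \<le> L" using order_trans[OF abs_ge_zero L[OF P_in[of 0]]] by simp
  qed
  have one: "\<bar>u (P (Suc j)) - u (P j)\<bar> \<le> \<tau> * (CARD('n) * (e * L))" if j: "j < N" for j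
  proof -
    define v where "v = - \<tau> *\<^sub>R (1 :: real, V (P j), 0 :: real^'D)"
    have v: "P j + v = P (Suc j)"
      unfolding v_def P_def euler_point_def using N
      by (simp add: euler_Suc \<tau>_def euler_point_def field_simps)
    have Pj: "P j \<in> \<Omega>" "P (Suc j) \<in> \<Omega>" using P_in j by auto
    have seg: "P j + s *\<^sub>R v \<in> \<Omega>" if "s \<in> {0..1}" for s
    proof -
      have "(1 - s) *\<^sub>R P j + s *\<^sub>R P (Suc j) \<in> \<Omega>"
        using that by (intro convexD[OF conv Pj]) auto
      then show ?thesis unfolding v[symmetric] by (simp add: algebra_simps)
    qed
    have nv: "norm v \<le> \<delta>"
    proof -
      have "norm (1 :: real, V (P j), 0 :: real^'D) \<le> 1 + M"
        using norm_Pair_le[of "1 :: real" "(V (P j), 0 :: real^'D)"] norm_Pair_le[of "V (P j)" "0 :: real^'D"] VM[OF Pj(1)]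
        by simp
      then have "\<tau> * norm (1 :: real, V (P j), 0 :: real^'D) \<le> T / N * (1 + M)"
        using \<tau> by (intro mult_mono) auto
      moreover have "norm v = \<tau> * norm (1 :: real, V (P j), 0 :: real^'D)"
        unfolding v_def norm_scaleR using \<tau> by simp
      ultimately show ?thesis using step by linarith
    qed
    define g' where "g' s = (\<Sum>b\<in>Basis. (v \<bullet> b) *\<^sub>R partial_deriv S b u (P j + s *\<^sub>R v))" for s
    have "norm (u (P j + 1 *\<^sub>R v) - u (P j + 0 *\<^sub>R v) - 1 *\<^sub>R 0) \<le> \<tau> * (CARD('n) * (e * L)) * \<bar>1\<bar>"
    proof (rule segment_derivative_bound[where J = "{0..1}" and g' = g'])
      show "((\<lambda>s. u (P j + s *\<^sub>R v)) has_vector_derivative g' s) (at s within {0..1})" if "s \<in> {0..1}" for s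
        unfolding g'_def using seg \<Omega>S that by (intro has_vector_derivative_along_line[OF S u1]) auto
      fix s :: real assume "s \<in> closed_segment 0 1"
      then have s: "s \<in> {0..1}" by (simp add: closed_segment_eq_real_ivl)
      define Q where "Q = P j + s *\<^sub>R v"
      have Q: "Q \<in> \<Omega>" unfolding Q_def by (rule seg[OF s])
      have QS: "Q \<in> S" using Q \<Omega>S by blast
      have "dist (P j) Q = \<bar>s\<bar> * norm v" unfolding Q_def by (simp add: dist_norm)
      also have "\<dots> \<le> 1 * norm v" using s by (intro mult_right_mono) auto
      finally have VQ: "norm (V (P j) - V Q) \<le> e" using V[OF Pj(1) Q] nv by simp
      let ?D = "\<lambda>i. partial_deriv S (0, axis i 1, 0) u Q"
      have "g' s = (\<Sum>b\<in>Basis. (v \<bullet> b) *\<^sub>R partial_deriv S b u Q)" by (simp add: g'_def Q_def)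
      also have "\<dots> = - \<tau> * partial_deriv S (1, 0, 0) u Q + (\<Sum>i\<in>UNIV. - \<tau> * vec_nth (V (P j)) i * ?D i)"
        unfolding sum_Basis_prod sum_Basis_cart
        by (simp add: v_def inner_prod_def inner_axis zero_prod_def)
      also have "partial_deriv S (1, 0, 0) u Q = - (\<Sum>i\<in>UNIV. vec_nth (V Q) i * ?D i)"
        using pde[OF QS] by (simp add: inner_vec_def eq_neg_iff_add_eq_0)
      also have "- \<tau> * - (\<Sum>i\<in>UNIV. vec_nth (V Q) i * ?D i) + (\<Sum>i\<in>UNIV. - \<tau> * vec_nth (V (P j)) i * ?D i)
          = - \<tau> * (\<Sum>i\<in>UNIV. vec_nth (V (P j) - V Q) i * ?D i)"
        by (simp add: sum_distrib_left sum_subtractf algebra_simps sum_negf)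
      finally have "norm (g' s) = \<tau> * \<bar>\<Sum>i\<in>UNIV. vec_nth (V (P j) - V Q) i * ?D i\<bar>"
        using \<tau> by (simp add: abs_mult)
      also have "\<dots> \<le> \<tau> * (\<Sum>i\<in>(UNIV :: 'n set). e * L)"
      proof (intro mult_left_mono order_trans[OF sum_abs] sum_mono)
        show "\<bar>vec_nth (V (P j) - V Q) i * ?D i\<bar> \<le> e * L" for i
          unfolding abs_mult using L[OF Q, of i] e0 order_trans[OF component_le_norm_cart VQ]
          by (intro mult_mono) (auto simp: S_def)
      qed (use \<tau> in simp)
      finally show "norm (g' s - 0) \<le> \<tau> * (CARD('n) * (e * L))" by simp
    qed auto
    then show ?thesis using v by simp
  qed
  have "\<bar>u (P j) - u (P 0)\<bar> \<le> j * (\<tau> * (CARD('n) * (e * L)))" if "j \<le> N" for j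
    using that
  proof (induction j)
    case (Suc j)
    then show ?case using one[of j] by (simp add: distrib_right)
  qed simp
  from this[of N] have "\<bar>u (P N) - u (P 0)\<bar> \<le> fst p * (CARD('n) * (e * L))"
    using N by (simp add: \<tau>_def)
  also have "\<dots> \<le> T * (CARD('n) * (e * L))" using p e0 by (intro mult_right_mono) auto
  finally have "\<bar>u (P N) - u (P 0)\<bar> \<le> T * (CARD('n) * (e * L))" .
  moreover have "u (P N) = u0 (euler V N p N)"
    using init[of "snd (snd p)"] p N by (auto simp: P_def euler_point_def)
  moreover have "P 0 = p" by (simp add: P_def euler_point_def)
  ultimately show ?thesis by simp
qed

section \<open>Approximation of the solution\<close>

lemma coord_box_UNIV: "coord_box (UNIV :: 'a::euclidean_space set)"
proof -
  have "\<exists>y. y \<noteq> x" for x :: real by (rule exI[of _ "x + 1"]) simp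
  then show ?thesis unfolding coord_box_def by (intro exI[of _ "\<lambda>_. UNIV"]) auto
qed

text \<open>A bound by the sum of the suprema of the partial derivatives. Enlarging it to at least 1
  allows dividing the accuracy by it later.\<close>

lemma C1_lipschitz_on_cball:
  fixes f :: "'a::euclidean_space \<Rightarrow> real"
  assumes f: "Ck_on 1 UNIV f"
  obtains L where "1 \<le> L" "\<And>x y. x \<in> cball 0 R \<Longrightarrow> y \<in> cball 0 R \<Longrightarrow> \<bar>f x - f y\<bar> \<le> L * norm (x - y)"
proof -
  have "\<exists>B\<ge>0. \<forall>x\<in>cball 0 R. \<bar>partial_deriv UNIV b f x\<bar> \<le> B" if b: "b \<in> Basis" for b :: 'a
  proof -
    have "continuous_on (cball 0 R) (partial_deriv UNIV b f)"
      using f b by (auto intro: continuous_on_subset)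
    then have "bounded (partial_deriv UNIV b f ` cball 0 R)"
      by (intro compact_imp_bounded compact_continuous_image compact_cball)
    then obtain B where "\<forall>y\<in>partial_deriv UNIV b f ` cball 0 R. norm y \<le> B"
      unfolding bounded_iff by blast
    then show ?thesis by (intro exI[of _ "max B 0"]) (auto intro: le_max_iff_disj[THEN iffD2])
  qed
  then obtain B where B: "\<And>b. b \<in> (Basis :: 'a set) \<Longrightarrow> 0 \<le> B b"
    "\<And>b x. b \<in> (Basis :: 'a set) \<Longrightarrow> x \<in> cball 0 R \<Longrightarrow> \<bar>partial_deriv UNIV b f x\<bar> \<le> B b" by metis
  define L where "L = 1 + (\<Sum>b\<in>Basis. B b)"
  have L: "1 \<le> L" unfolding L_def using B(1) by (simp add: sum_nonneg)
  show ?thesis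
  proof (rule that[OF L])
    fix x y :: 'a assume x: "x \<in> cball 0 R" and y: "y \<in> cball 0 R"
    define v where "v = x - y"
    have seg: "y + s *\<^sub>R v \<in> cball 0 R" if "s \<in> {0..1}" for s
    proof -
      have "(1 - s) *\<^sub>R y + s *\<^sub>R x \<in> cball 0 R" using that by (intro convexD[OF convex_cball y x]) auto
      then show ?thesis by (simp add: v_def algebra_simps)
    qed
    have "norm (f (y + 1 *\<^sub>R v) - f (y + 0 *\<^sub>R v) - 1 *\<^sub>R 0) \<le> L * norm v * \<bar>1\<bar>"
    proof (rule segment_derivative_bound[where J = "{0..1}"])
      show "((\<lambda>s. f (y + s *\<^sub>R v)) has_vector_derivative
          (\<Sum>b\<in>Basis. (v \<bullet> b) *\<^sub>R partial_deriv UNIV b f (y + s *\<^sub>R v))) (at s within {0..1})" if "s \<in> {0..1}" for s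
        using that by (intro has_vector_derivative_along_line[OF coord_box_UNIV f]) auto
      fix s :: real assume "s \<in> closed_segment 0 1"
      then have s: "s \<in> {0..1}" by (simp add: closed_segment_eq_real_ivl)
      have "\<bar>\<Sum>b\<in>Basis. (v \<bullet> b) *\<^sub>R partial_deriv UNIV b f (y + s *\<^sub>R v)\<bar> \<le> (\<Sum>b\<in>Basis. norm v * B b)"
      proof (intro order_trans[OF sum_abs] sum_mono)
        fix b :: 'a assume b: "b \<in> Basis"
        show "\<bar>(v \<bullet> b) *\<^sub>R partial_deriv UNIV b f (y + s *\<^sub>R v)\<bar> \<le> norm v * B b"
          using Basis_le_norm[OF b, of v] B(2)[OF b seg[OF s]]
          unfolding real_scaleR_def abs_mult by (intro mult_mono) auto
      qed
      also have "\<dots> \<le> L * norm v"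
        unfolding L_def by (simp add: sum_distrib_left algebra_simps)
      finally show "norm ((\<Sum>b\<in>Basis. (v \<bullet> b) *\<^sub>R partial_deriv UNIV b f (y + s *\<^sub>R v)) - 0) \<le> L * norm v"
        by simp
    qed auto
    then show "\<bar>f x - f y\<bar> \<le> L * norm (x - y)" by (simp add: v_def)
  qed
qed

text \<open>A closed set that contains almost all points of an open ball contains the ball. The
  pointwise form matters because the network for \<open>u0\<close> is evaluated at images of the
  inner map, which an almost everywhere bound might miss.\<close>

lemma Linf_norm_imp_bound:
  fixes f :: "'a::euclidean_space \<Rightarrow> real"
  assumes "Linf_norm (cball 0 R) f \<le> ereal e" "continuous_on UNIV f" "norm x < R"
  shows "\<bar>f x\<bar> \<le> e"
proof -
  have "AE x in lebesgue_on (cball 0 R). ereal \<bar>f x\<bar> \<le> Linf_norm (cball 0 R) f"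
    unfolding Linf_norm_def by (rule esssup_AE)
  then have "AE x in lebesgue_on (cball 0 R). \<bar>f x\<bar> \<le> e"
    by (rule eventually_mono) (use assms(1) order_trans in fastforce)
  then have "AE x in lebesgue. x \<in> cball 0 R \<longrightarrow> \<bar>f x\<bar> \<le> e"
    by (subst (asm) AE_restrict_space_iff) auto
  then have "AE x in lebesgue. x \<in> ball 0 R \<longrightarrow> x \<in> {x. \<bar>f x\<bar> \<le> e}"
    by (rule eventually_mono) auto
  moreover have "closed {x. \<bar>f x\<bar> \<le> e}"
    using assms(2) by (intro closed_Collect_le continuous_intros) auto
  ultimately have "x \<in> {x. \<bar>f x\<bar> \<le> e}"
    using assms(3) mem_closed_if_AE_lebesgue_open[OF open_ball, of "{x. \<bar>f x\<bar> \<le> e}" 0 R x] by simp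
  then show ?thesis by simp
qed

lemma Linf_norm_le:
  fixes f :: "'a::euclidean_space \<Rightarrow> real"
  assumes "compact S" "continuous_on S f" "\<And>x. x \<in> S \<Longrightarrow> \<bar>f x\<bar> \<le> e"
  shows "Linf_norm S f \<le> ereal e"
  unfolding Linf_norm_def
proof (rule esssup_I)
  have "S \<in> sets lebesgue" using assms(1) by (simp add: compact_imp_closed lborelD borel_compact)
  then have "f \<in> borel_measurable (lebesgue_on S)"
    by (rule continuous_imp_measurable_on_sets_lebesgue[OF assms(2)])
  then show "(\<lambda>x. ereal \<bar>f x\<bar>) \<in> borel_measurable (lebesgue_on S)" by measurable
  show "AE x in lebesgue_on S. ereal \<bar>f x\<bar> \<le> ereal e"
    by (rule AE_I2) (use assms(3) in auto)
qed

text \<open>The coefficients are derivatives divided by factorials, hence at most M. As \<Omega> is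
  convex, the expansion holds between any two of its points, so \<rho> can be arbitrary.\<close>

lemma Ck_field_locally_poly:
  fixes V :: "'a::euclidean_space \<Rightarrow> 'b::euclidean_space"
  assumes S: "coord_box S" and V: "Ck_on k S V" and \<Omega>: "\<Omega> \<subseteq> S" "compact \<Omega>" "convex \<Omega>"
    and M: "Ck_norm k S \<Omega> V = M" and i: "i \<in> Basis"
  shows "locally_poly k M (real DIM('a) ^ k * M) \<rho> \<Omega> (\<lambda>P. V P \<bullet> i)"
  unfolding locally_poly_def
proof
  fix P assume P: "P \<in> \<Omega>"
  have b: "\<bar>word_deriv S w (\<lambda>P. V P \<bullet> i) x\<bar> \<le> M" if "set w \<subseteq> Basis" "length w \<le> k" "x \<in> \<Omega>" for w x
  proof -
    have "word_deriv S w (\<lambda>P. V P \<bullet> i) x = word_deriv S w V x \<bullet> i"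
      using that \<Omega> by (intro word_deriv_inner[OF S Ck_on_mono[OF V]]) auto
    also have "\<bar>\<dots>\<bar> \<le> norm (word_deriv S w V x)" by (rule Basis_le_norm[OF i])
    also have "\<dots> \<le> M" unfolding M[symmetric] by (rule norm_word_deriv_le_Ck_norm[OF S V \<Omega>(1,2) that])
    finally show ?thesis .
  qed
  let ?a = "\<lambda>w. word_deriv S w (\<lambda>P. V P \<bullet> i) P / fact (length w)"
  show "\<exists>a. (\<forall>w\<in>words k. \<bar>a w\<bar> \<le> M) \<and> (\<forall>q\<in>\<Omega>. norm (q - P) \<le> \<rho> \<longrightarrow>
      \<bar>V q \<bullet> i - (\<Sum>w\<in>words k. a w * wpow (q - P) w)\<bar> \<le> real DIM('a) ^ k * M * norm (q - P) ^ k)"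
  proof (intro exI[of _ ?a] conjI ballI impI)
    fix w :: "'a list" assume w: "w \<in> words k"
    have "\<bar>?a w\<bar> \<le> \<bar>word_deriv S w (\<lambda>P. V P \<bullet> i) P\<bar> / 1"
      unfolding abs_divide by (intro divide_left_mono) auto
    also have "\<dots> \<le> M" using b[of w P] w P by (simp add: words_def)
    finally show "\<bar>?a w\<bar> \<le> M" .
  next
    fix q assume q: "q \<in> \<Omega>"
    show "\<bar>V q \<bullet> i - (\<Sum>w\<in>words k. ?a w * wpow (q - P) w)\<bar> \<le> real DIM('a) ^ k * M * norm (q - P) ^ k"
      by (rule taylor_words[OF S Ck_on_inner[OF S V] \<Omega>(1,3) _ P q]) (use b in auto)
  qed
qed

text \<open>Three errors: replacing u by \<open>u0\<close> at E, replacing E by the computed map F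
  inside the Lipschitz function \<open>u0\<close>, and replacing \<open>u0\<close> by \<Phi> at F.
  The strict margin to R keeps F where \<Phi> is known to be accurate.\<close>

lemma network_of_composition:
  fixes E :: "'a::euclidean_space \<Rightarrow> 'b::euclidean_space" and u :: "'a \<Rightarrow> real"
    and l1 l2 w1 w2 \<epsilon>0 \<epsilon>1 \<epsilon>2 \<Lambda> R :: real
  assumes g: "\<And>b. b \<in> Basis \<Longrightarrow> \<exists>L W g. computes L W g \<and> real L \<le> l1 \<and> real W \<le> w1 \<and> (\<forall>q\<in>S. \<bar>g q - E q \<bullet> b\<bar> \<le> \<epsilon>2)"
    and \<Phi>: "is_nn DIM('b) \<Phi>" "real (num_layers \<Phi>) \<le> l2" "real (num_weights \<Phi>) \<le> w2"
      "\<And>x. norm x < R \<Longrightarrow> \<bar>u0 x - nn_fun \<Phi> x\<bar> \<le> \<epsilon>1"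
    and Lip: "0 \<le> \<Lambda>" "\<And>x y. x \<in> cball 0 R \<Longrightarrow> y \<in> cball 0 R \<Longrightarrow> \<bar>u0 x - u0 y\<bar> \<le> \<Lambda> * norm (x - y)"
    and E: "\<And>q. q \<in> S \<Longrightarrow> norm (E q) + DIM('b) * \<epsilon>2 < R" and \<epsilon>2: "0 \<le> \<epsilon>2"
    and u: "\<And>q. q \<in> S \<Longrightarrow> \<bar>u q - u0 (E q)\<bar> \<le> \<epsilon>0"
  shows "\<exists>\<Psi>. is_nn DIM('a) \<Psi> \<and> output_dim \<Psi> = 1 \<and> real (num_layers \<Psi>) \<le> l1 + l2 \<and>
    real (num_weights \<Psi>) \<le> DIM('b) * w1 + 2 * w2 \<and>
    (\<forall>q\<in>S. \<bar>u q - nn_fun \<Psi> q\<bar> \<le> \<epsilon>0 + \<Lambda> * (DIM('b) * \<epsilon>2) + \<epsilon>1)"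
proof -
  obtain L W g where g: "\<And>b. b \<in> Basis \<Longrightarrow> computes (L b) (W b) (g b)" "\<And>b. b \<in> Basis \<Longrightarrow> real (L b) \<le> l1"
    "\<And>b. b \<in> Basis \<Longrightarrow> real (W b) \<le> w1" "\<And>b q. b \<in> Basis \<Longrightarrow> q \<in> S \<Longrightarrow> \<bar>g b q - E q \<bullet> b\<bar> \<le> \<epsilon>2"
    using assms(1) by metis
  define F where "F q = (\<Sum>b\<in>Basis. g b q *\<^sub>R b)" for q
  have Fb: "F q \<bullet> b = g b q" if "b \<in> Basis" for q b
    unfolding F_def using that by simp
  \<comment> \<open>The components come with different depths and are brought to the
    largest.\<close>
  define L0 where "L0 = Max (L ` (Basis :: 'b set))"
  have L0: "L b \<le> L0" if "b \<in> Basis" for b unfolding L0_def using that by simp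
  have "L0 \<in> L ` (Basis :: 'b set)" unfolding L0_def by (intro Max_in) auto
  then have L0': "real L0 \<le> l1" using g(2) by auto
  have "computes L0 (W b) (\<lambda>q. F q \<bullet> b)" if "b \<in> Basis" for b
    using computes_mono[OF g(1)[OF that] L0[OF that] order_refl] by (simp add: Fb[OF that])
  then obtain G W' c where G: "relu_circuit (L0 + length \<Phi> - 1) W' G" "affine_comb G c (\<lambda>q. nn_fun \<Phi> (F q))"
    "W' + c \<le> (\<Sum>b\<in>Basis. W b) + 2 * num_weights \<Phi>"
    by (rule circuit_compose[OF _ \<Phi>(1)])
  obtain \<Psi> where \<Psi>: "is_nn DIM('a) \<Psi>" "output_dim \<Psi> = 1" "num_layers \<Psi> = Suc (L0 + length \<Phi> - 1)"
    "num_weights \<Psi> \<le> W' + c" "\<And>q. nn_fun \<Psi> q = nn_fun \<Phi> (F q)"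
    by (rule network_of_circuit[OF G(1,2)]) blast
  show ?thesis
  proof (intro exI[of _ \<Psi>] conjI ballI \<Psi>(1,2))
    have "\<Phi> \<noteq> []" using \<Phi>(1) by (simp add: is_nn_def)
    then have "num_layers \<Psi> = L0 + num_layers \<Phi>" using \<Psi>(3) by (cases \<Phi>) (auto simp: num_layers_def)
    then show "real (num_layers \<Psi>) \<le> l1 + l2" using L0' \<Phi>(2) by simp
    have "real (num_weights \<Psi>) \<le> (\<Sum>b\<in>Basis. real (W b)) + 2 * real (num_weights \<Phi>)"
      using \<Psi>(4) G(3) by (simp flip: of_nat_sum)
    also have "\<dots> \<le> (\<Sum>b\<in>(Basis :: 'b set). w1) + 2 * w2"
      using g(3) \<Phi>(3) by (intro add_mono sum_mono mult_left_mono) auto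
    finally show "real (num_weights \<Psi>) \<le> DIM('b) * w1 + 2 * w2" by simp
    fix q assume q: "q \<in> S"
    have "norm (F q - E q) \<le> (\<Sum>b\<in>Basis. \<bar>(F q - E q) \<bullet> b\<bar>)" by (rule norm_le_l1)
    also have "\<dots> \<le> (\<Sum>b\<in>(Basis :: 'b set). \<epsilon>2)"
      using g(4) q by (intro sum_mono) (auto simp: inner_diff_left Fb)
    finally have d: "norm (F q - E q) \<le> DIM('b) * \<epsilon>2" by simp
    have "norm (F q) \<le> norm (E q) + norm (F q - E q)" by (metis add.commute norm_triangle_sub)
    then have F: "norm (F q) < R" using d E[OF q] by linarith
    have "0 \<le> DIM('b) * \<epsilon>2" using \<epsilon>2 by simp
    then have Eq: "norm (E q) < R" using E[OF q] by linarith
    have "\<bar>u0 (F q) - u0 (E q)\<bar> \<le> \<Lambda> * norm (F q - E q)" using F Eq by (intro Lip) auto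
    also have "\<dots> \<le> \<Lambda> * (DIM('b) * \<epsilon>2)" using d Lip(1) by (rule mult_left_mono)
    finally show "\<bar>u q - nn_fun \<Psi> q\<bar> \<le> \<epsilon>0 + \<Lambda> * (DIM('b) * \<epsilon>2) + \<epsilon>1"
      using u[OF q] \<Phi>(4)[OF F] unfolding \<Psi>(5) by linarith
  qed
qed

text \<open>The choice of N depends on the modulus of continuity of V and on the size of the
  gradient of u over the closed cylinder of radius G, both under control by compactness.\<close>

lemma transport_euler_approx:
  fixes V :: "real \<times> (real^'n) \<times> (real^'D) \<Rightarrow> real^'n" and T C \<kappa> M e :: real
  defines "G \<equiv> (\<kappa> + C * T) * exp (C * T)"
  assumes T: "0 < T" and C: "0 < C" and \<kappa>: "0 \<le> \<kappa>" and e: "0 < e"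
    and growth: "\<And>t x \<eta>. t \<in> {0..T} \<Longrightarrow> \<eta> \<in> cbox 0 1 \<Longrightarrow> norm (V (t, x, \<eta>)) \<le> C * (1 + norm x)"
    and VM: "\<And>P. P \<in> {0..T} \<times> cball 0 G \<times> cbox 0 1 \<Longrightarrow> norm (V P) \<le> M"
    and V: "continuous_on (param_cyl T UNIV) V" and u: "transport_solution T V u0 u"
  obtains N where "euler_scheme V T C \<kappa> G M (cbox 0 1) N"
    "\<And>p. p \<in> {0..T} \<times> cball 0 \<kappa> \<times> cbox 0 1 \<Longrightarrow> \<bar>u p - u0 (euler V N p N)\<bar> \<le> e"
proof -
  let ?\<Omega> = "{0..T} \<times> cball (0 :: real^'n) G \<times> cbox (0 :: real^'D) 1"
  have \<Omega>: "compact ?\<Omega>" by (intro compact_Times compact_cball compact_cbox compact_Icc)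
  have \<Omega>S: "?\<Omega> \<subseteq> param_cyl T UNIV" by (auto simp: param_cyl_def)
  have G0: "0 \<le> G" unfolding G_def using \<kappa> C T by simp
  have M: "0 \<le> M" by (rule order_trans[OF norm_ge_zero VM[of "(0, 0, 0)"]]) (use T G0 in \<open>auto simp: mem_box_cart\<close>)
  have u1: "Ck_on 1 (param_cyl T UNIV) u" using u by (simp add: transport_solution_def Let_def)
  have "\<exists>B. \<forall>P\<in>?\<Omega>. \<bar>partial_deriv (param_cyl T UNIV) (0, axis i 1, 0) u P\<bar> \<le> B" for i
  proof -
    have "(0, axis i 1, 0) \<in> (Basis :: (real \<times> (real^'n) \<times> (real^'D)) set)"
      by (auto simp: Basis_prod_def Basis_vec_def)
    then have "continuous_on (param_cyl T UNIV) (partial_deriv (param_cyl T UNIV) (0, axis i 1, 0) u)"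
      using u1 by simp
    then have "bounded (partial_deriv (param_cyl T UNIV) (0, axis i 1, 0) u ` ?\<Omega>)"
      using \<Omega> \<Omega>S by (intro compact_imp_bounded compact_continuous_image) (auto intro: continuous_on_subset)
    then show ?thesis unfolding bounded_iff by auto
  qed
  then obtain B where B: "\<And>i P. P \<in> ?\<Omega> \<Longrightarrow> \<bar>partial_deriv (param_cyl T UNIV) (0, axis i 1, 0) u P\<bar> \<le> B i"
    by metis
  define L where "L = Max (range B)"
  have L: "\<bar>partial_deriv (param_cyl T UNIV) (0, axis i 1, 0) u P\<bar> \<le> L" if "P \<in> ?\<Omega>" for i P
    unfolding L_def by (rule order_trans[OF B[OF that, of i]], rule Max_ge) simp_all
  have L0: "0 \<le> L"
    by (rule order_trans[OF abs_ge_zero L[of "(0, 0, 0)"]]) (use T G0 in \<open>auto simp: mem_box_cart\<close>)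
  \<comment> \<open>\<open>L + 1\<close> instead of L avoids dividing by zero.\<close>
  define e' where "e' = e / (T * (CARD('n) * (L + 1)))"
  have e': "0 < e'" unfolding e'_def using e T L0 by simp
  have "uniformly_continuous_on ?\<Omega> V"
    using V \<Omega> \<Omega>S by (intro compact_uniformly_continuous) (auto intro: continuous_on_subset)
  then obtain \<delta> where \<delta>: "0 < \<delta>" "\<And>P Q. P \<in> ?\<Omega> \<Longrightarrow> Q \<in> ?\<Omega> \<Longrightarrow> dist Q P < \<delta> \<Longrightarrow> dist (V Q) (V P) < e'"
    using e' unfolding uniformly_continuous_on_def by metis
  \<comment> \<open>The factor 2 leads from the strict distance bound of uniform continuity to the
    nonstrict one in \<open>transport_euler_error\<close>.\<close>
  define N where "N = nat \<lceil>2 * T * (1 + M) / \<delta>\<rceil> + 1"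
  have N: "0 < N" by (simp add: N_def)
  have "2 * T * (1 + M) / \<delta> \<le> real N" unfolding N_def using real_nat_ceiling_ge[of "2 * T * (1 + M) / \<delta>"] by simp
  then have step: "T / N * (1 + M) \<le> \<delta> / 2" using N \<delta>(1) by (simp add: field_simps)
  have es: "euler_scheme V T C \<kappa> G M (cbox 0 1) N"
    by unfold_locales (use T C \<kappa> N growth VM in \<open>auto simp: G_def\<close>)
  show ?thesis
  proof (rule that[OF es])
    fix p :: "real \<times> (real^'n) \<times> (real^'D)" assume p: "p \<in> {0..T} \<times> cball 0 \<kappa> \<times> cbox 0 1"
    have "\<bar>u p - u0 (euler V N p N)\<bar> \<le> T * (CARD('n) * (e' * L))"
    proof (rule transport_euler_error[OF es u L _ step p])
      fix P Q assume PQ: "P \<in> ?\<Omega>" "Q \<in> ?\<Omega>" "dist P Q \<le> \<delta> / 2"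
      then have "dist P Q < \<delta>" using \<delta>(1) by linarith
      from \<delta>(2)[OF PQ(2,1) this] show "norm (V P - V Q) \<le> e'" by (simp add: dist_norm)
    qed
    also have "\<dots> \<le> T * (CARD('n) * (e' * (L + 1)))" using e' T by (intro mult_left_mono) auto
    also have "\<dots> = e' * (T * (CARD('n) * (L + 1)))" by simp
    also have "\<dots> = e" unfolding e'_def using T L0 by simp
    finally show "\<bar>u p - u0 (euler V N p N)\<bar> \<le> e" .
  qed
qed

text \<open>Asking for the accuracy \<epsilon> / a instead of \<epsilon> costs only a constant
  factor in the logarithmic bound.\<close>

lemma log_scale_bound:
  fixes a \<epsilon> :: real
  assumes "1 \<le> a" "0 < \<epsilon>" "\<epsilon> < 1"
  shows "ln (1 / (\<epsilon> / a)) + 1 \<le> (1 + ln a) * (ln (1 / \<epsilon>) + 1)"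
proof -
  have "ln (1 / (\<epsilon> / a)) = ln a + ln (1 / \<epsilon>)" using assms by (simp add: ln_div)
  moreover have "0 \<le> ln a * ln (1 / \<epsilon>)" using assms by simp
  ultimately show ?thesis by (simp add: algebra_simps)
qed

lemma powr_scale:
  fixes a \<epsilon> s :: real
  assumes "0 < a" "0 < \<epsilon>"
  shows "(\<epsilon> / a) powr (- s) = a powr s * \<epsilon> powr (- s)"
  using assms by (simp add: powr_divide powr_minus_divide)

text \<open>The order of the quantifiers carries the dependence of c: K, T, r, k, \<open>u0\<close>
  and the number M are fixed before c, whereas V, C and u come after it, so that V is visible to c
  only through its norm M.\<close>

theorem theorem4p3:
  fixes k d :: nat and r T M :: real
    and u0 :: "real^'n \<Rightarrow> real" and K :: "(real^'n) set"
  assumes "1 \<le> k" and "0 < T" and "0 < r"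
    and "Ck_on 1 UNIV u0" and "nn_approximable r u0" and "compact K"
    and "d = 1 + CARD('n) + CARD('D)"
  shows "\<exists>c>0. \<forall>(V :: real \<times> (real^'n) \<times> (real^'D) \<Rightarrow> real^'n) C u.
    Ck_on k (param_cyl T UNIV) V \<longrightarrow>
    0 < C \<longrightarrow>
    (\<forall>(t, x, \<eta>)\<in>param_cyl T UNIV. norm (V (t, x, \<eta>)) \<le> C * (1 + norm x)) \<longrightarrow>
    Ck_norm k (param_cyl T UNIV) (param_cyl T (cball 0 (flow_radius K C T))) V = M \<longrightarrow>
    transport_solution T V u0 u \<longrightarrow>
    (\<forall>\<epsilon>\<in>{0<..<1}. \<exists>\<Phi>. is_nn d \<Phi> \<and> output_dim \<Phi> = 1 \<and>
      real (num_layers \<Phi>) \<le> c * (ln (1 / \<epsilon>) + 1) \<and>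
      real (num_weights \<Phi>) \<le>
        c * (\<epsilon> powr (- 1 / r) + \<epsilon> powr (- real d / real k)) * (ln (1 / \<epsilon>) + 1) \<and>
      Linf_norm (param_cyl T K) (\<lambda>p. u p - nn_fun \<Phi> p) < ereal \<epsilon>)"
proof (cases "K = {}")
  \<comment> \<open>The supremum in \<open>set_bound\<close> says nothing for the empty set, and the
    nonnegativity of \<kappa> is derived from a point of K. Here the error lives on an empty set and
    the zero network with one layer will do.\<close>
  case True
  have d: "DIM(real \<times> (real^'n) \<times> (real^'D)) = d" using assms(7) by simp
  obtain \<Phi> where \<Phi>: "is_nn d \<Phi>" "output_dim \<Phi> = 1" "num_layers \<Phi> = Suc 0" "num_weights \<Phi> \<le> 0 + 0"
    using network_of_circuit[OF circuit_empty[of 0] affine_comb.zero, where 'a = "real \<times> (real^'n) \<times> (real^'D)"] d by metis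
  have Linf: "Linf_norm (param_cyl T K) (\<lambda>p. u p - nn_fun \<Phi> p) < ereal \<epsilon>" if "0 < \<epsilon>"
    for u :: "real \<times> (real^'n) \<times> (real^'D) \<Rightarrow> real" and \<epsilon>
  proof -
    have "Linf_norm (param_cyl T K) (\<lambda>p. u p - nn_fun \<Phi> p) \<le> ereal (\<epsilon> / 2)"
      by (rule Linf_norm_le) (auto simp: True param_cyl_def)
    also have "\<dots> < ereal \<epsilon>" using that by simp
    finally show ?thesis .
  qed
  show ?thesis
  proof (intro exI[of _ 1] conjI allI impI ballI)
    fix u :: "real \<times> (real^'n) \<times> (real^'D) \<Rightarrow> real" and \<epsilon> :: real
    assume "\<epsilon> \<in> {0<..<1}"
    then have "0 < \<epsilon>" "0 \<le> ln (1 / \<epsilon>)" by auto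
    then show "\<exists>\<Phi>. is_nn d \<Phi> \<and> output_dim \<Phi> = 1 \<and>
      real (num_layers \<Phi>) \<le> 1 * (ln (1 / \<epsilon>) + 1) \<and>
      real (num_weights \<Phi>) \<le>
        1 * (\<epsilon> powr (- 1 / r) + \<epsilon> powr (- real d / real k)) * (ln (1 / \<epsilon>) + 1) \<and>
      Linf_norm (param_cyl T K) (\<lambda>p. u p - nn_fun \<Phi> p) < ereal \<epsilon>"
      using \<Phi> Linf[of \<epsilon> u] by (intro exI[of _ \<Phi>]) auto
  qed simp
next
  case False
  define \<kappa> where "\<kappa> = set_bound K"
  have K\<kappa>: "norm x \<le> \<kappa>" if "x \<in> K" for x
  proof -
    have "bounded (norm ` K)"
      using assms(6) by (intro compact_imp_bounded compact_continuous_image continuous_intros)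
    then show ?thesis unfolding \<kappa>_def set_bound_def using that
      by (intro cSUP_upper bounded_imp_bdd_above)
  qed
  have \<kappa>: "0 \<le> \<kappa>" using False K\<kappa> norm_ge_zero order_trans by blast
  have d: "DIM(real \<times> (real^'n) \<times> (real^'D)) = d" using assms(7) by simp
  define n where "n = real DIM(real^'n)"
  have n: "1 \<le> n" unfolding n_def using DIM_positive[where 'a = "real^'n"] by linarith
  \<comment> \<open>There is no field \<open>V\<close> with \<open>M < 0\<close>, but the constant has to be chosen before \<open>V\<close>.\<close>
  define M' where "M' = max M 0"
  define C1 where "C1 = card (words k :: (real \<times> (real^'n) \<times> (real^'D)) list set) * M' + (real DIM(real \<times> (real^'n) \<times> (real^'D)) ^ k * M') * real DIM(real \<times> (real^'n) \<times> (real^'D)) ^ k"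
  define C2 where "C2 = (T + 1) * C1 + M'"
  \<comment> \<open>The largest scale that \<open>euler_jet\<close> allows.\<close>
  define \<rho> where "\<rho> = exp (- C2)"
  \<comment> \<open>The cylinder over the ball of radius \<kappa> lies in the ball of radius R, as a
    parameter has norm at most \<open>CARD('D)\<close>. In R', \<open>\<kappa> + T * M'\<close>
    bounds the end points of the scheme and 1 is the margin for the error in computing them.\<close>
  define R where "R = 1 + (T + \<kappa> + CARD('D))"
  define R' where "R' = \<kappa> + T * M' + 1"
  have M': "0 \<le> M'" by (simp add: M'_def)
  have \<rho>: "0 < \<rho>" "\<rho> * exp C2 \<le> 1" by (simp_all add: \<rho>_def exp_minus)
  have R1: "1 \<le> R" unfolding R_def using assms(2) \<kappa> by simp
  have A0: "0 \<le> \<kappa> + T * M' + (1 / \<rho>) ^ k" and B0: "0 \<le> (1 / \<rho>) ^ k"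
    using \<kappa> M' assms(2) \<rho> by simp_all
  obtain cF where cF: "0 < cF" "\<And>(S :: (real \<times> (real^'n) \<times> (real^'D)) set) f \<epsilon>. S \<subseteq> cball 0 R \<Longrightarrow>
      locally_poly k (\<kappa> + T * M' + (1 / \<rho>) ^ k) ((1 / \<rho>) ^ k) \<rho> S f \<Longrightarrow> 0 < \<epsilon> \<Longrightarrow> \<epsilon> < 1 \<Longrightarrow>
      \<exists>L W g. computes L W g \<and> real L \<le> cF * (ln (1 / \<epsilon>) + 1) \<and>
        real W \<le> cF * \<epsilon> powr (- real DIM(real \<times> (real^'n) \<times> (real^'D)) / real k) * (ln (1 / \<epsilon>) + 1) \<and> (\<forall>q\<in>S. \<bar>g q - f q\<bar> \<le> \<epsilon>)"
    using locally_poly_circuit[OF assms(1) A0 B0 \<rho>(1) R1, where 'a = "real \<times> (real^'n) \<times> (real^'D)"] by blast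
  obtain Lu where Lu: "1 \<le> Lu" "\<And>x y. x \<in> cball 0 R' \<Longrightarrow> y \<in> cball 0 R' \<Longrightarrow> \<bar>u0 x - u0 y\<bar> \<le> Lu * norm (x - y)"
    by (rule C1_lipschitz_on_cball[OF assms(4)]) blast
  have "\<forall>K. compact K \<longrightarrow> (\<exists>c>0. \<forall>\<epsilon>\<in>{0<..<1}. \<exists>\<Phi>.
        is_nn DIM(real^'n) \<Phi> \<and> output_dim \<Phi> = 1 \<and>
        real (num_layers \<Phi>) \<le> c * (ln (1 / \<epsilon>) + 1) \<and>
        real (num_weights \<Phi>) \<le> c * \<epsilon> powr (- 1 / r) \<and>
        Linf_norm K (\<lambda>x. u0 x - nn_fun \<Phi> x) \<le> ereal \<epsilon>)"
    using assms(5) unfolding nn_approximable_def by (elim conjE)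
  from spec[OF this, of "cball 0 R'", THEN mp, OF compact_cball] obtain cu where cu: "0 < cu" "\<forall>\<epsilon>\<in>{0<..<1}. \<exists>\<Phi>.
        is_nn DIM(real^'n) \<Phi> \<and> output_dim \<Phi> = 1 \<and>
        real (num_layers \<Phi>) \<le> cu * (ln (1 / \<epsilon>) + 1) \<and>
        real (num_weights \<Phi>) \<le> cu * \<epsilon> powr (- 1 / r) \<and>
        Linf_norm (cball 0 R') (\<lambda>x. u0 x - nn_fun \<Phi> x) \<le> ereal \<epsilon>"
    by blast
  \<comment> \<open>The inner map has n components, each computed up to \<epsilon> / a, and
    \<open>u0\<close> stretches their joint error by at most Lu; the resulting bound is exactly
    \<epsilon> / 4.\<close>
  define a where "a = 4 * Lu * n"
  have "1 * 1 \<le> Lu * n" using Lu(1) n by (intro mult_mono) auto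
  then have a: "4 \<le> a" unfolding a_def by simp
  define \<Lambda> where "\<Lambda> = 1 + ln a"
  have \<Lambda>: "0 < \<Lambda>" "1 + ln 4 \<le> \<Lambda>" unfolding \<Lambda>_def using a by (simp_all add: add_pos_nonneg)
  \<comment> \<open>The first summand serves the depth, the second the weights of the n components,
    the third those of the network for \<open>u0\<close>, which composition doubles.\<close>
  define c where "c = (cF + cu) * \<Lambda> + n * cF * a powr (d / k) * \<Lambda> + 2 * cu * 4 powr (1 / r)"
  have pos: "0 < (cF + cu) * \<Lambda>" "0 \<le> n * cF * a powr (d / k) * \<Lambda>" "0 \<le> 2 * cu * 4 powr (1 / r)"
    using cF(1) cu(1) \<Lambda> n by simp_all
  have c: "0 < c" "(cF + cu) * \<Lambda> \<le> c" "n * cF * a powr (d / k) * \<Lambda> \<le> c" "2 * cu * 4 powr (1 / r) \<le> c"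
    unfolding c_def using pos by linarith+
  show ?thesis
  proof (intro exI[of _ c] conjI allI impI ballI)
    fix V :: "(real \<times> (real^'n) \<times> (real^'D)) \<Rightarrow> real^'n" and C :: real and u :: "(real \<times> (real^'n) \<times> (real^'D)) \<Rightarrow> real" and \<epsilon> :: real
    assume V: "Ck_on k (param_cyl T UNIV) V" and C: "0 < C"
      and growth: "\<forall>(t, x, \<eta>)\<in>param_cyl T UNIV. norm (V (t, x, \<eta>)) \<le> C * (1 + norm x)"
      and M: "Ck_norm k (param_cyl T UNIV) (param_cyl T (cball 0 (flow_radius K C T))) V = M"
      and u: "transport_solution T V u0 u" and "\<epsilon> \<in> {0<..<1}"
    then have \<epsilon>: "0 < \<epsilon>" "\<epsilon> < 1" by auto
    define G where "G = (\<kappa> + C * T) * exp (C * T)"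
    let ?\<Omega> = "{0..T} \<times> cball (0 :: real^'n) G \<times> cbox (0 :: real^'D) 1"
    let ?A = "{0..T} \<times> cball (0 :: real^'n) \<kappa> \<times> cbox (0 :: real^'D) 1"
    have \<Omega>_eq: "param_cyl T (cball 0 (flow_radius K C T)) = ?\<Omega>"
      by (simp add: param_cyl_def flow_radius_def G_def \<kappa>_def)
    have S: "coord_box (param_cyl T UNIV :: (real \<times> (real^'n) \<times> (real^'D)) set)" by (rule coord_box_param_cyl[OF assms(2)])
    have \<Omega>: "?\<Omega> \<subseteq> param_cyl T UNIV" "compact ?\<Omega>" "convex ?\<Omega>"
      by (auto simp: param_cyl_def intro!: compact_Times convex_Times)
    have VM: "norm (V P) \<le> M" if "P \<in> ?\<Omega>" for P
      using norm_word_deriv_le_Ck_norm[OF S V \<Omega>(1,2), of "[]" P] that M unfolding \<Omega>_eq by simp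
    have "0 \<le> G" unfolding G_def using \<kappa> C assms(2) by simp
    then have "(0, 0, 0) \<in> ?\<Omega>" using assms(2) by (auto simp: mem_box_cart)
    from order_trans[OF norm_ge_zero VM[OF this]] have MM: "M' = M" by (simp add: M'_def)
    have grow: "norm (V (t, x, \<eta>)) \<le> C * (1 + norm x)" if "t \<in> {0..T}" "\<eta> \<in> cbox 0 1" for t x \<eta>
      using bspec[OF growth, of "(t, x, \<eta>)"] that by (simp add: param_cyl_def)
    have e4: "0 < \<epsilon> / 4" using \<epsilon> by simp
    obtain N where NE: "euler_scheme V T C \<kappa> G M (cbox 0 1) N"
      "\<And>p. p \<in> ?A \<Longrightarrow> \<bar>u p - u0 (euler V N p N)\<bar> \<le> \<epsilon> / 4"
      using transport_euler_approx[OF assms(2) C \<kappa> e4 grow VM[unfolded G_def] Ck_on_imp_continuous_on[OF V] u]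
      unfolding G_def[symmetric] by blast
    interpret euler_scheme V T C \<kappa> G M "cbox 0 1" N by (rule NE(1))
    have \<Omega>0R: "?A \<subseteq> cball 0 R"
    proof
      fix p assume p: "p \<in> ?A"
      obtain t x \<eta> where txe: "p = (t, x, \<eta>)" by (cases p)
      have "norm \<eta> \<le> (\<Sum>i\<in>(UNIV :: 'D set). \<bar>vec_nth \<eta> i\<bar>)" by (rule norm_le_l1_cart)
      also have "\<dots> \<le> (\<Sum>i\<in>(UNIV :: 'D set). 1)"
        using p txe by (intro sum_mono) (auto simp: mem_box_cart)
      finally have "norm \<eta> \<le> CARD('D)" by simp
      moreover have "norm p \<le> norm t + (norm x + norm \<eta>)"
        unfolding txe using norm_Pair_le[of t "(x, \<eta>)"] norm_Pair_le[of x \<eta>] by linarith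
      moreover have "norm t \<le> T" "norm x \<le> \<kappa>" using p txe by auto
      ultimately show "p \<in> cball 0 R" unfolding R_def by simp
    qed
    have lp: "locally_poly k (\<kappa> + T * M' + (1 / \<rho>) ^ k) ((1 / \<rho>) ^ k) \<rho> ?A (\<lambda>p. euler V N p N \<bullet> b)"
      if b: "b \<in> Basis" for b
      unfolding MM
    proof (rule euler_locally_poly[where B = "real DIM(real \<times> (real^'n) \<times> (real^'D)) ^ k * M"])
      show "locally_poly k M (real DIM(real \<times> (real^'n) \<times> (real^'D)) ^ k * M) (real DIM(real \<times> (real^'n) \<times> (real^'D))) ?\<Omega> (\<lambda>P. V P \<bullet> i)" if "i \<in> Basis" for i
        by (rule Ck_field_locally_poly[OF S V \<Omega> _ that]) (use M in \<open>simp add: \<Omega>_eq\<close>)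
      show "0 \<le> M" using M' MM by simp
      then show "0 \<le> real DIM(real \<times> (real^'n) \<times> (real^'D)) ^ k * M" by simp
    qed (use assms(1) \<rho> b in \<open>simp_all only: C2_def C1_def MM\<close>)
    define \<epsilon>2 where "\<epsilon>2 = \<epsilon> / a"
    have \<epsilon>2: "0 < \<epsilon>2" "\<epsilon>2 < 1" unfolding \<epsilon>2_def using \<epsilon> a by (auto simp: field_simps)
    have \<epsilon>1: "\<epsilon> / 4 \<in> {0<..<1}" using \<epsilon> by simp
    obtain \<Phi> where \<Phi>: "is_nn DIM(real^'n) \<Phi>" "real (num_layers \<Phi>) \<le> cu * (ln (1 / (\<epsilon> / 4)) + 1)"
        "real (num_weights \<Phi>) \<le> cu * (\<epsilon> / 4) powr (- 1 / r)"
        "Linf_norm (cball 0 R') (\<lambda>x. u0 x - nn_fun \<Phi> x) \<le> ereal (\<epsilon> / 4)"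
      using bspec[OF cu(2) \<epsilon>1] by blast
    have \<Phi>_near: "\<bar>u0 x - nn_fun \<Phi> x\<bar> \<le> \<epsilon> / 4" if "norm x < R'" for x
      by (rule Linf_norm_imp_bound[OF \<Phi>(4) _ that])
        (intro continuous_on_diff Ck_on_imp_continuous_on[OF assms(4)] continuous_on_nn_fun[OF \<Phi>(1)])
    have n\<epsilon>2: "Lu * (n * \<epsilon>2) = \<epsilon> / 4" unfolding \<epsilon>2_def a_def using Lu(1) n by simp
    have "n * \<epsilon>2 \<le> Lu * (n * \<epsilon>2)" using Lu(1) n \<epsilon>2 mult_right_mono[of 1 Lu "n * \<epsilon>2"] by simp
    then have n\<epsilon>2': "n * \<epsilon>2 < 1" using n\<epsilon>2 \<epsilon> by linarith
    have components: "\<exists>L W g. computes L W g \<and> real L \<le> cF * (ln (1 / \<epsilon>2) + 1) \<and>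
          real W \<le> cF * \<epsilon>2 powr (- real DIM(real \<times> (real^'n) \<times> (real^'D)) / real k) * (ln (1 / \<epsilon>2) + 1) \<and>
          (\<forall>q\<in>?A. \<bar>g q - euler V N q N \<bullet> b\<bar> \<le> \<epsilon>2)" if "b \<in> Basis" for b
      by (rule cF(2)[OF \<Omega>0R lp[OF that] \<epsilon>2])
    have inside: "norm (euler V N q N) + real DIM(real^'n) * \<epsilon>2 < R'" if "q \<in> ?A" for q
      using euler_final_norm[OF that] n\<epsilon>2' unfolding R'_def MM n_def by linarith
    have Lu0: "0 \<le> Lu" using Lu(1) by simp
    from network_of_composition[OF components \<Phi>(1,2,3) \<Phi>_near Lu0 Lu(2) inside less_imp_le[OF \<epsilon>2(1)] NE(2)]
    obtain \<Psi> where \<Psi>: "is_nn DIM(real \<times> (real^'n) \<times> (real^'D)) \<Psi>" "output_dim \<Psi> = 1"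
      "real (num_layers \<Psi>) \<le> cF * (ln (1 / \<epsilon>2) + 1) + cu * (ln (1 / (\<epsilon> / 4)) + 1)"
      "real (num_weights \<Psi>) \<le> n *
         (cF * \<epsilon>2 powr (- real DIM(real \<times> (real^'n) \<times> (real^'D)) / real k) * (ln (1 / \<epsilon>2) + 1)) +
         2 * (cu * (\<epsilon> / 4) powr (- 1 / r))"
      "\<forall>q\<in>?A. \<bar>u q - nn_fun \<Psi> q\<bar> \<le> \<epsilon> / 4 + Lu * (n * \<epsilon>2) + \<epsilon> / 4"
      unfolding n_def[symmetric] by blast
    define l where "l = ln (1 / \<epsilon>) + 1"
    have l: "1 \<le> l" unfolding l_def using \<epsilon> by simp
    have l2: "ln (1 / \<epsilon>2) + 1 \<le> \<Lambda> * l"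
      unfolding \<epsilon>2_def \<Lambda>_def l_def using a \<epsilon> by (intro log_scale_bound) auto
    have "ln (1 / (\<epsilon> / 4)) + 1 \<le> (1 + ln 4) * l"
      unfolding l_def using \<epsilon> by (intro log_scale_bound) auto
    also have "\<dots> \<le> \<Lambda> * l" using \<Lambda> l by (intro mult_right_mono) auto
    finally have l4: "ln (1 / (\<epsilon> / 4)) + 1 \<le> \<Lambda> * l" .
    have "real (num_layers \<Psi>) \<le> cF * (\<Lambda> * l) + cu * (\<Lambda> * l)"
      using cF(1) cu(1) l2 l4 by (intro order_trans[OF \<Psi>(3)] add_mono mult_left_mono) auto
    also have "\<dots> = (cF + cu) * \<Lambda> * l" by (simp add: algebra_simps)
    also have "\<dots> \<le> c * l" using c l by (intro mult_right_mono) auto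
    finally have layers: "real (num_layers \<Psi>) \<le> c * l" .
    define E1 where "E1 = \<epsilon> powr (- 1 / r)"
    define E2 where "E2 = \<epsilon> powr (- real d / real k)"
    have E: "0 \<le> E1" "0 \<le> E2" by (simp_all add: E1_def E2_def)
    have p2: "\<epsilon>2 powr (- real DIM(real \<times> (real^'n) \<times> (real^'D)) / real k) = a powr (d / k) * E2"
      unfolding d \<epsilon>2_def E2_def using powr_scale[of a \<epsilon> "d / k"] a \<epsilon> by simp
    have p4: "(\<epsilon> / 4) powr (- 1 / r) = 4 powr (1 / r) * E1"
      unfolding E1_def using powr_scale[of 4 \<epsilon> "1 / r"] \<epsilon> by simp
    have "real (num_weights \<Psi>) \<le> n * (cF * (a powr (d / k) * E2) * (\<Lambda> * l)) + 2 * (cu * (4 powr (1 / r) * E1)) * l"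
    proof (rule order_trans[OF \<Psi>(4)])
      have "n * (cF * (a powr (d / k) * E2) * (ln (1 / \<epsilon>2) + 1)) \<le> n * (cF * (a powr (d / k) * E2) * (\<Lambda> * l))"
        using l2 n cF(1) E by (intro mult_left_mono) auto
      \<comment> \<open>The part for \<open>u0\<close> has no logarithm; since
        \<open>1 \<le> l\<close>, one may be inserted to match the common form.\<close>
      moreover have "2 * (cu * (4 powr (1 / r) * E1)) * 1 \<le> 2 * (cu * (4 powr (1 / r) * E1)) * l"
        using l cu(1) E by (intro mult_left_mono) auto
      ultimately show "n * (cF * \<epsilon>2 powr (- real DIM(real \<times> (real^'n) \<times> (real^'D)) / real k) * (ln (1 / \<epsilon>2) + 1)) + 2 * (cu * (\<epsilon> / 4) powr (- 1 / r))
          \<le> n * (cF * (a powr (d / k) * E2) * (\<Lambda> * l)) + 2 * (cu * (4 powr (1 / r) * E1)) * l"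
        unfolding p2 p4 by linarith
    qed
    also have "\<dots> = (n * cF * a powr (d / k) * \<Lambda>) * (E2 * l) + (2 * cu * 4 powr (1 / r)) * (E1 * l)"
      by (simp add: mult_ac)
    also have "\<dots> \<le> c * (E2 * l) + c * (E1 * l)"
      using c E l by (intro add_mono mult_right_mono mult_nonneg_nonneg) auto
    also have "\<dots> = c * (E1 + E2) * l" by (simp add: algebra_simps)
    finally have weights: "real (num_weights \<Psi>) \<le> c * (E1 + E2) * l" .
    have sub: "param_cyl T K \<subseteq> ?A" using K\<kappa> by (auto simp: param_cyl_def)
    \<comment> \<open>Three errors of \<epsilon> / 4 each leave room for the strict
      inequality.\<close>
    have "Linf_norm (param_cyl T K) (\<lambda>p. u p - nn_fun \<Psi> p) \<le> ereal (3 * \<epsilon> / 4)"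
    proof (rule Linf_norm_le)
      show "compact (param_cyl T K :: (real \<times> (real^'n) \<times> (real^'D)) set)"
        unfolding param_cyl_def using assms(6) by (intro compact_Times compact_Icc compact_cbox)
      have "continuous_on (param_cyl T UNIV) u"
        using u by (auto simp: transport_solution_def Let_def)
      then have "continuous_on (param_cyl T K) u"
        by (rule continuous_on_subset) (auto simp: param_cyl_def)
      then show "continuous_on (param_cyl T K) (\<lambda>p. u p - nn_fun \<Psi> p)"
        by (intro continuous_on_diff continuous_on_nn_fun[OF \<Psi>(1)])
      show "\<bar>u p - nn_fun \<Psi> p\<bar> \<le> 3 * \<epsilon> / 4" if "p \<in> param_cyl T K" for p
        using bspec[OF \<Psi>(5), of p] sub that unfolding n\<epsilon>2 by auto
    qed
    also have "\<dots> < ereal \<epsilon>" using \<epsilon> by simp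
    finally have "Linf_norm (param_cyl T K) (\<lambda>p. u p - nn_fun \<Psi> p) < ereal \<epsilon>" .
    then show "\<exists>\<Phi>. is_nn d \<Phi> \<and> output_dim \<Phi> = 1 \<and>
      real (num_layers \<Phi>) \<le> c * (ln (1 / \<epsilon>) + 1) \<and>
      real (num_weights \<Phi>) \<le>
        c * (\<epsilon> powr (- 1 / r) + \<epsilon> powr (- real d / real k)) * (ln (1 / \<epsilon>) + 1) \<and>
      Linf_norm (param_cyl T K) (\<lambda>p. u p - nn_fun \<Phi> p) < ereal \<epsilon>"
      using \<Psi>(1,2) layers weights unfolding d l_def E1_def E2_def by blast
  qed (rule c(1))
qed

end
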